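(* Let $t$ be a positive integer and let $\mathcal{F}_{sim}(t)$ be the $3$-graph defined below. For sufficiently large $n$, $$\mathrm{ex}_3(n,\mathcal{F}_{sim}(t))=\max_{a+b+c=n-t}\left\{abc+t\left(\binom{a}{2}+\binom{b}{2}+\binom{c}{2}\right)\right\}+\binom{t}{3},$$ where the maximum is over positive integers $a,b,c$. The maximum is achieved when $a,b,c$ differ pairwise by at most $1$. Moreover, an $n$-vertex $\mathcal{F}_{sim}(t)$-free $3$-graph has exactly this many hyperedges if and only if it is the following $3$-graph: take the complete $3$-partite $3$-graph $T_3(n-t,3)$ and a disjoint set $Q$ of $t$ further vertices; the hyperedges are those of $T_3(n-t,3)$, all triples inside $Q$, and all triples $\{q,x,y\}$ with $q\in Q$ and $x,y$ two vertices lying in the same part of $T_3(n-t,3)$.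
   Context: All hypergraphs are $3$-uniform. $\mathrm{ex}_3(n,\mathcal{F})$ is the maximum number of hyperedges in an $n$-vertex $3$-graph with no copy of $\mathcal{F}$ as a subhypergraph. $T_3(N,3)$ is the complete $3$-partite $3$-graph on $N$ vertices (hyperedges are triples with one vertex in each part) with part sizes $\lfloor N/3\rfloor$ or $\lceil N/3\rceil$. $\mathcal{F}_{sim}(t)$ is the $3$-graph with vertices $f_1,\dots,f_7,g_1,\dots,g_t$ and hyperedges $f_1f_2f_3$, $f_1f_2f_4$, $f_3f_4f_5$, $f_5f_6f_7$, and $f_6f_7g_i$ for $i=1,\dots,t$ (i.e. the $3$-graph $\{f_1f_2f_3,f_1f_2f_4,f_3f_4f_5,f_5f_6f_7,f_6f_7f_8\}$ with the vertex $f_8$ blown up into $t$ copies). *)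

theory Defs
  imports Complex_Main
begin

text \<open>A hypergraph is a pair of a vertex set and a set of hyperedges.\<close>

type_synonym 'a hypergraph = "'a set \<times> 'a set set"

abbreviation verts :: "'a hypergraph \<Rightarrow> 'a set" where "verts \<equiv> fst"
abbreviation hedges :: "'a hypergraph \<Rightarrow> 'a set set" where "hedges \<equiv> snd"

definition three_graph :: "'a hypergraph \<Rightarrow> bool" where
  "three_graph H \<longleftrightarrow> finite (verts H) \<and> (\<forall>e\<in>hedges H. e \<subseteq> verts H \<and> card e = 3)"

text \<open>Copies are not required to be induced.\<close>

definition contains_copy :: "'a hypergraph \<Rightarrow> 'b hypergraph \<Rightarrow> bool" where
  "contains_copy H F \<longleftrightarrow>
     (\<exists>\<phi>. inj_on \<phi> (verts F) \<and> \<phi> ` verts F \<subseteq> verts H \<and> (\<forall>e\<in>hedges F. \<phi> ` e \<in> hedges H))"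

text \<open>
  It suffices to consider 3-graphs on the fixed vertex set \<open>{..<n}\<close>, since every
  \<open>n\<close>-vertex 3-graph is isomorphic to one of those. The maximum is over a finite set, which is
  nonempty whenever \<open>F\<close> has a hyperedge.
\<close>

definition ex3 :: "nat \<Rightarrow> 'b hypergraph \<Rightarrow> nat" where
  "ex3 n F = Max {card (hedges H) | H :: nat hypergraph.
      three_graph H \<and> verts H = {..<n} \<and> \<not> contains_copy H F}"

datatype fsim_vertex = Vf nat | Vg nat

definition F_sim :: "nat \<Rightarrow> fsim_vertex hypergraph" where
  "F_sim t =
     (Vf ` {1..7} \<union> Vg ` {1..t},
      {{Vf 1, Vf 2, Vf 3}, {Vf 1, Vf 2, Vf 4}, {Vf 3, Vf 4, Vf 5}, {Vf 5, Vf 6, Vf 7}}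
        \<union> {{Vf 6, Vf 7, Vg i} | i. i \<in> {1..t}})"

definition part_count :: "nat \<Rightarrow> nat \<Rightarrow> nat \<Rightarrow> nat \<Rightarrow> nat" where
  "part_count t a b c = a * b * c + t * ((a choose 2) + (b choose 2) + (c choose 2))"

definition max_part_count :: "nat \<Rightarrow> nat \<Rightarrow> nat" where
  "max_part_count t N =
     Max {part_count t a b c | a b c. a > 0 \<and> b > 0 \<and> c > 0 \<and> a + b + c = N}"

text \<open>\<open>X\<close>, \<open>Y\<close>, \<open>Z\<close> are the parts of a copy of \<open>T\<^sub>3(N,3)\<close>.\<close>

definition T3_parts :: "nat \<Rightarrow> 'a set \<Rightarrow> 'a set \<Rightarrow> 'a set \<Rightarrow> bool" where
  "T3_parts N X Y Z \<longleftrightarrow>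
     finite (X \<union> Y \<union> Z) \<and> X \<inter> Y = {} \<and> X \<inter> Z = {} \<and> Y \<inter> Z = {} \<and>
     card (X \<union> Y \<union> Z) = N \<and>
     (\<forall>P\<in>{X, Y, Z}. int (card P) = \<lfloor>real N / 3\<rfloor> \<or> int (card P) = \<lceil>real N / 3\<rceil>)"

definition complete_3partite_edges :: "'a set \<Rightarrow> 'a set \<Rightarrow> 'a set \<Rightarrow> 'a set set" where
  "complete_3partite_edges X Y Z = {{x, y, z} | x y z. x \<in> X \<and> y \<in> Y \<and> z \<in> Z}"

definition is_extremal_graph :: "nat \<Rightarrow> nat \<Rightarrow> 'a hypergraph \<Rightarrow> bool" where
  "is_extremal_graph t n H \<longleftrightarrow>
     (\<exists>X Y Z Q. T3_parts (n - t) X Y Z \<and>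
        finite Q \<and> card Q = t \<and> Q \<inter> (X \<union> Y \<union> Z) = {} \<and>
        verts H = X \<union> Y \<union> Z \<union> Q \<and>
        hedges H = complete_3partite_edges X Y Z
          \<union> {e. e \<subseteq> Q \<and> card e = 3}
          \<union> {{q, x, y} | q x y. q \<in> Q \<and> x \<noteq> y \<and> (\<exists>P\<in>{X, Y, Z}. x \<in> P \<and> y \<in> P)})"

end

theory Submission
  imports Defs
begin

text \<open>
  Deleting \<open>O(n\<^sup>2)\<close> edges from an \<open>F_sim\<close>-free graph leaves a subgraph in which every covered pair has
  large codegree. In it a copy of \<open>F\<^sub>5 = {abc, abd, cde}\<close> extends greedily to \<open>F_sim\<close>, so the subgraph is
  cancellative. After passing to large minimum degree, pairwise covered vertices of a cancellative
  graph have disjoint links, so the shadow has no \<open>K\<^sub>5\<close>, hence by Turan's theorem no \<open>K\<^sub>4\<close>, and its large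
  minimum degree makes almost all of the graph tripartite with parts \<open>A\<close>, \<open>B\<close>, \<open>C\<close>.

  Back in the original graph, a vertex with large transversal link cannot be the tip \<open>e\<close> of an \<open>F\<^sub>5\<close>.
  Hence no edge inside \<open>A \<union> B \<union> C\<close> contains two vertices of one part, and every remaining vertex has
  a link that consists almost entirely of pairs inside the parts, or else has degree well below
  \<open>n\<^sup>2/9\<close>. A pair inside a part is covered by at most \<open>t\<close> vertices of the first kind. Since adding such a
  vertex costs \<open>n\<^sup>2/9\<close> transversal edges and gains at most \<open>n\<^sup>2/6\<close>, edge counting forces exactly \<open>t\<close> of
  them and none of the second kind. Finally, no edge consists of two of them and
  a vertex of \<open>A \<union> B \<union> C\<close>, and a pair across two parts that lies in one of their links has small
  codegree, so it costs more transversal edges than it gains.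
\<close>

section \<open>Turan's theorem\<close>

text \<open>Cleaning deletes up to \<open>(t + 5) * n\<^sup>2\<close> edges, more than the term
  \<open>t * n\<^sup>2 / 18\<close> that decides the answer. The cleaned graph therefore only
  locates \<open>A\<close>, \<open>B\<close>, \<open>C\<close>; all decisive counts are made in the
  original graph, where pairs of small codegree survive and are charged to about
  \<open>n / 4\<close> missing transversals each. The core is made maximal before counting.
  Otherwise a left-over vertex could have a transversal link as large as a typical one and would not
  show up as a loss; maximality caps each of its three crossing links at
  \<open>n\<^sup>2 / 10\<close>, strictly below \<open>n\<^sup>2 / 9\<close>. The deficit of
  transversals is written as \<open>\<sigma>\<^sup>2 * n\<^sup>3 / 12\<close>: at most
  \<open>\<sigma> * n\<^sup>2 / 12\<close> pairs across two given parts can then miss more than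
  \<open>\<sigma> * n\<close> third vertices, so one power of \<open>\<sigma>\<close> pays for the
  threshold and one remains. \<open>\<sigma>\<close> is of order \<open>1 / t\<close>, so that
  \<open>t\<close> errors of size \<open>\<sigma> * n\<^sup>2\<close> stay below the gaps between
  1/6, 1/9 and 1/10.\<close>

lemma turan:
  fixes G :: "('a \<times> 'a) set"
  assumes "finite V" "G \<subseteq> V \<times> V" "sym G" "irrefl G" "r \<ge> 1"
    and "\<And>S. S \<subseteq> V \<Longrightarrow> card S = Suc r \<Longrightarrow> \<exists>x\<in>S. \<exists>y\<in>S. x \<noteq> y \<and> (x, y) \<notin> G"
  shows "real r * card G \<le> (real r - 1) * (card V)\<^sup>2"
  using \<open>r \<ge> 1\<close> assms(1-4,6)
proof (induction r arbitrary: V G rule: nat_induct_at_least)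
  case base
  have "G = {}"
  proof (rule ccontr)
    assume "G \<noteq> {}"
    then obtain x y where xy: "(x, y) \<in> G" by auto
    then have "x \<noteq> y" using base by (auto simp: irrefl_def)
    then have "\<exists>u\<in>{x, y}. \<exists>v\<in>{x, y}. u \<noteq> v \<and> (u, v) \<notin> G"
      using base.prems(2) base.prems(5)[of "{x, y}"] xy base by (auto simp: card_insert_if)
    then show False using xy base by (auto dest: symD)
  qed
  then show ?case by simp
next
  case (Suc r)
  show ?case
  proof (cases "V = {}")
    case True then show ?thesis using Suc by auto
  next
    case False
    define dg where "dg v = card (G `` {v})" for v
    have "Max (dg ` V) \<in> dg ` V" using False Suc.prems(1) by (intro Max_in) auto
    then obtain v where v: "v \<in> V" "\<And>u. u \<in> V \<Longrightarrow> dg u \<le> dg v"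
      using Suc.prems(1) by (metis (no_types, lifting) Max_ge finite_imageI image_iff)
    \<comment> \<open>A clique of \<open>Suc r\<close> vertices in the neighbourhood of
      \<open>v\<close> would extend by \<open>v\<close>, so the induction hypothesis applies inside
      \<open>N\<close>; maximality of \<open>v\<close> bounds all other degrees by
      \<open>card N\<close>.\<close>
    define N where "N = G `` {v}"
    have NV: "N \<subseteq> V" using Suc.prems(2) by (auto simp: N_def)
    have fN: "finite N" using NV Suc.prems(1) finite_subset by auto
    have fG: "finite G" using Suc.prems finite_subset by blast
    have IH: "real r * card (G \<inter> N \<times> N) \<le> (real r - 1) * (card N)\<^sup>2"
    proof (rule Suc.IH)
      show "sym (G \<inter> N \<times> N)" using Suc.prems(3) by (auto simp: sym_def)
      show "irrefl (G \<inter> N \<times> N)" using Suc.prems(4) by (auto simp: irrefl_def)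
      fix S assume S: "S \<subseteq> N" "card S = Suc r"
      have "v \<notin> N" using Suc.prems(4) by (auto simp: irrefl_def N_def)
      then have "v \<notin> S" using S by auto
      then have "card (insert v S) = Suc (Suc r)" using S fN by (simp add: finite_subset)
      then obtain x y where "x \<in> insert v S" "y \<in> insert v S" "x \<noteq> y" "(x, y) \<notin> G"
        using Suc.prems(5)[of "insert v S"] S NV v(1) by auto
      moreover have "\<And>z. z \<in> S \<Longrightarrow> (v, z) \<in> G \<and> (z, v) \<in> G"
        using S Suc.prems(3) by (auto simp: N_def dest: symD)
      ultimately show "\<exists>x\<in>S. \<exists>y\<in>S. x \<noteq> y \<and> (x, y) \<notin> G \<inter> N \<times> N" by auto
    qed (use fN in auto)
    define G1 where "G1 = Sigma (V - N) (\<lambda>x. G `` {x})"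
    have fG1: "finite G1" unfolding G1_def using Suc.prems(1) fG by (intro finite_SigmaI) auto
    have "card G1 = (\<Sum>x\<in>V - N. dg x)"
      unfolding G1_def dg_def using Suc.prems(1) fG by (subst card_SigmaI) auto
    also have "\<dots> \<le> card (V - N) * dg v" using v by (intro sum_bounded_above[where K="dg v", simplified]) auto
    finally have G1: "card G1 \<le> card (V - N) * dg v" .
    \<comment> \<open>A pair not inside \<open>N\<close> has an end outside \<open>N\<close>:
      \<open>G1\<close> holds the pairs that start there, its converse those that end there.\<close>
    have "G \<subseteq> (G \<inter> N \<times> N) \<union> G1 \<union> G1\<inverse>"
      using Suc.prems(2,3) by (auto simp: G1_def dest: symD)
    then have "card G \<le> card ((G \<inter> N \<times> N) \<union> G1 \<union> G1\<inverse>)"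
      using fG fG1 by (intro card_mono) auto
    also have "\<dots> \<le> card (G \<inter> N \<times> N) + card G1 + card G1"
      by (metis (no_types, lifting) card_Un_le card_inverse order_trans add_le_mono1)
    finally have "card G \<le> card (G \<inter> N \<times> N) + 2 * (card (V - N) * dg v)" using G1 by simp
    then have g: "real (card G) \<le> card (G \<inter> N \<times> N) + 2 * (real (card (V - N)) * card N)"
      unfolding dg_def N_def by (metis (mono_tags, lifting) of_nat_add of_nat_le_iff of_nat_mult of_nat_numeral)
    have n: "real (card (V - N)) = card V - real (card N)"
      using NV Suc.prems(1) fN by (simp add: card_Diff_subset card_mono of_nat_diff)
    define d where "d = real (card N)"
    define n where "n = real (card V)"
    define R where "R = real r"
    have R: "R \<ge> 1" using Suc.hyps by (simp add: R_def)
    have "R * card G \<le> R * (card (G \<inter> N \<times> N) + 2 * ((n - d) * d))"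
      using g n R unfolding d_def n_def by (intro mult_left_mono) auto
    also have "\<dots> \<le> (R - 1) * d\<^sup>2 + 2 * R * ((n - d) * d)" using IH unfolding d_def R_def by (simp add: algebra_simps)
    finally have "(R + 1) * (R * card G) \<le> (R + 1) * ((R - 1) * d\<^sup>2 + 2 * R * ((n - d) * d))"
      using R by (intro mult_left_mono) auto
    \<comment> \<open>Completing the square; equality would need \<open>d = R * n / (R + 1)\<close>,
      the degree in the Turan graph with \<open>r + 1\<close> parts.\<close>
    also have "\<dots> = R * (R * n\<^sup>2) - (R * n - (R + 1) * d)\<^sup>2" by (simp add: power2_eq_square algebra_simps)
    also have "\<dots> \<le> R * (R * n\<^sup>2)" by simp
    finally have "R * ((R + 1) * card G) \<le> R * (R * n\<^sup>2)" by (simp add: algebra_simps)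
    then have "(R + 1) * card G \<le> R * n\<^sup>2" using R by simp
    then show ?thesis by (simp add: R_def n_def algebra_simps)
  qed
qed

section \<open>Cancellative 3-graphs\<close>

text \<open>Ordered pairs: the full link counts each edge at \<open>v\<close> twice, its
  intersection with \<open>B \<times> C\<close> for disjoint \<open>B\<close>, \<open>C\<close> only
  once.\<close>

definition link :: "'a set set \<Rightarrow> 'a \<Rightarrow> ('a \<times> 'a) set" where
  "link E v = {(x, y). {v, x, y} \<in> E}"

definition shadow :: "'a set set \<Rightarrow> ('a \<times> 'a) set" where
  "shadow E = {(x, y). x \<noteq> y \<and> (\<exists>z. {x, y, z} \<in> E)}"

text \<open>\<open>e\<close> may equal \<open>a\<close> or \<open>b\<close>, so \<open>K_4\<close>
  minus an edge is forbidden along with \<open>F_5\<close>. For 3-graphs this says that no edge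
  contains the symmetric difference of two distinct edges.\<close>

definition cancellative :: "'a set set \<Rightarrow> bool" where
  "cancellative E \<longleftrightarrow> (\<forall>a b c d e. {a, b, c} \<in> E \<longrightarrow> {a, b, d} \<in> E \<longrightarrow> c \<noteq> d \<longrightarrow> {c, d, e} \<notin> E)"

definition transversals :: "'a set set \<Rightarrow> 'a set \<Rightarrow> 'a set \<Rightarrow> 'a set \<Rightarrow> ('a \<times> 'a \<times> 'a) set" where
  "transversals E A B C = Sigma A (\<lambda>x. link E x \<inter> B \<times> C)"

lemma card_3_distinct: "card {x, y, z} = 3 \<longleftrightarrow> x \<noteq> y \<and> x \<noteq> z \<and> y \<noteq> z"
  by (auto simp: card_insert_if)

lemma three_graph_edge:
  assumes "three_graph (V, E)" "{x, y, z} \<in> E"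
  shows "x \<noteq> y \<and> x \<noteq> z \<and> y \<noteq> z \<and> x \<in> V \<and> y \<in> V \<and> z \<in> V"
proof -
  have "card {x, y, z} = 3" "{x, y, z} \<subseteq> V" using assms by (auto simp: three_graph_def)
  then show ?thesis by (auto simp: card_3_distinct)
qed

lemma three_graph_finite:
  assumes "three_graph (V, E)" shows "finite V" "finite E"
proof -
  show "finite V" using assms by (simp add: three_graph_def)
  moreover have "E \<subseteq> Pow V" using assms by (auto simp: three_graph_def)
  ultimately show "finite E" by (meson finite_Pow_iff finite_subset)
qed

lemma three_graph_subset:
  assumes "three_graph (V, E)" "E' \<subseteq> E" shows "three_graph (V, E')"
  using assms by (auto simp: three_graph_def)

lemma three_graph_induced:
  assumes "three_graph (V, E)" "U \<subseteq> V" shows "three_graph (U, {e \<in> E. e \<subseteq> U})"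
  using assms by (auto simp: three_graph_def finite_subset)

lemma cancellative_subset: "cancellative E \<Longrightarrow> E' \<subseteq> E \<Longrightarrow> cancellative E'"
  unfolding cancellative_def by blast

lemma link_subset: "three_graph (V, E) \<Longrightarrow> link E v \<subseteq> V \<times> V"
  unfolding link_def using three_graph_edge by fastforce

lemma finite_link: "three_graph (V, E) \<Longrightarrow> finite (link E v)"
  by (rule finite_subset[OF link_subset]) (auto dest: three_graph_finite)

lemma sym_link: "sym (link E v)"
  by (auto simp: sym_def link_def insert_commute)

lemma irrefl_link: "three_graph (V, E) \<Longrightarrow> irrefl (link E v)"
  using three_graph_edge unfolding irrefl_def link_def by fastforce

lemma shadow_subset: "three_graph (V, E) \<Longrightarrow> shadow E \<subseteq> V \<times> V"
  unfolding shadow_def using three_graph_edge by fastforce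

lemma finite_shadow: "three_graph (V, E) \<Longrightarrow> finite (shadow E)"
  by (rule finite_subset[OF shadow_subset]) (auto dest: three_graph_finite)

lemma sym_shadow: "sym (shadow E)"
  by (auto simp: sym_def shadow_def insert_commute)

lemma irrefl_shadow: "irrefl (shadow E)"
  by (auto simp: irrefl_def shadow_def)

lemma edge_shadow:
  assumes "three_graph (V, E)" "{x, y, z} \<in> E"
  shows "(x, y) \<in> shadow E" "(y, x) \<in> shadow E" "(x, z) \<in> shadow E" "(z, x) \<in> shadow E" "(y, z) \<in> shadow E" "(z, y) \<in> shadow E"
proof -
  have d: "x \<noteq> y" "x \<noteq> z" "y \<noteq> z" using three_graph_edge[OF assms] by auto
  have "{x, z, y} \<in> E" "{y, z, x} \<in> E" using assms(2) by (auto simp: insert_commute)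
  then show "(x, y) \<in> shadow E" "(x, z) \<in> shadow E" "(y, z) \<in> shadow E" using d assms(2) by (auto simp: shadow_def)
  then show "(y, x) \<in> shadow E" "(z, x) \<in> shadow E" "(z, y) \<in> shadow E" using sym_shadow[of E] by (auto dest: symD)
qed

lemma card_link:
  assumes "three_graph (V, E)"
  shows "card (link E v) = 2 * card {e \<in> E. v \<in> e}"
proof -
  define D where "D = {e \<in> E. v \<in> e}"
  define P where "P e = {(x, y). {v, x, y} = e}" for e
  have link: "link E v = (\<Union>e\<in>D. P e)" by (auto simp: link_def D_def P_def)
  have P: "card (P e) = 2 \<and> finite (P e)" if "e \<in> D" for e
  proof -
    have "card e = 3" "v \<in> e" using that assms by (auto simp: D_def three_graph_def)
    then have "card (e - {v}) = 2" by (simp add: card_Diff_singleton)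
    then obtain x y where xy: "e - {v} = {x, y}" "x \<noteq> y" by (meson card_2_iff)
    then have e: "e = {v, x, y}" "v \<noteq> x" "v \<noteq> y" using \<open>v \<in> e\<close> by auto
    have "P e = {(x, y), (y, x)}"
    proof -
      have "(a, b) = (x, y) \<or> (a, b) = (y, x)" if ab: "{v, a, b} = {v, x, y}" for a b
      proof -
        have "card {v, a, b} = 3" using ab e(2,3) xy(2) by simp
        then have "v \<noteq> a" "v \<noteq> b" "a \<noteq> b" by (auto simp: card_3_distinct)
        moreover have "a \<in> {v, x, y}" "b \<in> {v, x, y}" using ab by auto
        ultimately show ?thesis by auto
      qed
      then show ?thesis unfolding P_def e(1) by (auto simp: insert_commute)
    qed
    then show ?thesis using xy(2) by simp
  qed
  have "card (link E v) = (\<Sum>e\<in>D. card (P e))"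
    unfolding link using three_graph_finite[OF assms] P
    by (intro card_UN_disjoint) (auto simp: D_def P_def)
  also have "\<dots> = (\<Sum>e\<in>D. 2)" using P by (intro sum.cong) auto
  finally show ?thesis by (simp add: D_def)
qed

text \<open>The links are disjoint, since a common pair \<open>x y\<close> of covered
  \<open>i\<close>, \<open>j\<close> gives the forbidden \<open>{x, y, i}\<close>,
  \<open>{x, y, j}\<close>, \<open>{i, j, z}\<close>; and a link pair is itself covered, so all
  links lie in the shadow.\<close>

lemma card_link_union:
  assumes tg: "three_graph (V, E)" and c: "cancellative E" and "S \<subseteq> V"
    and cl: "\<And>x y. x \<in> S \<Longrightarrow> y \<in> S \<Longrightarrow> x \<noteq> y \<Longrightarrow> (x, y) \<in> shadow E"
  shows "(\<Sum>v\<in>S. card (link E v)) \<le> card (shadow E)"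
proof -
  have fS: "finite S" using assms three_graph_finite finite_subset by metis
  have "(\<Sum>v\<in>S. card (link E v)) = card (\<Union>v\<in>S. link E v)"
  proof (subst card_UN_disjoint)
    show "\<forall>i\<in>S. \<forall>j\<in>S. i \<noteq> j \<longrightarrow> link E i \<inter> link E j = {}"
    proof (intro ballI impI equals0I)
      fix i j p assume ij: "i \<in> S" "j \<in> S" "i \<noteq> j" and p: "p \<in> link E i \<inter> link E j"
      obtain x y where xy: "p = (x, y)" by force
      have "{x, y, i} \<in> E" "{x, y, j} \<in> E" using p by (auto simp: link_def xy insert_commute)
      moreover obtain z where "{i, j, z} \<in> E" using cl[OF ij] by (auto simp: shadow_def)
      ultimately show False using c ij(3) unfolding cancellative_def by blast
    qed
  qed (use fS finite_link[OF tg] in auto)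
  also have "\<dots> \<le> card (shadow E)"
    by (intro card_mono finite_shadow[OF tg]) (auto simp: link_def edge_shadow[OF tg])
  finally show ?thesis .
qed

text \<open>The constant 1/5 works twice: five disjoint links would exceed all
  \<open>(card V)\<^sup>2\<close> ordered pairs; after Turan has bounded the shadow by 3/4 of these,
  four links would exceed 4/5 of them.\<close>

lemma shadow_K4_free:
  assumes tg: "three_graph (V, E)" and c: "cancellative E"
    and deg: "\<And>v. v \<in> V \<Longrightarrow> 5 * card (link E v) > (card V)\<^sup>2"
    and S: "S \<subseteq> V" "card S = 4"
  shows "\<exists>x\<in>S. \<exists>y\<in>S. x \<noteq> y \<and> (x, y) \<notin> shadow E"
proof (rule ccontr)
  have bnd: "card S * (card V)\<^sup>2 + card S \<le> 5 * card (shadow E)"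
    if "S \<subseteq> V" "\<And>x y. x \<in> S \<Longrightarrow> y \<in> S \<Longrightarrow> x \<noteq> y \<Longrightarrow> (x, y) \<in> shadow E" for S
  proof -
    have "card S * ((card V)\<^sup>2 + 1) = (\<Sum>v\<in>S. (card V)\<^sup>2 + 1)" by simp
    also have "\<dots> \<le> (\<Sum>v\<in>S. 5 * card (link E v))" using deg that(1) by (intro sum_mono) fastforce
    also have "\<dots> = 5 * (\<Sum>v\<in>S. card (link E v))" by (simp add: sum_distrib_left)
    also have "\<dots> \<le> 5 * card (shadow E)" using card_link_union[OF tg c that] by simp
    finally show ?thesis by (simp add: algebra_simps)
  qed
  have "real 4 * card (shadow E) \<le> (real 4 - 1) * (card V)\<^sup>2"
  proof (rule turan[OF three_graph_finite(1)[OF tg] shadow_subset[OF tg] sym_shadow irrefl_shadow])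
    fix T assume T: "T \<subseteq> V" "card T = Suc 4"
    show "\<exists>x\<in>T. \<exists>y\<in>T. x \<noteq> y \<and> (x, y) \<notin> shadow E"
    proof (rule ccontr)
      assume "\<not> ?thesis"
      then have "5 * (card V)\<^sup>2 + 5 \<le> 5 * card (shadow E)" using bnd[of T] T by auto
      moreover have "card (shadow E) \<le> card (V \<times> V)"
        using shadow_subset[OF tg] three_graph_finite(1)[OF tg] by (intro card_mono) auto
      ultimately show False by (simp add: card_cartesian_product power2_eq_square)
    qed
  qed simp
  then have "real (4 * card (shadow E)) \<le> real (3 * (card V)\<^sup>2)" by simp
  then have "4 * card (shadow E) \<le> 3 * (card V)\<^sup>2" by (simp only: of_nat_le_iff)
  moreover assume "\<not> ?thesis"
  then have "4 * (card V)\<^sup>2 + 4 \<le> 5 * card (shadow E)" using bnd[of S] S by auto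
  ultimately show False by linarith
qed

lemma card_induced_remove:
  assumes tg: "three_graph (V, E)"
  shows "card E = card {e \<in> E. e \<subseteq> V - {v}} + card {e \<in> E. v \<in> e}"
proof -
  have "E = {e \<in> E. e \<subseteq> V - {v}} \<union> {e \<in> E. v \<in> e}" using tg by (auto simp: three_graph_def)
  then have "card E = card ({e \<in> E. e \<subseteq> V - {v}} \<union> {e \<in> E. v \<in> e})" by simp
  also have "\<dots> = card {e \<in> E. e \<subseteq> V - {v}} + card {e \<in> E. v \<in> e}"
    using three_graph_finite[OF tg] by (intro card_Un_disjoint) auto
  finally show ?thesis .
qed

text \<open>Bollobas's bound with a quadratic slack. A vertex of degree at most
  \<open>n\<^sup>2 / 9\<close> is deleted by induction, the slack covering the excess of
  \<open>3 * n\<^sup>2\<close> over \<open>n^3 - (n - 1)^3\<close>. Without such a vertex the shadow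
  is \<open>K_4\<close>-free, and the three links at any edge would exceed the
  \<open>2 * n\<^sup>2 / 3\<close> ordered pairs that Turan leaves.\<close>

lemma cancellative_card_bound:
  assumes "three_graph (V, E)" "cancellative E"
  shows "27 * card E \<le> (card V)^3 + 2 * (card V)\<^sup>2"
  using assms
proof (induction "card V" arbitrary: V E)
  case 0
  then have "V = {}" using three_graph_finite by fastforce
  then have "E = {}" using 0 by (fastforce simp: three_graph_def)
  then show ?case by simp
next
  case (Suc m V E)
  note tg = \<open>three_graph (V, E)\<close>
  define n where "n = card V"
  have n: "n = Suc m" using Suc by (simp add: n_def)
  show ?case
  proof (cases "\<exists>v\<in>V. 9 * card {e \<in> E. v \<in> e} \<le> n\<^sup>2")
    case True
    then obtain v where v: "v \<in> V" "9 * card {e \<in> E. v \<in> e} \<le> n\<^sup>2" by auto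
    have "card (V - {v}) = m" using v(1) n by (simp add: n_def)
    moreover have "cancellative {e \<in> E. e \<subseteq> V - {v}}" using Suc.prems(2) cancellative_subset by (metis (no_types, lifting) mem_Collect_eq subsetI)
    ultimately have "27 * card {e \<in> E. e \<subseteq> V - {v}} \<le> m^3 + 2 * m\<^sup>2"
      using Suc.hyps(1)[of "V - {v}"] three_graph_induced[OF tg, of "V - {v}"] by auto
    then have "27 * card E \<le> m^3 + 2 * m\<^sup>2 + 3 * n\<^sup>2"
      using card_induced_remove[OF tg, of v] v(2) by linarith
    also have "\<dots> \<le> n^3 + 2 * n\<^sup>2" unfolding n by (simp add: power2_eq_square power3_eq_cube algebra_simps)
    finally show ?thesis unfolding n_def .
  next
    case False
    then have deg: "2 * n\<^sup>2 < 9 * card (link E v)" if "v \<in> V" for v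
      using that card_link[OF tg, of v] by (auto simp: not_le)
    have K4: "\<exists>x\<in>S. \<exists>y\<in>S. x \<noteq> y \<and> (x, y) \<notin> shadow E" if "S \<subseteq> V" "card S = 4" for S
    proof (rule shadow_K4_free[OF tg Suc.prems(2) _ that])
      fix v assume "v \<in> V"
      from deg[OF this] show "(card V)\<^sup>2 < 5 * card (link E v)" by (simp add: n_def)
    qed
    have "real 3 * card (shadow E) \<le> (real 3 - 1) * (card V)\<^sup>2"
      by (rule turan[OF three_graph_finite(1)[OF tg] shadow_subset[OF tg] sym_shadow irrefl_shadow])
        (use K4 in auto)
    then have "real (3 * card (shadow E)) \<le> real (2 * n\<^sup>2)" by (simp add: n_def)
    then have t: "3 * card (shadow E) \<le> 2 * n\<^sup>2" by (simp only: of_nat_le_iff)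
    have "E = {}"
    proof (rule ccontr)
      assume "E \<noteq> {}"
      then obtain e where e: "e \<in> E" by auto
      then have e3: "card e = 3" "e \<subseteq> V" using tg by (auto simp: three_graph_def)
      then obtain a b c where abc: "e = {a, b, c}" "a \<noteq> b" "a \<noteq> c" "b \<noteq> c" by (auto simp: card_3_iff)
      have "(\<Sum>v\<in>e. card (link E v)) \<le> card (shadow E)"
        using edge_shadow[OF tg e[unfolded abc(1)]] abc e3 by (intro card_link_union[OF tg Suc.prems(2)]) auto
      then have "card (link E a) + card (link E b) + card (link E c) \<le> card (shadow E)" using abc by simp
      moreover have "2 * n\<^sup>2 < 9 * card (link E a)" "2 * n\<^sup>2 < 9 * card (link E b)" "2 * n\<^sup>2 < 9 * card (link E c)"
        using deg abc(1) e3 by auto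
      ultimately show False using t by linarith
    qed
    then show ?thesis by simp
  qed
qed

section \<open>Stability\<close>

text \<open>Typical vertices of \<open>A\<close> have about \<open>n\<^sup>2/9\<close> link pairs in \<open>B \<times> C\<close>; \<open>n\<^sup>2/10\<close> is below that but well above half of it.\<close>

definition core :: "'a set \<Rightarrow> 'a set set \<Rightarrow> 'a set \<Rightarrow> 'a set \<Rightarrow> 'a set \<Rightarrow> bool" where
  "core V E A B C \<longleftrightarrow> A \<subseteq> V \<and> B \<subseteq> V \<and> C \<subseteq> V \<and> A \<inter> B = {} \<and> A \<inter> C = {} \<and> B \<inter> C = {} \<and>
     (\<forall>v\<in>A. (real (card V))\<^sup>2 \<le> 10 * real (card (link E v \<inter> B \<times> C))) \<and>
     (\<forall>v\<in>B. (real (card V))\<^sup>2 \<le> 10 * real (card (link E v \<inter> A \<times> C))) \<and>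
     (\<forall>v\<in>C. (real (card V))\<^sup>2 \<le> 10 * real (card (link E v \<inter> A \<times> B)))"

lemma card_link_swap: "card (link E v \<inter> B \<times> C) = card (link E v \<inter> C \<times> B)"
proof -
  have "link E v \<inter> C \<times> B = (link E v \<inter> B \<times> C)\<inverse>" by (auto simp: link_def insert_commute)
  then show ?thesis by simp
qed

lemma core_swap: "core V E A B C \<Longrightarrow> core V E B A C"
  unfolding core_def card_link_swap[of E _ B A] by (simp add: Int_commute[of B A])

lemma core_swap': "core V E A B C \<Longrightarrow> core V E A C B"
  unfolding core_def card_link_swap[of E _ C B] by (simp add: Int_commute[of C B])

lemma finite_transversals:
  assumes "three_graph (V, E)" "A \<subseteq> V" shows "finite (transversals E A B C)"
  unfolding transversals_def
  by (intro finite_SigmaI finite_Int disjI1 finite_link[OF assms(1)]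
      finite_subset[OF assms(2) three_graph_finite(1)[OF assms(1)]])

lemma card_transversals:
  assumes "three_graph (V, E)" "A \<subseteq> V"
  shows "card (transversals E A B C) = (\<Sum>x\<in>A. card (link E x \<inter> B \<times> C))"
  unfolding transversals_def
  using finite_subset[OF assms(2) three_graph_finite(1)[OF assms(1)]] finite_link[OF assms(1)]
  by (subst card_SigmaI) auto

lemma transversals_swap: "card (transversals E B A C) = card (transversals E A B C)"
proof -
  have "transversals E B A C = (\<lambda>(x, y, z). (y, x, z)) ` transversals E A B C"
  proof (intro set_eqI iffI)
    fix p assume "p \<in> transversals E B A C"
    then obtain x y z where "p = (y, x, z)" "x \<in> A" "y \<in> B" "z \<in> C" "{x, y, z} \<in> E"
      by (auto simp: transversals_def link_def insert_commute)
    then show "p \<in> (\<lambda>(x, y, z). (y, x, z)) ` transversals E A B C"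
      by (auto simp: transversals_def link_def intro!: image_eqI[of _ _ "(x, y, z)"])
  qed (auto simp: transversals_def link_def insert_commute)
  then show ?thesis by (simp only:) (intro card_image, auto simp: inj_on_def)
qed

lemma transversals_swap': "card (transversals E A C B) = card (transversals E A B C)"
proof -
  have "transversals E A C B = (\<lambda>(x, y, z). (x, z, y)) ` transversals E A B C"
  proof (intro set_eqI iffI)
    fix p assume "p \<in> transversals E A C B"
    then obtain x y z where "p = (x, z, y)" "x \<in> A" "y \<in> B" "z \<in> C" "{x, y, z} \<in> E"
      by (auto simp: transversals_def link_def insert_commute)
    then show "p \<in> (\<lambda>(x, y, z). (x, z, y)) ` transversals E A B C"
      by (auto simp: transversals_def link_def intro!: image_eqI[of _ _ "(x, y, z)"])
  qed (auto simp: transversals_def link_def insert_commute)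
  then show ?thesis by (simp only:) (intro card_image, auto simp: inj_on_def)
qed

lemma finite_argmax:
  fixes f :: "'b \<Rightarrow> real"
  assumes "finite S" "S \<noteq> {}"
  obtains x where "x \<in> S" "\<And>y. y \<in> S \<Longrightarrow> f y \<le> f x"
proof -
  have "Max (f ` S) \<in> f ` S" using assms by (intro Max_in) auto
  then show ?thesis using that assms by (metis (no_types, lifting) Max_ge finite_imageI image_iff)
qed

text \<open>Why \<open>U\<close> is large: by the cancellative bound \<open>g U\<close> is at most
  about \<open>\<eta> * u^3 / 27\<close>, while \<open>g V\<close> falls short of
  \<open>\<eta> * n^3 / 27\<close> by only a quadratic amount. This is the purpose of taking
  \<open>\<beta>\<close> slightly below 1/27.\<close>

lemma dense_induced_subgraph:
  fixes \<eta> K :: real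
  assumes tg: "three_graph (V, E)" and c: "cancellative E"
    and eta: "0 < \<eta>" "\<eta> \<le> 1 / 1000" and K: "K \<ge> 0"
    and e: "(real (card V))^3 - 27 * K * (real (card V))\<^sup>2 \<le> 27 * real (card E)"
    and n: "(27 * K + 2) / \<eta>\<^sup>2 \<le> card V"
  obtains U where "U \<subseteq> V" "(1 - \<eta>) * card V \<le> card U"
    "\<And>v. v \<in> U \<Longrightarrow> 2 / 9 * (1 - 2 * \<eta>) * (real (card U))\<^sup>2 \<le> card (link {e \<in> E. e \<subseteq> U} v)"
proof -
  define \<beta> where "\<beta> = (1 - \<eta>) / 27"
  \<comment> \<open>At a maximiser of \<open>g\<close>, deleting a vertex of degree below \<open>\<beta> (u\<^sup>3 - (u - 1)\<^sup>3)\<close> would increase \<open>g\<close>.\<close>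
  define g where "g S = card {e \<in> E. e \<subseteq> S} - \<beta> * (card S)^3" for S
  have fV: "finite V" and fE: "finite E" using three_graph_finite[OF tg] by auto
  obtain U where U: "U \<in> Pow V" "\<And>S. S \<in> Pow V \<Longrightarrow> g S \<le> g U"
    using finite_argmax[of "Pow V" g] fV by auto
  define u where "u = real (card U)"
  define n where "n = real (card V)"
  have un: "u \<le> n" using U(1) fV by (auto simp: u_def n_def card_mono)
  have np: "n > 0"
  proof -
    have "(27 * K + 2) / \<eta>\<^sup>2 > 0" using K eta by auto
    then show ?thesis using n unfolding n_def by linarith
  qed
  have tgU: "three_graph (U, {e \<in> E. e \<subseteq> U})" using three_graph_induced[OF tg] U by auto
  have "{e \<in> E. e \<subseteq> V} = E" using tg by (auto simp: three_graph_def)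
  then have gV: "card E - \<beta> * n^3 \<le> real (card {e \<in> E. e \<subseteq> U}) - \<beta> * u^3"
    using U(2)[of V] by (simp add: g_def u_def n_def)
  have "cancellative {e \<in> E. e \<subseteq> U}" using c cancellative_subset by (metis (no_types, lifting) mem_Collect_eq subsetI)
  then have "27 * card {e \<in> E. e \<subseteq> U} \<le> (card U)^3 + 2 * (card U)\<^sup>2"
    using cancellative_card_bound[OF tgU] by simp
  then have "real (27 * card {e \<in> E. e \<subseteq> U}) \<le> real ((card U)^3 + 2 * (card U)\<^sup>2)" by (simp only: of_nat_le_iff)
  then have "27 * real (card {e \<in> E. e \<subseteq> U}) \<le> u^3 + 2 * u\<^sup>2" by (simp add: u_def)
  with gV e have "\<eta> * (n^3 - u^3) \<le> 27 * K * n\<^sup>2 + 2 * u\<^sup>2"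
    by (simp add: \<beta>_def n_def field_simps)
  also have "\<dots> \<le> (27 * K + 2) * n\<^sup>2" using un by (simp add: algebra_simps u_def power_mono)
  finally have 1: "\<eta> * (n^3 - u^3) \<le> (27 * K + 2) * n\<^sup>2" .
  have "n\<^sup>2 * (n - u) \<le> n^3 - u^3"
  proof -
    have "n^3 - u^3 - n\<^sup>2 * (n - u) = u * ((n - u) * (n + u))" by (simp add: power2_eq_square power3_eq_cube algebra_simps)
    also have "\<dots> \<ge> 0" using un by (auto simp: u_def n_def)
    finally show ?thesis by simp
  qed
  then have "\<eta> * (n\<^sup>2 * (n - u)) \<le> \<eta> * (n^3 - u^3)" using eta by simp
  then have "n\<^sup>2 * (\<eta> * (n - u)) \<le> n\<^sup>2 * (27 * K + 2)" using 1 by (simp add: mult_ac)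
  then have "\<eta> * (n - u) \<le> 27 * K + 2" using np by simp
  moreover have "27 * K + 2 \<le> \<eta>\<^sup>2 * n" using n eta by (simp add: n_def field_simps)
  ultimately have "\<eta> * (n - u) \<le> \<eta> * (\<eta> * n)" by (simp add: power2_eq_square mult_ac)
  then have "n - u \<le> \<eta> * n" using eta by (simp only: mult_le_cancel_left_pos)
  then have u: "(1 - \<eta>) * n \<le> u" by (simp add: algebra_simps)
  have n1: "2 / \<eta> \<le> n"
  proof -
    have "\<eta> * \<eta> \<le> \<eta> * 1" using eta by (intro mult_left_mono) auto
    then have "2 / \<eta> \<le> 2 / \<eta>\<^sup>2" using eta by (intro divide_left_mono) (auto simp: power2_eq_square)
    also have "\<dots> \<le> (27 * K + 2) / \<eta>\<^sup>2" using K by (intro divide_right_mono) auto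
    finally show ?thesis using n by (simp add: n_def)
  qed
  \<comment> \<open>This absorbs the linear term of \<open>u^3 - (u - 1)^3\<close> and explains the
    passage from \<open>1 - \<eta>\<close> to \<open>1 - 2 * \<eta>\<close>.\<close>
  have "\<eta> * u \<ge> 1"
  proof -
    have "\<eta> * u \<ge> \<eta> * ((1 - \<eta>) * n)" using u eta by simp
    moreover have "\<eta> * n \<ge> 2" using n1 eta by (simp add: field_simps)
    then have "(1 - \<eta>) * (\<eta> * n) \<ge> (1 / 2) * 2" using eta by (intro mult_mono) auto
    ultimately show ?thesis by (simp add: mult_ac)
  qed
  have deg: "2 / 9 * (1 - 2 * \<eta>) * (real (card U))\<^sup>2 \<le> card (link {e \<in> E. e \<subseteq> U} v)" if v: "v \<in> U" for v
  proof -
    have "real (card (U - {v})) = u - 1"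
    proof -
      have "finite U" using U(1) fV finite_subset by auto
      then have "Suc (card (U - {v})) = card U" using v by (rule card_Suc_Diff1)
      then show ?thesis unfolding u_def by linarith
    qed
    then have "real (card {e \<in> E. e \<subseteq> U - {v}}) - \<beta> * (u - 1)^3 \<le> real (card {e \<in> E. e \<subseteq> U}) - \<beta> * u^3"
      using U(2)[of "U - {v}"] U(1) by (auto simp: g_def u_def)
    moreover have "{e \<in> {e \<in> E. e \<subseteq> U}. e \<subseteq> U - {v}} = {e \<in> E. e \<subseteq> U - {v}}" by auto
    then have "2 * card {e \<in> E. e \<subseteq> U} = 2 * card {e \<in> E. e \<subseteq> U - {v}} + card (link {e \<in> E. e \<subseteq> U} v)"
      using card_induced_remove[OF tgU, of v] card_link[OF tgU, of v] by simp
    then have "2 * real (card {e \<in> E. e \<subseteq> U}) = 2 * real (card {e \<in> E. e \<subseteq> U - {v}}) + real (card (link {e \<in> E. e \<subseteq> U} v))"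
      by linarith
    ultimately have "2 * \<beta> * (u^3 - (u - 1)^3) \<le> card (link {e \<in> E. e \<subseteq> U} v)"
      by (simp add: algebra_simps)
    moreover have "2 * \<beta> * (u^3 - (u - 1)^3) \<ge> 2 * \<beta> * (3 * u\<^sup>2 - 3 * u)"
    proof -
      have "u^3 - (u - 1)^3 = 3 * u\<^sup>2 - 3 * u + 1" by (simp add: power2_eq_square power3_eq_cube algebra_simps)
      then show ?thesis using eta by (intro mult_left_mono) (auto simp: \<beta>_def)
    qed
    moreover have "2 * \<beta> * (3 * u\<^sup>2 - 3 * u) = 2 / 9 * ((1 - \<eta>) * (u\<^sup>2 - u))" by (simp add: \<beta>_def field_simps)
    moreover have "(1 - \<eta>) * (u\<^sup>2 - u) \<ge> (1 - 2 * \<eta>) * u\<^sup>2"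
    proof -
      have "(1 - \<eta>) * (u\<^sup>2 - u) - (1 - 2 * \<eta>) * u\<^sup>2 = u * (\<eta> * u - 1) + \<eta> * u" by (simp add: power2_eq_square algebra_simps)
      also have "\<dots> \<ge> 0" using \<open>\<eta> * u \<ge> 1\<close> eta by (intro add_nonneg_nonneg mult_nonneg_nonneg) (auto simp: u_def)
      finally show ?thesis by simp
    qed
    ultimately have "2 / 9 * ((1 - 2 * \<eta>) * u\<^sup>2) \<le> card (link {e \<in> E. e \<subseteq> U} v)" by linarith
    then show ?thesis by (simp only: u_def mult.assoc)
  qed
  show thesis using that[of U] U(1) u deg by (auto simp: u_def n_def)
qed

text \<open>The parts are the common shadow neighbourhoods of the three pairs of one edge
  \<open>{a, b, c}\<close>. Since the shadow has no \<open>K_4\<close>, they are disjoint and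
  independent; since every vertex has nearly \<open>2 * u / 3\<close> neighbours,
  inclusion-exclusion leaves at most \<open>4 * \<eta> * u\<close> vertices uncovered.\<close>

lemma tripartition_from_degree:
  fixes \<eta> :: real
  assumes tg: "three_graph (U, E)" and c: "cancellative E"
    and eta: "0 < \<eta>" "\<eta> \<le> 1 / 1000" and ne: "U \<noteq> {}"
    and deg: "\<And>v. v \<in> U \<Longrightarrow> 2 / 9 * (1 - 2 * \<eta>) * (real (card U))\<^sup>2 \<le> card (link E v)"
  obtains A B C where "A \<subseteq> U" "B \<subseteq> U" "C \<subseteq> U" "A \<inter> B = {}" "A \<inter> C = {}" "B \<inter> C = {}"
    "(1 - 4 * \<eta>) * card U \<le> real (card A) + card B + card C"
    "\<And>v. v \<in> A \<Longrightarrow> (1 / 9 - 5 * \<eta>) * (real (card U))\<^sup>2 \<le> card (link E v \<inter> B \<times> C)"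
    "\<And>v. v \<in> B \<Longrightarrow> (1 / 9 - 5 * \<eta>) * (real (card U))\<^sup>2 \<le> card (link E v \<inter> A \<times> C)"
    "\<And>v. v \<in> C \<Longrightarrow> (1 / 9 - 5 * \<eta>) * (real (card U))\<^sup>2 \<le> card (link E v \<inter> A \<times> B)"
proof -
  define u where "u = real (card U)"
  have fU: "finite U" and fE: "finite E" using three_graph_finite[OF tg] by auto
  have u0: "u > 0" using ne fU by (auto simp: u_def card_gt_0_iff)
  define G where "G = shadow E"
  define N where "N x = G `` {x}" for x
  have G: "sym G" "irrefl G" "G \<subseteq> U \<times> U" using sym_shadow irrefl_shadow shadow_subset[OF tg] by (auto simp: G_def)
  have NU: "N x \<subseteq> U" for x using G(3) by (auto simp: N_def)
  have fN: "finite (N x)" for x using NU fU finite_subset by blast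
  have K4: "\<exists>x\<in>S. \<exists>y\<in>S. x \<noteq> y \<and> (x, y) \<notin> shadow E" if "S \<subseteq> U" "card S = 4" for S
  proof (rule shadow_K4_free[OF tg c _ that])
    fix v assume "v \<in> U"
    from deg[OF this] have "2 / 9 * (1 - 2 * \<eta>) * u\<^sup>2 \<le> card (link E v)" by (simp add: u_def)
    moreover have "2 / 9 * (1 - 2 * \<eta>) * u\<^sup>2 > 1 / 5 * u\<^sup>2" using eta u0 by (intro mult_strict_right_mono) auto
    ultimately have "real ((card U)\<^sup>2) < real (5 * card (link E v))" by (simp add: u_def)
    then show "(card U)\<^sup>2 < 5 * card (link E v)" by (simp only: of_nat_less_iff)
  qed
  have noK4: False if "(p, q) \<in> G" "(p, r) \<in> G" "(p, s) \<in> G" "(q, r) \<in> G" "(q, s) \<in> G" "(r, s) \<in> G" for p q r s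
  proof -
    have d: "p \<noteq> q" "p \<noteq> r" "p \<noteq> s" "q \<noteq> r" "q \<noteq> s" "r \<noteq> s" using that G(2) by (auto simp: irrefl_def)
    have "{p, q, r, s} \<subseteq> U" using that G(3) by auto
    moreover have "card {p, q, r, s} = 4" using d by simp
    ultimately show False using K4[of "{p, q, r, s}"] that symD[OF G(1)] unfolding G_def by auto
  qed
  have lkG: "(v, y) \<in> G \<and> (v, z) \<in> G \<and> (y, z) \<in> G" if "(y, z) \<in> link E v" for v y z
    using that edge_shadow[OF tg] by (auto simp: link_def G_def)
  \<comment> \<open>Mantel's theorem in the link of \<open>v\<close>: a triangle there would form a
    \<open>K_4\<close> with \<open>v\<close> in the shadow.\<close>
  have Nlow: "2 / 3 * (1 - 2 * \<eta>) * u \<le> card (N v)" if v: "v \<in> U" for v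
  proof -
    have "real 2 * card (link E v) \<le> (real 2 - 1) * (card (N v))\<^sup>2"
    proof (rule turan[OF fN _ sym_link irrefl_link[OF tg]])
      show "link E v \<subseteq> N v \<times> N v" using lkG by (auto simp: N_def)
      fix S assume S: "S \<subseteq> N v" "card S = Suc 2"
      then obtain p q r where pqr: "S = {p, q, r}" "p \<noteq> q" "p \<noteq> r" "q \<noteq> r"
        by (auto simp: numeral_eq_Suc card_Suc_eq)
      show "\<exists>x\<in>S. \<exists>y\<in>S. x \<noteq> y \<and> (x, y) \<notin> link E v"
      proof (rule ccontr)
        assume "\<not> ?thesis"
        then have "(p, q) \<in> link E v" "(p, r) \<in> link E v" "(q, r) \<in> link E v" using pqr by auto
        then show False using noK4[of v p q r] lkG by blast
      qed
    qed simp
    then have "2 * card (link E v) \<le> (real (card (N v)))\<^sup>2" by simp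
    moreover have "2 * (2 / 9 * (1 - 2 * \<eta>) * u\<^sup>2) \<le> 2 * card (link E v)"
      using deg[OF v] unfolding u_def of_nat_power by linarith
    ultimately have 1: "4 / 9 * (1 - 2 * \<eta>) * u\<^sup>2 \<le> (real (card (N v)))\<^sup>2" by linarith
    have "(2 / 3 * (1 - 2 * \<eta>) * u)\<^sup>2 = 4 / 9 * ((1 - 2 * \<eta>) * (1 - 2 * \<eta>)) * u\<^sup>2" by (simp add: power2_eq_square field_simps)
    also have "\<dots> \<le> 4 / 9 * ((1 - 2 * \<eta>) * 1) * u\<^sup>2"
      using eta by (intro mult_right_mono mult_left_mono) auto
    finally have "(2 / 3 * (1 - 2 * \<eta>) * u)\<^sup>2 \<le> (real (card (N v)))\<^sup>2"
      using 1 unfolding mult_1_right by (rule order_trans)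
    then show ?thesis by (rule power2_le_imp_le) simp
  qed
  obtain w where w: "w \<in> U" using ne by auto
  have "0 < 2 / 9 * (1 - 2 * \<eta>) * u\<^sup>2" using eta u0 by simp
  then have "card (link E w) > 0" using deg[OF w] unfolding u_def by linarith
  then have "link E w \<noteq> {}" by auto
  then obtain y z where "(y, z) \<in> link E w" by auto
  then obtain a b c where abc: "{a, b, c} \<in> E" by (auto simp: link_def)
  have abcU: "a \<in> U" "b \<in> U" "c \<in> U" using three_graph_edge[OF tg abc] by auto
  have abcG: "(a, b) \<in> G" "(a, c) \<in> G" "(b, c) \<in> G" using edge_shadow[OF tg abc] by (auto simp: G_def)
  define A where "A = N b \<inter> N c"
  define B where "B = N a \<inter> N c"
  define C where "C = N a \<inter> N b"
  have no3: "N a \<inter> N b \<inter> N c = {}" using noK4[of a b c] abcG by (auto simp: N_def)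
  have fABC: "finite A" "finite B" "finite C" using fN by (auto simp: A_def B_def C_def)
  have "card (N a \<union> N b) + card C = card (N a) + card (N b)"
    unfolding C_def using fN by (simp add: card_Un_Int[symmetric])
  moreover have "card ((N a \<union> N b) \<union> N c) + card ((N a \<union> N b) \<inter> N c) = card (N a \<union> N b) + card (N c)"
    using fN by (simp add: card_Un_Int[symmetric])
  moreover have "(N a \<union> N b) \<inter> N c = A \<union> B" by (auto simp: A_def B_def)
  moreover have dis: "A \<inter> B = {}" "A \<inter> C = {}" "B \<inter> C = {}" using no3 by (auto simp: A_def B_def C_def)
  moreover have "card (A \<union> B) = card A + card B" using fABC dis by (simp add: card_Un_disjoint)
  moreover have "card ((N a \<union> N b) \<union> N c) \<le> card U" using NU fU by (intro card_mono) auto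
  ultimately have "card (N a) + card (N b) + card (N c) \<le> card A + card B + card C + card U" by simp
  then have "real (card (N a)) + card (N b) + card (N c) \<le> real (card A) + card B + card C + u"
    unfolding u_def by linarith
  with Nlow[OF abcU(1)] Nlow[OF abcU(2)] Nlow[OF abcU(3)]
  have big: "(1 - 4 * \<eta>) * u \<le> real (card A) + card B + card C" by (simp add: algebra_simps)
  have sub: "A \<subseteq> U" "B \<subseteq> U" "C \<subseteq> U" using NU by (auto simp: A_def B_def C_def)
  have ind0: False if "x \<in> N p \<inter> N q" "y \<in> N p \<inter> N q" "(x, y) \<in> G" "(p, q) \<in> G" for x y p q
    using that noK4[of p q x y] by (auto simp: N_def)
  have ind: "\<And>x y. x \<in> A \<Longrightarrow> y \<in> A \<Longrightarrow> (x, y) \<notin> G" "\<And>x y. x \<in> B \<Longrightarrow> y \<in> B \<Longrightarrow> (x, y) \<notin> G"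
     "\<And>x y. x \<in> C \<Longrightarrow> y \<in> C \<Longrightarrow> (x, y) \<notin> G"
    unfolding A_def B_def C_def using ind0 abcG by blast+
  \<comment> \<open>By independence, a link pair of \<open>v\<close> lies in
    \<open>Q \<times> R\<close> or its converse, or meets the leftover set \<open>J\<close>. The
    last kind costs at most \<open>8 * \<eta> * u\<^sup>2\<close> ordered pairs; halving the rest
    leaves at least \<open>(1 / 9 - 5 * \<eta>) * u\<^sup>2\<close>.\<close>
  have key: "(1 / 9 - 5 * \<eta>) * u\<^sup>2 \<le> card (link E v \<inter> Q \<times> R)"
    if v: "v \<in> P" and PQR: "P \<union> Q \<union> R = A \<union> B \<union> C"
      and ind: "\<And>x y. x \<in> P \<Longrightarrow> y \<in> P \<Longrightarrow> (x, y) \<notin> G" "\<And>x y. x \<in> Q \<Longrightarrow> y \<in> Q \<Longrightarrow> (x, y) \<notin> G"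
      "\<And>x y. x \<in> R \<Longrightarrow> y \<in> R \<Longrightarrow> (x, y) \<notin> G" for v P Q R
  proof -
    define J where "J = U - (A \<union> B \<union> C)"
    have "card (A \<union> B \<union> C) = card A + card B + card C"
      using fABC dis by (subst card_Un_disjoint, auto)+
    moreover have "card J = card U - card (A \<union> B \<union> C)" "card (A \<union> B \<union> C) \<le> card U"
      unfolding J_def using fABC sub fU by (auto intro!: card_Diff_subset card_mono)
    ultimately have "real (card J) = u - (real (card A) + card B + card C)" by (simp add: u_def of_nat_diff)
    then have J: "real (card J) \<le> 4 * \<eta> * u" using big by (simp add: algebra_simps)
    have vU: "v \<in> U" using v PQR sub by auto
    have "link E v \<subseteq> (link E v \<inter> Q \<times> R) \<union> (link E v \<inter> R \<times> Q) \<union> (J \<times> U \<union> U \<times> J)"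
    proof
      fix p assume p: "p \<in> link E v"
      obtain y z where yz: "p = (y, z)" by force
      have g: "(v, y) \<in> G" "(v, z) \<in> G" "(y, z) \<in> G" using lkG p yz by auto
      have U: "y \<in> U" "z \<in> U" using g G(3) by auto
      have J: "x \<in> Q \<or> x \<in> R \<or> x \<in> J" if "x \<in> U" "(v, x) \<in> G" for x
      proof -
        have "x \<notin> P" using that ind(1)[OF v] by blast
        then show ?thesis using that PQR[symmetric] unfolding J_def by blast
      qed
      have "\<not> (y \<in> Q \<and> z \<in> Q)" "\<not> (y \<in> R \<and> z \<in> R)" using ind(2,3) g(3) by blast+
      then show "p \<in> (link E v \<inter> Q \<times> R) \<union> (link E v \<inter> R \<times> Q) \<union> (J \<times> U \<union> U \<times> J)"
        using p U J[OF U(1) g(1)] J[OF U(2) g(2)] unfolding yz by blast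
    qed
    moreover have fJ: "finite J" using fU by (simp add: J_def)
    ultimately have "card (link E v) \<le> card ((link E v \<inter> Q \<times> R) \<union> (link E v \<inter> R \<times> Q) \<union> (J \<times> U \<union> U \<times> J))"
      using finite_link[OF tg] fU by (intro card_mono) auto
    also have "\<dots> \<le> card (link E v \<inter> Q \<times> R) + card (link E v \<inter> R \<times> Q) + (card (J \<times> U) + card (U \<times> J))"
      by (meson card_Un_le add_mono order_trans)
    finally have "card (link E v) \<le> 2 * card (link E v \<inter> Q \<times> R) + 2 * (card J * card U)"
      by (simp add: card_link_swap[of E v R Q] card_cartesian_product mult.commute)
    then have "real (card (link E v)) \<le> real (2 * card (link E v \<inter> Q \<times> R) + 2 * (card J * card U))"
      by (simp only: of_nat_le_iff)
    then have "real (card (link E v)) \<le> 2 * real (card (link E v \<inter> Q \<times> R)) + 2 * (card J * u)"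
      by (simp add: u_def)
    moreover have "card J * u \<le> (4 * \<eta> * u) * u" using J u0 by (intro mult_right_mono) auto
    moreover note deg[OF vU, folded u_def]
    moreover have "2 / 9 * (1 - 2 * \<eta>) * u\<^sup>2 - 2 * ((4 * \<eta> * u) * u) - 2 * ((1 / 9 - 5 * \<eta>) * u\<^sup>2) \<ge> 0"
    proof -
      have "2 / 9 * (1 - 2 * \<eta>) * u\<^sup>2 - 2 * ((4 * \<eta> * u) * u) - 2 * ((1 / 9 - 5 * \<eta>) * u\<^sup>2) = 14 / 9 * \<eta> * u\<^sup>2"
        by (simp add: power2_eq_square field_simps)
      also have "\<dots> \<ge> 0" using eta by simp
      finally show ?thesis .
    qed
    ultimately show ?thesis by linarith
  qed
  show thesis
  proof (rule that[OF sub dis])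
    show "(1 - 4 * \<eta>) * card U \<le> real (card A) + card B + card C" using big by (simp add: u_def)
  qed (use key[where P = A and Q = B and R = C, OF _ _ ind(1,2,3)]
      key[where P = B and Q = A and R = C, OF _ _ ind(2,1,3)] key[where P = C and Q = A and R = B, OF _ _ ind(3,1,2)]
    in \<open>auto simp: u_def Un_ac\<close>)
qed

lemma core_exists:
  fixes \<eta> K :: real
  assumes tg: "three_graph (V, E)" and c: "cancellative E"
    and eta: "0 < \<eta>" "\<eta> \<le> 1 / 1000" and K: "K \<ge> 0"
    and e: "(real (card V))^3 - 27 * K * (real (card V))\<^sup>2 \<le> 27 * real (card E)"
    and n: "(27 * K + 2) / \<eta>\<^sup>2 \<le> card V"
  obtains A B C where "core V E A B C" "(1 / 27 - 3 * \<eta>) * (real (card V))^3 \<le> card (transversals E A B C)"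
proof -
  obtain U where U: "U \<subseteq> V" "(1 - \<eta>) * card V \<le> card U"
    "\<And>v. v \<in> U \<Longrightarrow> 2 / 9 * (1 - 2 * \<eta>) * (real (card U))\<^sup>2 \<le> card (link {e \<in> E. e \<subseteq> U} v)"
    using dense_induced_subgraph[OF assms] by blast
  define n u where "n = real (card V)" and "u = real (card U)"
  have np: "n > 0"
  proof -
    have "(27 * K + 2) / \<eta>\<^sup>2 > 0" using K eta by auto
    then show ?thesis using n unfolding n_def by linarith
  qed
  have un: "(1 - \<eta>) * n \<le> u" using U(2) by (simp add: n_def u_def)
  moreover have "(1 - \<eta>) * n > 0" using np eta by simp
  ultimately have ne: "U \<noteq> {}" and u0: "u > 0" by (auto simp: u_def)
  define F where "F = {e \<in> E. e \<subseteq> U}"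
  have FE: "F \<subseteq> E" by (auto simp: F_def)
  have tgF: "three_graph (U, F)" using three_graph_induced[OF tg U(1)] by (simp add: F_def)
  obtain A B C where ABC: "A \<subseteq> U" "B \<subseteq> U" "C \<subseteq> U" "A \<inter> B = {}" "A \<inter> C = {}" "B \<inter> C = {}"
    "(1 - 4 * \<eta>) * u \<le> real (card A) + card B + card C"
    "\<And>v. v \<in> A \<Longrightarrow> (1 / 9 - 5 * \<eta>) * u\<^sup>2 \<le> card (link F v \<inter> B \<times> C)"
    "\<And>v. v \<in> B \<Longrightarrow> (1 / 9 - 5 * \<eta>) * u\<^sup>2 \<le> card (link F v \<inter> A \<times> C)"
    "\<And>v. v \<in> C \<Longrightarrow> (1 / 9 - 5 * \<eta>) * u\<^sup>2 \<le> card (link F v \<inter> A \<times> B)"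
    by (rule tripartition_from_degree[OF tgF cancellative_subset[OF c FE] eta ne U(3)[folded F_def], folded u_def])
      (assumption, (rule that; assumption))
  have mono: "card (link F v \<inter> S) \<le> card (link E v \<inter> S)" for v S
    using FE finite_link[OF tg] by (intro card_mono) (auto simp: link_def)
  have low: "n\<^sup>2 / 10 \<le> (1 / 9 - 5 * \<eta>) * u\<^sup>2"
  proof -
    have "((1 - \<eta>) * n)\<^sup>2 \<le> u\<^sup>2" using un np eta by (intro power_mono) auto
    moreover have "((1 - \<eta>) * n)\<^sup>2 \<ge> (1 - 2 * \<eta>) * n\<^sup>2"
      unfolding power_mult_distrib by (intro mult_right_mono) (auto simp: power2_eq_square algebra_simps)
    moreover have "(1 - 2 * \<eta>) * n\<^sup>2 \<ge> 998 / 1000 * n\<^sup>2" using eta by (intro mult_right_mono) auto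
    ultimately have "998 / 1000 * n\<^sup>2 \<le> u\<^sup>2" by linarith
    moreover have "106 / 1000 * u\<^sup>2 \<le> (1 / 9 - 5 * \<eta>) * u\<^sup>2" using eta by (intro mult_right_mono) auto
    moreover have "n\<^sup>2 \<ge> 0" by simp
    ultimately show ?thesis by linarith
  qed
  have "n\<^sup>2 \<le> 10 * real (card (link E v \<inter> S))" if "(1 / 9 - 5 * \<eta>) * u\<^sup>2 \<le> card (link F v \<inter> S)" for v S
    using that mono[of v S] low by linarith
  then have deg10: "\<forall>v\<in>A. n\<^sup>2 \<le> 10 * real (card (link E v \<inter> B \<times> C))" "\<forall>v\<in>B. n\<^sup>2 \<le> 10 * real (card (link E v \<inter> A \<times> C))"
      "\<forall>v\<in>C. n\<^sup>2 \<le> 10 * real (card (link E v \<inter> A \<times> B))"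
    using ABC(8-10) by auto
  have core: "core V E A B C"
    unfolding core_def using ABC(1-6) U(1) deg10[unfolded n_def] by auto
  have s: "real (card P) * ((1 / 9 - 5 * \<eta>) * u\<^sup>2) \<le> card (transversals E P Q R)"
    if "P \<subseteq> U" "\<And>v. v \<in> P \<Longrightarrow> (1 / 9 - 5 * \<eta>) * u\<^sup>2 \<le> card (link F v \<inter> Q \<times> R)" for P Q R
  proof -
    have "real (card P) * ((1 / 9 - 5 * \<eta>) * u\<^sup>2) = (\<Sum>v\<in>P. (1 / 9 - 5 * \<eta>) * u\<^sup>2)" by simp
    also have "\<dots> \<le> (\<Sum>v\<in>P. real (card (link E v \<inter> Q \<times> R)))"
      using that(2) mono by (intro sum_mono) (meson of_nat_le_iff order_trans)
    also have "\<dots> = card (transversals E P Q R)" using that(1) U(1) by (simp add: card_transversals[OF tg])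
    finally show ?thesis .
  qed
  \<comment> \<open>Only the sum of the part sizes is bounded below, so the transversals are counted
    from all three sides and the counts added.\<close>
  have "(1 - 4 * \<eta>) * u * ((1 / 9 - 5 * \<eta>) * u\<^sup>2) \<le> (real (card A) + card B + card C) * ((1 / 9 - 5 * \<eta>) * u\<^sup>2)"
    using ABC(7) eta by (intro mult_right_mono) auto
  also have "\<dots> \<le> 3 * real (card (transversals E A B C))"
    using s[OF ABC(1) ABC(8)] s[OF ABC(2) ABC(9)] s[OF ABC(3) ABC(10)]
      transversals_swap[of E B A C] transversals_swap[of E C A B] transversals_swap'[of E A C B]
    by (simp add: algebra_simps)
  finally have T: "(1 - 4 * \<eta>) * (1 / 9 - 5 * \<eta>) * u^3 \<le> 3 * real (card (transversals E A B C))"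
    by (simp add: power2_eq_square power3_eq_cube mult_ac)
  have "((1 - \<eta>) * n)^3 \<le> u^3" using un np eta by (intro power_mono) auto
  moreover have "(1 - 3 * \<eta>) * n^3 \<le> ((1 - \<eta>) * n)^3"
  proof -
    have "(1 - \<eta>)^3 - (1 - 3 * \<eta>) = \<eta>\<^sup>2 * (3 - \<eta>)" by (simp add: power2_eq_square power3_eq_cube algebra_simps)
    also have "\<dots> \<ge> 0" using eta by simp
    finally show ?thesis unfolding power_mult_distrib using np by (intro mult_right_mono) auto
  qed
  ultimately have u3: "(1 - 3 * \<eta>) * n^3 \<le> u^3" by linarith
  have "(1 / 9 - 9 * \<eta>) * n^3 \<le> ((1 / 9 - 6 * \<eta>) * (1 - 3 * \<eta>)) * n^3"
  proof (intro mult_right_mono)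
    have "(1 / 9 - 6 * \<eta>) * (1 - 3 * \<eta>) - (1 / 9 - 9 * \<eta>) = 8 / 3 * \<eta> + 18 * \<eta>\<^sup>2" by (simp add: power2_eq_square field_simps)
    also have "\<dots> \<ge> 0" using eta by simp
    finally show "1 / 9 - 9 * \<eta> \<le> (1 / 9 - 6 * \<eta>) * (1 - 3 * \<eta>)" by simp
  qed (use np in auto)
  also have "\<dots> \<le> (1 / 9 - 6 * \<eta>) * u^3" using u3 eta by (simp add: mult_left_mono mult.assoc)
  also have "\<dots> \<le> (1 - 4 * \<eta>) * (1 / 9 - 5 * \<eta>) * u^3"
  proof (intro mult_right_mono)
    have "(1 - 4 * \<eta>) * (1 / 9 - 5 * \<eta>) - (1 / 9 - 6 * \<eta>) = 5 / 9 * \<eta> + 20 * \<eta>\<^sup>2" by (simp add: power2_eq_square field_simps)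
    also have "\<dots> \<ge> 0" using eta by simp
    finally show "1 / 9 - 6 * \<eta> \<le> (1 - 4 * \<eta>) * (1 / 9 - 5 * \<eta>)" by simp
  qed (use u0 in auto)
  finally have "(1 / 27 - 3 * \<eta>) * n^3 \<le> card (transversals E A B C)" using T by (simp add: algebra_simps)
  then show thesis using that core unfolding n_def by simp
qed

section \<open>Reduction to the cancellative case\<close>

definition codegree :: "'a set set \<Rightarrow> 'a \<Rightarrow> 'a \<Rightarrow> 'a set" where
  "codegree E x y = {z. {x, y, z} \<in> E}"

lemma codegree_subset: "three_graph (V, E) \<Longrightarrow> codegree E x y \<subseteq> V"
  unfolding codegree_def using three_graph_edge by fastforce

lemma finite_codegree: "three_graph (V, E) \<Longrightarrow> finite (codegree E x y)"
  by (rule finite_subset[OF codegree_subset]) (auto dest: three_graph_finite)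

text \<open>\<open>G\<close> need only avoid \<open>f1\<close> to \<open>f5\<close>: its members
  form edges with \<open>f6\<close> and \<open>f7\<close> and so differ from these two.\<close>

lemma contains_F_simI:
  assumes tg: "three_graph (V, E)"
    and e: "{f1, f2, f3} \<in> E" "{f1, f2, f4} \<in> E" "{f3, f4, f5} \<in> E" "{f5, f6, f7} \<in> E"
    and d: "distinct [f1, f2, f3, f4, f5, f6, f7]"
    and G: "finite G" "t \<le> card G" "G \<subseteq> codegree E f6 f7" "G \<inter> {f1, f2, f3, f4, f5} = {}"
  shows "contains_copy (V, E) (F_sim t)"
proof -
  obtain T where T: "T \<subseteq> G" "card T = t" "finite T"
    using obtain_subset_with_card_n[OF G(2)] by blast
  obtain h where h: "bij_betw h {1..t} T" using ex_bij_betw_nat_finite_1[OF T(3)] T(2) by auto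
  define fs where "fs = [f1, f2, f3, f4, f5, f6, f7]"
  define \<phi> where "\<phi> v = (case v of Vf i \<Rightarrow> fs ! (i - 1) | Vg i \<Rightarrow> h i)" for v
  have hT: "h i \<in> T" if "i \<in> {1..t}" for i using h that by (auto simp: bij_betw_def)
  have hE: "{f6, f7, h i} \<in> E" if "i \<in> {1..t}" for i using hT[OF that] T G by (auto simp: codegree_def)
  have hf: "h i \<notin> set fs" if "i \<in> {1..t}" for i
    using hT[OF that] T(1) G(4) three_graph_edge[OF tg hE[OF that]] by (auto simp: fs_def)
  have nth: "fs ! 0 = f1" "fs ! 1 = f2" "fs ! 2 = f3" "fs ! 3 = f4" "fs ! 4 = f5" "fs ! 5 = f6" "fs ! 6 = f7"
    by (simp_all add: fs_def)
  have d': "distinct fs" using d by (simp add: fs_def)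
  have inf: "inj_on (\<lambda>i. fs ! (i - 1)) {1..7}"
    using d' by (auto simp: inj_on_def nth_eq_iff_index_eq fs_def[THEN arg_cong[where f = length], simplified])
  have infs: "fs ! (i - 1) \<in> set fs" if "i \<in> {1..7}" for i
    using that by (intro nth_mem) (auto simp: fs_def)
  have inj: "inj_on \<phi> (verts (F_sim t))"
  proof (rule inj_onI)
    fix u v assume u: "u \<in> verts (F_sim t)" and v: "v \<in> verts (F_sim t)" and eq: "\<phi> u = \<phi> v"
    show "u = v"
    proof (cases u)
      case (Vf i)
      then have i: "i \<in> {1..7}" using u by (auto simp: F_sim_def)
      show ?thesis
      proof (cases v)
        case (Vf j)
        then have "j \<in> {1..7}" using v by (auto simp: F_sim_def)
        then have "i = j" using i eq \<open>u = Vf i\<close> Vf inf by (auto simp: \<phi>_def dest: inj_onD)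
        then show ?thesis using \<open>u = Vf i\<close> Vf by simp
      next
        case (Vg j)
        then have "j \<in> {1..t}" using v by (auto simp: F_sim_def)
        then show ?thesis using hf[of j] infs[OF i] eq \<open>u = Vf i\<close> Vg by (auto simp: \<phi>_def)
      qed
    next
      case (Vg i)
      then have i: "i \<in> {1..t}" using u by (auto simp: F_sim_def)
      show ?thesis
      proof (cases v)
        case (Vf j)
        then have "j \<in> {1..7}" using v by (auto simp: F_sim_def)
        then show ?thesis using hf[OF i] infs[of j] eq \<open>u = Vg i\<close> Vf by (auto simp: \<phi>_def)
      next
        case (Vg j)
        then have "j \<in> {1..t}" using v by (auto simp: F_sim_def)
        then have "i = j" using i eq \<open>u = Vg i\<close> Vg h by (auto simp: \<phi>_def bij_betw_def dest: inj_onD)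
        then show ?thesis using \<open>u = Vg i\<close> Vg by simp
      qed
    qed
  qed
  have "set fs \<subseteq> V" using three_graph_edge[OF tg e(1)] three_graph_edge[OF tg e(2)]
      three_graph_edge[OF tg e(3)] three_graph_edge[OF tg e(4)] by (auto simp: fs_def)
  moreover have "h i \<in> V" if "i \<in> {1..t}" for i using three_graph_edge[OF tg hE[OF that]] by auto
  ultimately have V: "\<phi> ` verts (F_sim t) \<subseteq> verts (V, E)"
    using infs by (auto simp: F_sim_def \<phi>_def)
  have \<phi>: "\<phi> (Vf 1) = f1" "\<phi> (Vf 2) = f2" "\<phi> (Vf 3) = f3" "\<phi> (Vf 4) = f4" "\<phi> (Vf 5) = f5"
    "\<phi> (Vf 6) = f6" "\<phi> (Vf 7) = f7" "\<And>i. \<phi> (Vg i) = h i"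
    by (simp_all add: \<phi>_def fs_def)
  have "\<forall>e\<in>hedges (F_sim t). \<phi> ` e \<in> hedges (V, E)"
    using e hE by (auto simp: F_sim_def \<phi> simp del: One_nat_def)
  then show ?thesis using inj V unfolding contains_copy_def by blast
qed

text \<open>\<open>v\<close> plays \<open>f5\<close> and \<open>p\<close>, \<open>q\<close> play
  \<open>f6\<close>, \<open>f7\<close>. The vertices \<open>a\<close>, \<open>b\<close>,
  \<open>c\<close>, \<open>d\<close>, \<open>v\<close> spoil at most five candidates for the
  \<open>g_i\<close>, hence the threshold \<open>t + 5\<close>.\<close>

lemma F5_tip_link_light:
  assumes tg: "three_graph (V, E)" and fr: "\<not> contains_copy (V, E) (F_sim t)"
    and e: "{a, b, c} \<in> E" "{a, b, d} \<in> E" "c \<noteq> d" "{c, d, v} \<in> E" "v \<noteq> a" "v \<noteq> b"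
    and pq: "{v, p, q} \<in> E" "{p, q} \<inter> {a, b, c, d} = {}"
  shows "card (codegree E p q) < t + 5"
proof (rule ccontr)
  assume "\<not> ?thesis"
  then have big: "t + 5 \<le> card (codegree E p q)" by simp
  define G where "G = codegree E p q - {a, b, c, d, v}"
  have "card {a, b, c, d, v} \<le> 5" by (simp add: card_insert_if)
  then have "t \<le> card G" using big diff_card_le_card_Diff[of "{a, b, c, d, v}" "codegree E p q"] by (simp add: G_def)
  moreover have "distinct [a, b, c, d, v, p, q]"
    using three_graph_edge[OF tg e(1)] three_graph_edge[OF tg e(2)] three_graph_edge[OF tg e(4)]
      three_graph_edge[OF tg pq(1)] e pq(2) by auto
  moreover have "finite G" using finite_codegree[OF tg] by (simp add: G_def)
  ultimately have "contains_copy (V, E) (F_sim t)"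
    using contains_F_simI[OF tg e(1,2,4) pq(1), of G t] by (auto simp: G_def)
  then show False using fr by simp
qed

text \<open>One extremal choice replaces iterated deletion: comparing \<open>g F\<close> with
  \<open>g E\<close> shows that at most \<open>K\<close> edges are lost per ordered pair of
  vertices.\<close>

lemma clean_subgraph:
  fixes E :: "'a set set"
  assumes tg: "three_graph (V, E)"
  obtains E' where "E' \<subseteq> E" "card E \<le> card E' + K * (card V)\<^sup>2"
    "\<And>x y. (x, y) \<in> shadow E' \<Longrightarrow> K \<le> card (codegree E' x y)"
proof -
  have fE: "finite E" using three_graph_finite[OF tg] by simp
  \<comment> \<open>If a covered pair had codegree below \<open>K\<close>, deleting its edges would increase \<open>g\<close>.\<close>
  define g where "g F = real (card F) - real K * card (shadow F)" for F :: "'a set set"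
  obtain F where F: "F \<in> Pow E" "\<And>S. S \<in> Pow E \<Longrightarrow> g S \<le> g F"
    using finite_argmax[of "Pow E" g] fE by auto
  have tgF: "three_graph (V, F)" using three_graph_subset[OF tg] F(1) by auto
  have fF: "finite F" using three_graph_finite[OF tgF] by simp
  have "real (card E) - real K * card (shadow E) \<le> g F" using F(2)[of E] by (simp add: g_def)
  moreover have "g F \<le> card F" by (simp add: g_def)
  moreover have "card (shadow E) \<le> card (V \<times> V)"
    using shadow_subset[OF tg] three_graph_finite(1)[OF tg] by (intro card_mono) auto
  then have "K * card (shadow E) \<le> K * (card V)\<^sup>2" by (simp add: card_cartesian_product power2_eq_square)
  then have "real K * card (shadow E) \<le> real (K * (card V)\<^sup>2)" by (simp only: of_nat_mult[symmetric] of_nat_le_iff)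
  ultimately have "real (card E) \<le> real (card F + K * (card V)\<^sup>2)" by simp
  then have 1: "card E \<le> card F + K * (card V)\<^sup>2" by (simp only: of_nat_le_iff)
  have 2: "K \<le> card (codegree F x y)" if xy: "(x, y) \<in> shadow F" for x y
  proof (rule ccontr)
    assume lt: "\<not> ?thesis"
    define D where "D = {e \<in> F. {x, y} \<subseteq> e}"
    have "D \<subseteq> (\<lambda>z. {x, y, z}) ` codegree F x y"
    proof
      fix e assume e: "e \<in> D"
      then have "card e = 3" "{x, y} \<subseteq> e" "e \<in> F" using tgF by (auto simp: D_def three_graph_def)
      moreover have xyn: "x \<noteq> y" using xy by (auto simp: shadow_def)
      ultimately have "card (e - {x, y}) = 1" by (simp add: card_Diff_subset)
      then obtain z where "e - {x, y} = {z}" by (auto simp: card_1_singleton_iff)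
      then have "e = {x, y, z}" using \<open>{x, y} \<subseteq> e\<close> by auto
      then show "e \<in> (\<lambda>z. {x, y, z}) ` codegree F x y" using \<open>e \<in> F\<close> by (auto simp: codegree_def)
    qed
    then have "card D \<le> card (codegree F x y)"
      using surj_card_le finite_codegree[OF tgF] by blast
    then have D: "card D < K" using lt by simp
    have cF: "card (F - D) = card F - card D" "card D \<le> card F"
      using fF by (auto simp: D_def intro!: card_Diff_subset card_mono)
    have "shadow (F - D) \<subseteq> shadow F - {(x, y)}" by (auto simp: shadow_def D_def)
    then have "card (shadow (F - D)) \<le> card (shadow F - {(x, y)})"
      using finite_shadow[OF tgF] by (intro card_mono) auto
    also have "\<dots> < card (shadow F)" using xy finite_shadow[OF tgF] by (rule card_Diff1_less[rotated])
    finally have "card (shadow (F - D)) + 1 \<le> card (shadow F)" by simp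
    then have "K * (card (shadow (F - D)) + 1) \<le> K * card (shadow F)" by (rule mult_le_mono2)
    then have "real (K * (card (shadow (F - D)) + 1)) \<le> real (K * card (shadow F))" by (simp only: of_nat_le_iff)
    then have "real K * card (shadow (F - D)) + K \<le> real K * card (shadow F)" by (simp add: algebra_simps)
    moreover have "g (F - D) \<le> g F" using F by (intro F(2)) auto
    ultimately show False using cF D by (simp add: g_def of_nat_diff)
  qed
  show thesis using that[of F] F(1) 1 2 by blast
qed

lemma ex_avoiding:
  assumes "card X \<ge> 5" shows "\<exists>x\<in>X. x \<notin> {a, b, c, d}"
proof (rule ccontr)
  assume "\<not> ?thesis"
  then have "card X \<le> card {a, b, c, d}" by (intro card_mono) auto
  also have "\<dots> \<le> 4" by (simp add: card_insert_if)
  finally show False using assms by simp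
qed

text \<open>Codegree at least 5 lets each new vertex avoid four given ones. An edge
  \<open>{v, p, q}\<close> off the \<open>F_5\<close> is reached through the covered pairs
  \<open>v c\<close> and \<open>v p\<close>; then \<open>{p, q}\<close> is covered in
  \<open>E'\<close>, so its codegree is too large for the link of a tip.\<close>

lemma cancellative_clean_subgraph:
  assumes tg: "three_graph (V, E)" and fr: "\<not> contains_copy (V, E) (F_sim t)"
    and E': "E' \<subseteq> E" and heavy: "\<And>x y. (x, y) \<in> shadow E' \<Longrightarrow> t + 5 \<le> card (codegree E' x y)"
  shows "cancellative E'"
  unfolding cancellative_def
proof (intro allI impI notI)
  fix a b c d e assume e: "{a, b, c} \<in> E'" "{a, b, d} \<in> E'" "c \<noteq> d" "{c, d, e} \<in> E'"
  note tg' = three_graph_subset[OF tg E']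
  have big: "5 \<le> card (codegree E' x y)" if "(x, y) \<in> shadow E'" for x y using heavy[OF that] by simp
  \<comment> \<open>\<open>e\<close> may be \<open>a\<close> or \<open>b\<close>; a third vertex of
    \<open>{c, d}\<close> off both turns the configuration into a genuine
    \<open>F_5\<close>.\<close>
  obtain v where v: "{c, d, v} \<in> E'" "v \<noteq> a" "v \<noteq> b"
    using ex_avoiding[OF big[OF edge_shadow(1)[OF tg' e(4)]], of a b a b] by (auto simp: codegree_def)
  obtain p where p: "{v, c, p} \<in> E'" "p \<noteq> a" "p \<noteq> b" "p \<noteq> d"
    using ex_avoiding[OF big[OF edge_shadow(4)[OF tg' v(1)]], of a b d a] by (auto simp: codegree_def)
  obtain q where q: "{v, p, q} \<in> E'" "q \<noteq> a" "q \<noteq> b" "q \<noteq> c" "q \<noteq> d"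
    using ex_avoiding[OF big[OF edge_shadow(3)[OF tg' p(1)]], of a b c d] by (auto simp: codegree_def)
  have "card (codegree E p q) < t + 5"
  proof (rule F5_tip_link_light[OF tg fr])
    show "{a, b, c} \<in> E" "{a, b, d} \<in> E" "c \<noteq> d" "{c, d, v} \<in> E" "v \<noteq> a" "v \<noteq> b" "{v, p, q} \<in> E"
      using e v q E' by auto
    show "{p, q} \<inter> {a, b, c, d} = {}" using p q three_graph_edge[OF tg' p(1)] by auto
  qed
  moreover have "card (codegree E' p q) \<le> card (codegree E p q)"
    using E' by (intro card_mono finite_codegree[OF tg]) (auto simp: codegree_def)
  moreover have "t + 5 \<le> card (codegree E' p q)" using heavy edge_shadow(5)[OF tg' q(1)] by blast
  ultimately show False by simp
qed

lemma card_link_mono: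
  assumes "three_graph (V, E)" "E' \<subseteq> E" "S \<subseteq> T"
  shows "card (link E' v \<inter> S) \<le> card (link E v \<inter> T)"
  using assms(2,3) by (intro card_mono finite_Int disjI1 finite_link[OF assms(1)]) (auto simp: link_def)

lemma core_mono:
  assumes "three_graph (V, E)" "E' \<subseteq> E" "core V E' A B C" shows "core V E A B C"
proof -
  have *: "x \<le> 10 * real (card (link E' v \<inter> S)) \<Longrightarrow> x \<le> 10 * real (card (link E v \<inter> S))" for x v S
    using card_link_mono[OF assms(1,2) order_refl, of v S] by linarith
  show ?thesis using assms(3) * unfolding core_def by blast
qed

lemma card_transversals_mono:
  assumes "three_graph (V, E)" "E' \<subseteq> E" "A \<subseteq> A'" "A' \<subseteq> V"
  shows "card (transversals E' A B C) \<le> card (transversals E A' B C)"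
  using assms(2,3) by (intro card_mono finite_transversals[OF assms(1,4)]) (auto simp: transversals_def link_def)

lemma core_insert:
  assumes tg: "three_graph (V, E)" and core: "core V E A B C" and w: "w \<in> V" "w \<notin> A \<union> B \<union> C"
    and lw: "(real (card V))\<^sup>2 \<le> 10 * real (card (link E w \<inter> B \<times> C))"
  shows "core V E (insert w A) B C"
proof -
  have *: "x \<le> 10 * real (card (link E v \<inter> insert w A \<times> S))" if "x \<le> 10 * real (card (link E v \<inter> A \<times> S))" for x v S
  proof -
    have "card (link E v \<inter> A \<times> S) \<le> card (link E v \<inter> insert w A \<times> S)"
      by (intro card_link_mono[OF tg order_refl]) auto
    then show ?thesis using that by linarith
  qed
  show ?thesis using core w lw * unfolding core_def by auto
qed

text \<open>Among the cores with enough transversals, one covering the most vertices is taken. A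
  left-over vertex with \<open>n\<^sup>2 / 10\<close> link pairs across two parts could join the
  third part: the insertion preserves all core conditions and loses no transversal.\<close>

lemma maximal_core_exists:
  fixes \<eta> :: real
  assumes tg: "three_graph (V, E)" and fr: "\<not> contains_copy (V, E) (F_sim t)"
    and eta: "0 < \<eta>" "\<eta> \<le> 1 / 1000"
    and e: "(real (card V))^3 \<le> 27 * real (card E)"
    and n: "(27 * (real t + 5) + 2) / \<eta>\<^sup>2 \<le> card V"
  obtains A B C where "core V E A B C" "(1 / 27 - 3 * \<eta>) * (real (card V))^3 \<le> card (transversals E A B C)"
    "\<And>w. w \<in> V - (A \<union> B \<union> C) \<Longrightarrow> 10 * real (card (link E w \<inter> B \<times> C)) < (real (card V))\<^sup>2 \<and>
       10 * real (card (link E w \<inter> A \<times> C)) < (real (card V))\<^sup>2 \<and> 10 * real (card (link E w \<inter> A \<times> B)) < (real (card V))\<^sup>2"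
proof -
  define P where "P = (\<lambda>(A, B, C). core V E A B C \<and> (1 / 27 - 3 * \<eta>) * (real (card V))^3 \<le> card (transversals E A B C))"
  define S where "S = {p \<in> Pow V \<times> Pow V \<times> Pow V. P p}"
  obtain E' where E': "E' \<subseteq> E" "card E \<le> card E' + (t + 5) * (card V)\<^sup>2"
    "\<And>x y. (x, y) \<in> shadow E' \<Longrightarrow> t + 5 \<le> card (codegree E' x y)"
    using clean_subgraph[OF tg] by blast
  have c: "cancellative E'" using cancellative_clean_subgraph[OF tg fr E'(1,3)] .
  note tg' = three_graph_subset[OF tg E'(1)]
  have "real (card E) \<le> real (card E' + (t + 5) * (card V)\<^sup>2)" using E'(2) by (simp only: of_nat_le_iff)
  then have "(real (card V))^3 - 27 * real (t + 5) * (real (card V))\<^sup>2 \<le> 27 * real (card E')"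
    using e by (simp add: algebra_simps)
  moreover have "(27 * real (t + 5) + 2) / \<eta>\<^sup>2 \<le> card V" using n by simp
  ultimately obtain A B C where ABC: "core V E' A B C"
      "(1 / 27 - 3 * \<eta>) * (real (card V))^3 \<le> card (transversals E' A B C)"
    using core_exists[OF tg' c eta, of "real (t + 5)"] by auto
  have "core V E A B C" using core_mono[OF tg E'(1) ABC(1)] .
  moreover have "card (transversals E' A B C) \<le> card (transversals E A B C)"
    using ABC(1) by (intro card_transversals_mono[OF tg E'(1)]) (auto simp: core_def)
  ultimately have "(A, B, C) \<in> S" using ABC(2) by (auto simp: S_def P_def core_def)
  then have "S \<noteq> {}" by auto
  moreover have "finite S" using three_graph_finite[OF tg] by (auto simp: S_def)
  ultimately obtain p where p: "p \<in> S" "\<And>q. q \<in> S \<Longrightarrow> real ((\<lambda>(A, B, C). card (A \<union> B \<union> C)) q) \<le> real ((\<lambda>(A, B, C). card (A \<union> B \<union> C)) p)"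
    using finite_argmax[of S "\<lambda>q. real ((\<lambda>(A, B, C). card (A \<union> B \<union> C)) q)"] by blast
  obtain A B C where ABC: "p = (A, B, C)" by (cases p) auto
  have co: "core V E A B C" and tr: "(1 / 27 - 3 * \<eta>) * (real (card V))^3 \<le> card (transversals E A B C)"
    using p(1) by (auto simp: S_def P_def ABC)
  have no: False if w: "w \<in> V - (X \<union> Y \<union> Z)" and X: "core V E (insert w X) Y Z \<Longrightarrow> P p'" "fst p' \<subseteq> V"
     "fst (snd p') \<subseteq> V" "snd (snd p') \<subseteq> V"
     "fst p' \<union> fst (snd p') \<union> snd (snd p') = insert w (A \<union> B \<union> C)" "X \<union> Y \<union> Z = A \<union> B \<union> C"
     "core V E X Y Z" "(real (card V))\<^sup>2 \<le> 10 * real (card (link E w \<inter> Y \<times> Z))" for w X Y Z p'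
  proof -
    have "P p'" using X(1) core_insert[OF tg X(7), of w] w X(8) by auto
    then have "p' \<in> S" using X(2-4) by (cases p') (auto simp: S_def)
    then have "card (insert w (A \<union> B \<union> C)) \<le> card (A \<union> B \<union> C)"
      using p(2)[of p'] X(5) by (auto simp: ABC split: prod.splits)
    moreover have "finite (A \<union> B \<union> C)"
      using co three_graph_finite(1)[OF tg] finite_subset[of "A \<union> B \<union> C" V] by (auto simp: core_def)
    ultimately show False using w X(6) by auto
  qed
  have sub: "A \<subseteq> V" "B \<subseteq> V" "C \<subseteq> V" using co by (auto simp: core_def)
  have trm: "card (transversals E A B C) \<le> card (transversals E (insert w A) B C)"
    "card (transversals E A B C) \<le> card (transversals E A (insert w B) C)"
    "card (transversals E A B C) \<le> card (transversals E A B (insert w C))" if "w \<in> V" for w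
  proof -
    show "card (transversals E A B C) \<le> card (transversals E (insert w A) B C)"
      using sub that by (intro card_transversals_mono[OF tg]) auto
    show "card (transversals E A B C) \<le> card (transversals E A (insert w B) C)"
      using sub that unfolding transversals_swap[of E A "insert w B"] transversals_swap[of E A B]
      by (intro card_transversals_mono[OF tg]) auto
    show "card (transversals E A B C) \<le> card (transversals E A B (insert w C))"
      using sub that unfolding transversals_swap'[of E A B] transversals_swap[of E A "insert w C"] transversals_swap[of E A C]
      by (intro card_transversals_mono[OF tg]) auto
  qed
  have 1: "10 * real (card (link E w \<inter> B \<times> C)) < (real (card V))\<^sup>2" if w: "w \<in> V - (A \<union> B \<union> C)" for w
    using no[of w A B C "(insert w A, B, C)"] w sub co trm(1)[of w] tr by (force simp: P_def)
  have 2: "10 * real (card (link E w \<inter> A \<times> C)) < (real (card V))\<^sup>2" if w: "w \<in> V - (A \<union> B \<union> C)" for w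
    using no[of w B A C "(A, insert w B, C)"] w sub core_swap[OF co] trm(2)[of w] tr core_swap[of V E "insert w B" A C]
    by (force simp: P_def)
  have 3: "10 * real (card (link E w \<inter> A \<times> B)) < (real (card V))\<^sup>2" if w: "w \<in> V - (A \<union> B \<union> C)" for w
    using no[of w C A B "(A, B, insert w C)"] w sub core_swap[OF core_swap'[OF co]] trm(3)[of w] tr
      core_swap'[OF core_swap[of V E "insert w C" A B]]
    by (force simp: P_def)
  show thesis using that[OF co tr] 1 2 3 by blast
qed

section \<open>Vertices outside the tripartite core\<close>

lemma amgm3:
  fixes x y z :: real
  assumes "0 \<le> x" "0 \<le> y" "0 \<le> z"
  shows "27 * (x * y * z) \<le> (x + y + z)^3"
proof -
  have "0 \<le> (x + y + z) * ((x - y)\<^sup>2 + (y - z)\<^sup>2 + (x - z)\<^sup>2) / 2 + 3 * (x * (y - z)\<^sup>2 + y * (x - z)\<^sup>2 + z * (x - y)\<^sup>2)"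
    using assms by (intro add_nonneg_nonneg mult_nonneg_nonneg divide_nonneg_nonneg) auto
  also have "\<dots> = (x + y + z)^3 - 27 * (x * y * z)"
    by (simp add: power2_eq_square power3_eq_cube field_simps)
  finally show ?thesis by simp
qed

text \<open>For fixed \<open>x\<close> the product is at most
  \<open>x * (n - x)\<^sup>2 / 4\<close>, and \<open>4 / 27 * n^3 - x * (n - x)\<^sup>2\<close>
  equals \<open>(x - n / 3)\<^sup>2 * (4 / 3 * n - x)\<close>, whose last factor is at least
  \<open>n / 3\<close>. The constant 1/12 is chosen so that this yields exactly
  \<open>\<sigma> * n\<close>.\<close>

lemma product_near_max:
  fixes x y z n \<sigma> :: real
  assumes "0 \<le> x" "0 \<le> y" "0 \<le> z" "x + y + z \<le> n" "0 < n" "0 \<le> \<sigma>"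
    and p: "(1 / 27 - \<sigma>\<^sup>2 / 12) * n^3 \<le> x * y * z"
  shows "\<bar>x - n / 3\<bar> \<le> \<sigma> * n"
proof -
  have "4 * (y * z) \<le> (y + z)\<^sup>2"
    using zero_le_power2[of "y - z"] by (simp add: power2_eq_square algebra_simps)
  also have "\<dots> \<le> (n - x)\<^sup>2" using assms by (intro power_mono) auto
  finally have "x * (4 * (y * z)) \<le> x * (n - x)\<^sup>2" using assms by (intro mult_left_mono) auto
  then have "(4 / 27 - \<sigma>\<^sup>2 / 3) * n^3 \<le> x * (n - x)\<^sup>2" using p by (simp add: algebra_simps)
  moreover have "x * (n - x)\<^sup>2 = 4 / 27 * n^3 - (x - n / 3)\<^sup>2 * (4 / 3 * n - x)"
    by (simp add: power2_eq_square power3_eq_cube field_simps)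
  ultimately have "(x - n / 3)\<^sup>2 * (4 / 3 * n - x) \<le> \<sigma>\<^sup>2 / 3 * n^3" by (simp add: algebra_simps)
  moreover have "(x - n / 3)\<^sup>2 * (n / 3) \<le> (x - n / 3)\<^sup>2 * (4 / 3 * n - x)"
    using assms by (intro mult_left_mono) auto
  ultimately have "(x - n / 3)\<^sup>2 * (n / 3) \<le> (\<sigma>\<^sup>2 * n\<^sup>2) * (n / 3)"
    by (simp add: power2_eq_square power3_eq_cube mult_ac)
  then have "(x - n / 3)\<^sup>2 \<le> (\<sigma> * n)\<^sup>2" using assms by (simp add: power_mult_distrib)
  then show ?thesis using assms by (simp add: abs_le_square_iff[symmetric])
qed

lemma card_pairs_meeting:
  assumes "finite V" "card S \<le> k" "finite S"
  shows "card (S \<times> V \<union> V \<times> S) \<le> 2 * (k * card V)"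
proof -
  have "card (S \<times> V \<union> V \<times> S) \<le> card (S \<times> V) + card (V \<times> S)" by (rule card_Un_le)
  also have "\<dots> = 2 * (card S * card V)" by (simp add: card_cartesian_product)
  also have "\<dots> \<le> 2 * (k * card V)" using assms(2) by simp
  finally show ?thesis .
qed

definition missing :: "'a set set \<Rightarrow> 'a set \<Rightarrow> 'a set \<Rightarrow> 'a set \<Rightarrow> ('a \<times> 'a \<times> 'a) set" where
  "missing E A B C = A \<times> B \<times> C - transversals E A B C"

lemma card_missing:
  assumes "finite A" "finite B" "finite C"
  shows "card (missing E A B C) + card (transversals E A B C) = card A * card B * card C"
proof -
  have sub: "transversals E A B C \<subseteq> A \<times> B \<times> C" by (auto simp: transversals_def)
  moreover have "finite (A \<times> B \<times> C)" using assms by simp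
  ultimately have "card (missing E A B C) = card (A \<times> B \<times> C) - card (transversals E A B C)"
      "card (transversals E A B C) \<le> card (A \<times> B \<times> C)"
    unfolding missing_def by (auto intro: card_Diff_subset finite_subset card_mono)
  then show ?thesis by (simp add: card_cartesian_product)
qed

lemma card_pairs_missing:
  fixes d :: real
  assumes fin: "finite A" "finite B" "finite C" and P: "P \<subseteq> B \<times> C"
    and d: "\<And>y z. (y, z) \<in> P \<Longrightarrow> d \<le> card {x \<in> A. {x, y, z} \<notin> E}"
  shows "card P * d \<le> card (missing E A B C)"
proof -
  have fP: "finite P" using P fin finite_subset[of P "B \<times> C"] by auto
  have "card P * d = (\<Sum>p\<in>P. d)" by simp
  also have "\<dots> \<le> (\<Sum>p\<in>P. real (card {x \<in> A. {x, fst p, snd p} \<notin> E}))"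
    using d by (intro sum_mono) auto
  also have "\<dots> = card (Sigma P (\<lambda>p. {x \<in> A. {x, fst p, snd p} \<notin> E}))"
    using fP fin by (subst card_SigmaI) auto
  finally have "card P * d \<le> card (Sigma P (\<lambda>p. {x \<in> A. {x, fst p, snd p} \<notin> E}))" .
  moreover have "card (Sigma P (\<lambda>p. {x \<in> A. {x, fst p, snd p} \<notin> E})) =
      card ((\<lambda>(p, x). (x, p)) ` (Sigma P (\<lambda>p. {x \<in> A. {x, fst p, snd p} \<notin> E})))"
    by (rule card_image[symmetric]) (auto simp: inj_on_def)
  moreover have "\<dots> \<le> card (missing E A B C)"
    using P fin by (intro card_mono) (auto simp: missing_def transversals_def link_def)
  ultimately show ?thesis by linarith
qed

text \<open>Unordered pairs, in contrast to links, so that they are counted by binomial coefficients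
  as in \<open>part_count\<close>.\<close>

definition same_pairs :: "'a set \<Rightarrow> 'a set \<Rightarrow> 'a set \<Rightarrow> 'a set set" where
  "same_pairs A B C = {p. card p = 2 \<and> (p \<subseteq> A \<or> p \<subseteq> B \<or> p \<subseteq> C)}"

lemma card_same_pairs:
  assumes "finite A" "finite B" "finite C" "A \<inter> B = {}" "A \<inter> C = {}" "B \<inter> C = {}"
  shows "card (same_pairs A B C) = (card A choose 2) + (card B choose 2) + (card C choose 2)"
    and "finite (same_pairs A B C)"
proof -
  have ne: "p \<noteq> {}" if "card p = 2" for p :: "'a set" using that by auto
  have eq: "same_pairs A B C = {p. p \<subseteq> A \<and> card p = 2} \<union> {p. p \<subseteq> B \<and> card p = 2} \<union> {p. p \<subseteq> C \<and> card p = 2}"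
    by (auto simp: same_pairs_def)
  have d: "{p. p \<subseteq> X \<and> card p = 2} \<inter> {p. p \<subseteq> Y \<and> card p = 2} = {}" if "X \<inter> Y = {}" for X Y :: "'a set"
    using that ne by fastforce
  have f: "finite {p. p \<subseteq> X \<and> card p = 2}" if "finite X" for X :: "'a set" using that by simp
  show "card (same_pairs A B C) = (card A choose 2) + (card B choose 2) + (card C choose 2)"
    unfolding eq using assms d f
    by (subst card_Un_disjoint, simp_all add: Int_Un_distrib2 card_Un_disjoint n_subsets)
  show "finite (same_pairs A B C)" unfolding eq using assms by simp
qed

text \<open>\<open>T\<close> forces all part sizes to within \<open>\<sigma> * n\<close> of
  \<open>n / 3\<close>, \<open>s1\<close> keeps \<open>t\<close> errors of relative size
  \<open>\<sigma>\<close> small, and \<open>n6\<close>, \<open>sn\<close> make the terms linear in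
  \<open>n\<close> negligible. All assumptions are symmetric in the parts.\<close>

locale tricore =
  fixes t :: nat and V :: "'a set" and E :: "'a set set" and A B C :: "'a set" and \<sigma> :: real
  assumes tg: "three_graph (V, E)" and fr: "\<not> contains_copy (V, E) (F_sim t)"
    and core: "core V E A B C"
    and t1: "t \<ge> 1" and s0: "0 < \<sigma>" and s1: "\<sigma> * (1000 * (t + 1)) \<le> 1"
    and T: "(1 / 27 - \<sigma>\<^sup>2 / 12) * (real (card V))^3 \<le> card (transversals E A B C)"
    and maxi: "\<And>w. w \<in> V - (A \<union> B \<union> C) \<Longrightarrow> 10 * real (card (link E w \<inter> B \<times> C)) < (real (card V))\<^sup>2 \<and>
       10 * real (card (link E w \<inter> A \<times> C)) < (real (card V))\<^sup>2 \<and> 10 * real (card (link E w \<inter> A \<times> B)) < (real (card V))\<^sup>2"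
    and n6: "1000000 * (real t + 1)\<^sup>2 \<le> card V"
    and sn: "100 \<le> \<sigma> * card V"
begin

text \<open>Together with \<open>swap'\<close> this generates all permutations of the parts, so most
  facts are proved for one part and transferred; \<open>tricore.swap[OF swap']\<close> brings
  \<open>C\<close> to the front.\<close>

lemma swap: "tricore t V E B A C \<sigma>"
  using tg fr core_swap[OF core] t1 s0 s1 T maxi n6 sn
  by unfold_locales (auto simp: transversals_swap[of E B A C] card_link_swap[of E _ B A])

lemma swap': "tricore t V E A C B \<sigma>"
  using tg fr core_swap'[OF core] t1 s0 s1 T maxi n6 sn
  by unfold_locales (auto simp: transversals_swap'[of E A C B] card_link_swap[of E _ C B])

abbreviation n :: real where "n \<equiv> real (card V)"

lemma sub: "A \<subseteq> V" "B \<subseteq> V" "C \<subseteq> V" "A \<union> B \<union> C \<subseteq> V" and dis: "A \<inter> B = {}" "A \<inter> C = {}" "B \<inter> C = {}"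
  using core by (auto simp: core_def)

lemma fin: "finite V" "finite A" "finite B" "finite C"
  using three_graph_finite[OF tg] sub finite_subset by auto

lemma n_ge: "n \<ge> 4000000" "n \<ge> 1000000 * (real t + 1)" "n > 0"
proof -
  have "(real t + 1)\<^sup>2 \<ge> 2\<^sup>2" using t1 by (intro power_mono) auto
  then show "n \<ge> 4000000" using n6 by simp
  then show "n > 0" by simp
  have "(real t + 1) * 1 \<le> (real t + 1)\<^sup>2" unfolding power2_eq_square by (intro mult_left_mono) auto
  then show "n \<ge> 1000000 * (real t + 1)" using n6 by simp
qed

lemma n_mult: "4000000 * n \<le> n\<^sup>2" "100 * n \<le> \<sigma> * n\<^sup>2"
  using mult_right_mono[OF n_ge(1), of n] mult_right_mono[OF sn, of n] by (auto simp: power2_eq_square)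

lemma s_le: "\<sigma> \<le> 1 / 2000" "\<sigma> * t \<le> 1 / 1000" "\<sigma>\<^sup>2 \<le> \<sigma> / 2000"
proof -
  have "\<sigma> * 2000 \<le> \<sigma> * (1000 * (t + 1))" using s0 t1 by (intro mult_left_mono) auto
  then show 1: "\<sigma> \<le> 1 / 2000" using s1 by simp
  show "\<sigma> * t \<le> 1 / 1000" using s0 s1 by (simp add: algebra_simps)
  show "\<sigma>\<^sup>2 \<le> \<sigma> / 2000" using 1 s0 mult_left_mono[OF 1, of \<sigma>] by (simp add: power2_eq_square)
qed

section \<open>Part sizes and missing transversals\<close>

lemma card_parts: "card A + card B + card C = card (A \<union> B \<union> C)" "real (card A) + card B + card C \<le> n"
proof -
  show 1: "card A + card B + card C = card (A \<union> B \<union> C)"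
    using fin dis by (simp add: card_Un_disjoint Int_Un_distrib2)
  have "card (A \<union> B \<union> C) \<le> card V" using fin sub by (intro card_mono) auto
  then show "real (card A) + card B + card C \<le> n" using 1 by linarith
qed

lemma card_transversals_le: "card (transversals E A B C) \<le> card A * card B * card C"
  using card_missing[OF fin(2-4), of E] by simp

lemma prod_parts: "(1 / 27 - \<sigma>\<^sup>2 / 12) * n^3 \<le> real (card A) * card B * card C"
proof -
  have "real (card (transversals E A B C)) \<le> real (card A * card B * card C)"
    using card_transversals_le by (simp only: of_nat_le_iff)
  then show ?thesis using T by simp
qed

lemma card_A: "\<bar>real (card A) - n / 3\<bar> \<le> \<sigma> * n"
  using card_parts(2) prod_parts s0 n_ge by (intro product_near_max[of _ "card B" "card C"]) auto

lemma card_A_bounds: "33 / 100 * n \<le> card A" "card A \<le> (1 / 3 + \<sigma>) * n" "card A \<le> 334 / 1000 * n"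
proof -
  have "\<sigma> * n \<le> 1 / 2000 * n" using s_le n_ge by (intro mult_right_mono) auto
  then show "33 / 100 * n \<le> card A" "card A \<le> 334 / 1000 * n" using card_A unfolding abs_le_iff by linarith+
  show "card A \<le> (1 / 3 + \<sigma>) * n" using card_A by (simp add: algebra_simps abs_le_iff)
qed

lemma card_missing_le: "card (missing E A B C) \<le> \<sigma>\<^sup>2 / 12 * n^3"
proof -
  have "27 * (real (card A) * card B * card C) \<le> (real (card A) + card B + card C)^3" by (rule amgm3) auto
  also have "\<dots> \<le> n^3" using card_parts by (intro power_mono) auto
  finally have "27 * (real (card A) * card B * card C) \<le> n^3" .
  moreover have "real (card (missing E A B C)) + card (transversals E A B C) = real (card A) * card B * card C"
    using card_missing[OF fin(2-4), of E] by (metis of_nat_add of_nat_mult)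
  ultimately show ?thesis using T by (simp add: algebra_simps)
qed

text \<open>The threshold of \<open>F5_tip_link_light\<close>: off the other four vertices of the
  \<open>F_5\<close>, the link of a tip contains no pair of larger codegree.\<close>

definition light :: "'a set \<Rightarrow> 'a set \<Rightarrow> ('a \<times> 'a) set" where
  "light Y Z = {(y, z) \<in> Y \<times> Z. card (codegree E y z) < t + 5}"

lemma codegree_compl: 
  assumes "card (codegree E y z) < t + 5"
  shows "n / 4 \<le> card {x \<in> A. {x, y, z} \<notin> E}"
proof -
  have "A - {x \<in> A. {x, y, z} \<notin> E} \<subseteq> codegree E y z" by (auto simp: codegree_def insert_commute)
  then have "card (A - {x \<in> A. {x, y, z} \<notin> E}) \<le> card (codegree E y z)"
    by (intro card_mono finite_codegree[OF tg])
  moreover have "card A - card {x \<in> A. {x, y, z} \<notin> E} \<le> card (A - {x \<in> A. {x, y, z} \<notin> E})"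
    using fin by (intro diff_card_le_card_Diff) auto
  ultimately have "card A \<le> card {x \<in> A. {x, y, z} \<notin> E} + (t + 5)" using assms by simp
  then have "real (card A) \<le> real (card {x \<in> A. {x, y, z} \<notin> E}) + (real t + 5)" by linarith
  moreover have "real t + 5 \<le> 8 / 100 * n" using n_ge(2) by simp
  ultimately show ?thesis using card_A_bounds(1) by linarith
qed

lemma card_light_missing:
  assumes "P \<subseteq> light B C" shows "card P * (n / 4) \<le> card (missing E A B C)"
  using assms codegree_compl by (intro card_pairs_missing fin) (auto simp: light_def)

lemma card_light: "card (light B C) \<le> \<sigma>\<^sup>2 / 3 * n\<^sup>2" "finite (light B C)"
proof -
  have "card (light B C) * (n / 4) \<le> \<sigma>\<^sup>2 / 12 * n^3"
    using card_light_missing[OF order_refl] card_missing_le by linarith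
  then have "card (light B C) * n \<le> (\<sigma>\<^sup>2 / 3 * n\<^sup>2) * n" by (simp add: power2_eq_square power3_eq_cube mult_ac)
  then show "card (light B C) \<le> \<sigma>\<^sup>2 / 3 * n\<^sup>2" using n_ge(3) by (simp only: mult_le_cancel_right_pos)
  have "light B C \<subseteq> B \<times> C" by (auto simp: light_def)
  then show "finite (light B C)" using fin finite_subset by blast
qed

text \<open>Of the \<open>n\<^sup>2 / 10\<close> link pairs in \<open>B \<times> C\<close>, at most
  \<open>n\<^sup>2 / 100\<close> are light and \<open>8 * n\<close> meet \<open>S\<close>. Size four
  leaves room for the vertices other than the tip in an \<open>F_5\<close>.\<close>

lemma active_A:
  assumes v: "v \<in> A" and S: "finite S" "card S \<le> 4"
  shows "\<exists>p q. {v, p, q} \<in> E \<and> {p, q} \<inter> S = {} \<and> t + 5 \<le> card (codegree E p q)"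
proof (rule ccontr)
  assume no: "\<not> ?thesis"
  have "link E v \<inter> B \<times> C \<subseteq> light B C \<union> (S \<times> V \<union> V \<times> S)"
  proof
    fix x assume x: "x \<in> link E v \<inter> B \<times> C"
    then obtain p q where pq: "x = (p, q)" "{v, p, q} \<in> E" "p \<in> B" "q \<in> C" by (auto simp: link_def)
    then have "\<not> ({p, q} \<inter> S = {} \<and> t + 5 \<le> card (codegree E p q))" using no by blast
    then show "x \<in> light B C \<union> (S \<times> V \<union> V \<times> S)"
      using pq sub by (auto simp: light_def)
  qed
  then have "card (link E v \<inter> B \<times> C) \<le> card (light B C \<union> (S \<times> V \<union> V \<times> S))"
    using card_light S fin by (intro card_mono) auto
  also have "\<dots> \<le> card (light B C) + 2 * (4 * card V)"
    using card_pairs_meeting[OF fin(1) S(2,1)] by (meson add_le_mono card_Un_le le_trans order_refl)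
  finally have "real (card (link E v \<inter> B \<times> C)) \<le> card (light B C) + 8 * n" by linarith
  moreover have "n\<^sup>2 \<le> 10 * real (card (link E v \<inter> B \<times> C))" using core v by (auto simp: core_def)
  moreover have "\<sigma>\<^sup>2 / 3 * n\<^sup>2 \<le> 1 / 100 * n\<^sup>2" using s_le by (intro mult_right_mono) auto
  ultimately show False using card_light(1) n_mult n_ge by linarith
qed

lemma active:
  assumes v: "v \<in> A \<union> B \<union> C" and S: "finite S" "card S \<le> 4"
  shows "\<exists>p q. {v, p, q} \<in> E \<and> {p, q} \<inter> S = {} \<and> t + 5 \<le> card (codegree E p q)"
  using v active_A[OF _ S] tricore.active_A[OF swap _ S] tricore.active_A[OF tricore.swap[OF swap'] _ S] by auto

lemma no_tip:
  assumes v: "v \<in> A \<union> B \<union> C"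
    and e: "{a, b, c} \<in> E" "{a, b, d} \<in> E" "c \<noteq> d" "{c, d, v} \<in> E" "v \<noteq> a" "v \<noteq> b"
  shows False
proof -
  have "card {a, b, c, d} \<le> 4" by (simp add: card_insert_if)
  then obtain p q where "{v, p, q} \<in> E" "{p, q} \<inter> {a, b, c, d} = {}" "t + 5 \<le> card (codegree E p q)"
    using active[OF v, of "{a, b, c, d}"] by auto
  then show False using F5_tip_link_light[OF tg fr e] by fastforce
qed

text \<open>Two sets of at least \<open>n\<^sup>2 / 10\<close> pairs inside
  \<open>B \<times> C\<close>, which has fewer than \<open>12 / 100 * n\<^sup>2\<close>, overlap in
  more pairs than the \<open>8 * n\<close> that can meet \<open>S\<close>. This is the use of a core
  threshold above half of \<open>n\<^sup>2 / 9\<close>.\<close>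

lemma common_A:
  assumes x: "x \<in> A" "x' \<in> A" and S: "finite S" "card S \<le> 4"
  shows "\<exists>y z. {x, y, z} \<in> E \<and> {x', y, z} \<in> E \<and> y \<notin> S \<and> z \<notin> S \<and> y \<in> A \<union> B \<union> C \<and> z \<in> A \<union> B \<union> C"
proof (rule ccontr)
  assume no: "\<not> ?thesis"
  define X where "X = link E x \<inter> B \<times> C"
  define X' where "X' = link E x' \<inter> B \<times> C"
  have fX: "finite X" "finite X'" using finite_link[OF tg] by (auto simp: X_def X'_def)
  have "X \<inter> X' \<subseteq> S \<times> V \<union> V \<times> S"
  proof
    fix p assume "p \<in> X \<inter> X'"
    then obtain y z where "p = (y, z)" "{x, y, z} \<in> E" "{x', y, z} \<in> E" "y \<in> B" "z \<in> C"
      by (auto simp: link_def X_def X'_def)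
    moreover from this have "y \<in> S \<or> z \<in> S" using no by blast
    ultimately show "p \<in> S \<times> V \<union> V \<times> S" using sub by auto
  qed
  then have "card (X \<inter> X') \<le> card (S \<times> V \<union> V \<times> S)" using S fin by (intro card_mono) auto
  also have "\<dots> \<le> 2 * (4 * card V)" using card_pairs_meeting[OF fin(1) S(2,1)] .
  finally have 1: "real (card (X \<inter> X')) \<le> 8 * n" by linarith
  have "card (X \<union> X') \<le> card (B \<times> C)" using fin by (intro card_mono) (auto simp: X_def X'_def)
  moreover have "card X + card X' = card (X \<union> X') + card (X \<inter> X')" using fX by (rule card_Un_Int)
  ultimately have "card X + card X' \<le> card B * card C + card (X \<inter> X')" by (simp add: card_cartesian_product)
  then have "real (card X + card X') \<le> real (card B * card C + card (X \<inter> X'))" by (simp only: of_nat_le_iff)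
  then have "real (card X) + card X' \<le> real (card B) * card C + card (X \<inter> X')" by simp
  moreover have "real (card B) * card C \<le> (334 / 1000 * n) * (334 / 1000 * n)"
    using tricore.card_A_bounds(3)[OF swap] tricore.card_A_bounds(3)[OF tricore.swap[OF swap']] by (intro mult_mono) auto
  then have "real (card B) * card C \<le> 111556 / 1000000 * n\<^sup>2" by (simp add: power2_eq_square)
  moreover have "111556 / 1000000 * n\<^sup>2 \<le> 12 / 100 * n\<^sup>2" by (intro mult_right_mono) auto
  moreover have "n\<^sup>2 \<le> 10 * real (card X)" "n\<^sup>2 \<le> 10 * real (card X')"
    using core x by (auto simp: core_def X_def X'_def)
  ultimately show False using 1 n_mult n_ge by linarith
qed

lemma same_pairs_swap: "same_pairs B A C = same_pairs A B C" "same_pairs A C B = same_pairs A B C"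
  by (auto simp: same_pairs_def)

lemma common:
  assumes "{x, x'} \<in> same_pairs A B C" and S: "finite S" "card S \<le> 4"
  obtains y z where "{x, y, z} \<in> E" "{x', y, z} \<in> E" "y \<notin> S" "z \<notin> S" "y \<in> A \<union> B \<union> C" "z \<in> A \<union> B \<union> C"
proof -
  have U: "B \<union> A \<union> C = A \<union> B \<union> C" "C \<union> A \<union> B = A \<union> B \<union> C" by auto
  have "x \<in> A \<and> x' \<in> A \<or> x \<in> B \<and> x' \<in> B \<or> x \<in> C \<and> x' \<in> C" using assms by (auto simp: same_pairs_def)
  then show thesis
    using that common_A[OF _ _ S, of x x'] tricore.common_A[OF swap _ _ S, of x x', unfolded U]
      tricore.common_A[OF tricore.swap[OF swap'] _ _ S, of x x', unfolded U] by blast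
qed

lemma same_pairs_facts:
  assumes "{x, x'} \<in> same_pairs A B C"
  shows "x \<noteq> x'" "x \<in> A \<union> B \<union> C" "x' \<in> A \<union> B \<union> C"
  using assms by (auto simp: same_pairs_def)

text \<open>For a common link pair \<open>y z\<close> of \<open>x\<close> and \<open>x'\<close>, the
  edges \<open>{y, z, x}\<close>, \<open>{y, z, x'}\<close>, \<open>{x, x', w}\<close> form an
  \<open>F_5\<close> with tip \<open>w\<close>. Thus a single pair inside a part makes the rest of
  the link of \<open>w\<close> light.\<close>

lemma same_pair_light:
  assumes p: "{x, x'} \<in> same_pairs A B C" "{x, x', w} \<in> E" and pq: "{w, p, q} \<in> E" "{p, q} \<inter> {x, x'} = {}"
  shows "card (codegree E p q) < t + 5"
proof -
  have "card {p, q, w} \<le> 4" by (simp add: card_insert_if)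
  then obtain y z where yz: "{x, y, z} \<in> E" "{x', y, z} \<in> E" "y \<notin> {p, q, w}" "z \<notin> {p, q, w}"
    using common[OF p(1), of "{p, q, w}"] by blast
  show ?thesis
  proof (rule F5_tip_link_light[OF tg fr _ _ _ p(2) _ _ pq(1)])
    show "{y, z, x} \<in> E" "{y, z, x'} \<in> E" using yz by (auto simp: insert_commute)
    show "{p, q} \<inter> {y, z, x, x'} = {}" using yz pq by auto
  qed (use yz same_pairs_facts[OF p(1)] in auto)
qed

lemma no_bad:
  assumes p: "{x, x'} \<in> same_pairs A B C" "{x, x', v} \<in> E" shows "v \<notin> A \<union> B \<union> C"
proof
  assume v: "v \<in> A \<union> B \<union> C"
  have "card {x, x'} \<le> 4" by (simp add: card_insert_if)
  then obtain p q where "{v, p, q} \<in> E" "{p, q} \<inter> {x, x'} = {}" "t + 5 \<le> card (codegree E p q)"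
    using active[OF v, of "{x, x'}"] by auto
  then show False using same_pair_light[OF p] by fastforce
qed

section \<open>Links of the vertices outside the core\<close>

definition W :: "'a set" where "W = V - (A \<union> B \<union> C)"

definition same_link :: "'a \<Rightarrow> 'a set set" where
  "same_link w = {p \<in> same_pairs A B C. insert w p \<in> E}"

definition cross :: "'a \<Rightarrow> nat" where
  "cross w = card (link E w \<inter> B \<times> C) + card (link E w \<inter> A \<times> C) + card (link E w \<inter> A \<times> B)"

text \<open>At most \<open>2 * card V\<close> pairs meet two given vertices, so a vertex of
  \<open>Q\<close> has a same-part link pair avoiding any two vertices, whereas a vertex of
  \<open>W - Q\<close> contributes only linearly many such pairs.\<close>

definition Q :: "'a set" where "Q = {w \<in> W. 2 * card V < card (same_link w)}"

lemma swap_W: "tricore.W V B A C = W" "tricore.W V A C B = W"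
  unfolding tricore.W_def[OF swap] tricore.W_def[OF swap'] W_def by auto

lemma fin_W: "finite W" "finite Q" "Q \<subseteq> W" "W \<subseteq> V" "W \<inter> (A \<union> B \<union> C) = {}"
  using fin by (auto simp: W_def Q_def)

lemma fin_same: "finite (same_pairs A B C)" "finite (same_link w)"
  using card_same_pairs(2)[OF fin(2-4) dis] by (auto simp: same_link_def)

lemma cross_same_BC:
  assumes "p \<in> same_link w" shows "card (link E w \<inter> B \<times> C) \<le> \<sigma>\<^sup>2 / 3 * n\<^sup>2 + 4 * n"
proof -
  obtain x x' where xx: "p = {x, x'}" using assms by (auto simp: same_link_def same_pairs_def card_2_iff)
  then have p: "{x, x'} \<in> same_pairs A B C" "{x, x', w} \<in> E" using assms by (auto simp: same_link_def insert_commute)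
  have "link E w \<inter> B \<times> C \<subseteq> light B C \<union> ({x, x'} \<times> V \<union> V \<times> {x, x'})"
    using same_pair_light[OF p] sub by (fastforce simp: link_def light_def)
  then have "card (link E w \<inter> B \<times> C) \<le> card (light B C \<union> ({x, x'} \<times> V \<union> V \<times> {x, x'}))"
    using card_light fin by (intro card_mono) auto
  also have "\<dots> \<le> card (light B C) + card ({x, x'} \<times> V \<union> V \<times> {x, x'})" by (rule card_Un_le)
  also have "card ({x, x'} \<times> V \<union> V \<times> {x, x'}) \<le> 2 * (2 * card V)"
    by (rule card_pairs_meeting[OF fin(1)]) (auto simp: card_insert_if)
  finally have "real (card (link E w \<inter> B \<times> C)) \<le> card (light B C) + 4 * n" by linarith
  then show ?thesis using card_light(1) by linarith
qed

lemma same_link_swap: "tricore.same_link E B A C = same_link" "tricore.same_link E A C B = same_link"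
  unfolding tricore.same_link_def[OF swap] tricore.same_link_def[OF swap'] same_link_def same_pairs_swap
  by auto

lemma cross_same:
  assumes "same_link w \<noteq> {}" shows "cross w \<le> \<sigma>\<^sup>2 * n\<^sup>2 + 12 * n"
proof -
  obtain p where p: "p \<in> same_link w" using assms by auto
  have s1: "p \<in> tricore.same_link E B A C w" using p same_link_swap by simp
  have s2: "p \<in> tricore.same_link E C A B w"
    using p tricore.same_link_swap(1)[OF swap'] same_link_swap by simp
  have "card (link E w \<inter> A \<times> C) \<le> \<sigma>\<^sup>2 / 3 * n\<^sup>2 + 4 * n" using tricore.cross_same_BC[OF swap s1] .
  moreover have "card (link E w \<inter> A \<times> B) \<le> \<sigma>\<^sup>2 / 3 * n\<^sup>2 + 4 * n" using tricore.cross_same_BC[OF tricore.swap[OF swap'] s2] .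
  ultimately show ?thesis using cross_same_BC[OF p] by (simp add: cross_def)
qed

text \<open>If \<open>{c, a, b}\<close> and \<open>{w, y, c}\<close> are edges with \<open>y\<close>
  off \<open>a\<close>, \<open>b\<close>, then \<open>{a, b, w}\<close>, \<open>{a, b, c}\<close>,
  \<open>{w, c, y}\<close> form an \<open>F_5\<close> whose tip \<open>y\<close> lies in the core.
  So only \<open>y = a\<close>, \<open>y = b\<close> or the few \<open>c\<close> not completing
  \<open>a b\<close> remain.\<close>

lemma one_type:
  assumes w: "w \<in> W" and ab: "(a, b) \<in> link E w \<inter> A \<times> B" and d: "card {c \<in> C. {c, a, b} \<notin> E} \<le> \<sigma> * n"
  shows "card (link E w \<inter> A \<times> C) \<le> \<sigma> * n\<^sup>2 + 2 * n" "card (link E w \<inter> B \<times> C) \<le> \<sigma> * n\<^sup>2 + 2 * n"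
proof -
  have gen: "card (link E w \<inter> Y \<times> C) \<le> \<sigma> * n\<^sup>2 + 2 * n" if Y: "Y \<subseteq> A \<union> B" for Y
  proof -
    define D where "D = {c \<in> C. {c, a, b} \<notin> E}"
    have YV: "Y \<subseteq> V" "finite Y" using Y sub fin finite_subset[of Y V] by auto
    have "link E w \<inter> Y \<times> C \<subseteq> {a, b} \<times> C \<union> Y \<times> D"
    proof
      fix p assume "p \<in> link E w \<inter> Y \<times> C"
      then obtain y c where yc: "p = (y, c)" "{w, y, c} \<in> E" "y \<in> Y" "c \<in> C" by (auto simp: link_def)
      show "p \<in> {a, b} \<times> C \<union> Y \<times> D"
      proof (rule ccontr)
        assume "p \<notin> {a, b} \<times> C \<union> Y \<times> D"
        then have y: "y \<noteq> a" "y \<noteq> b" "{c, a, b} \<in> E" using yc by (auto simp: D_def)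
        show False
        proof (rule no_tip)
          show "y \<in> A \<union> B \<union> C" using yc Y by auto
          show "{a, b, w} \<in> E" "{a, b, c} \<in> E" "{w, c, y} \<in> E" using ab y yc by (auto simp: link_def insert_commute)
          show "w \<noteq> c" using w yc by (auto simp: W_def)
        qed (use y in auto)
      qed
    qed
    then have "card (link E w \<inter> Y \<times> C) \<le> card ({a, b} \<times> C \<union> Y \<times> D)"
      using fin YV by (intro card_mono) (auto simp: D_def)
    also have "\<dots> \<le> card ({a, b} \<times> C) + card (Y \<times> D)" by (rule card_Un_le)
    also have "\<dots> = card {a, b} * card C + card Y * card D" by (simp add: card_cartesian_product)
    also have "\<dots> \<le> 2 * card V + card V * card D"
      using fin sub YV by (intro add_mono mult_mono card_mono) (auto simp: card_insert_if D_def)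
    finally have "real (card (link E w \<inter> Y \<times> C)) \<le> real (2 * card V + card V * card D)" by (simp only: of_nat_le_iff)
    then have "real (card (link E w \<inter> Y \<times> C)) \<le> 2 * n + n * card D" by simp
    also have "n * card D \<le> n * (\<sigma> * n)" using d unfolding D_def by (intro mult_left_mono) auto
    finally show ?thesis by (simp add: power2_eq_square mult_ac)
  qed
  show "card (link E w \<inter> A \<times> C) \<le> \<sigma> * n\<^sup>2 + 2 * n" "card (link E w \<inter> B \<times> C) \<le> \<sigma> * n\<^sup>2 + 2 * n"
    by (rule gen; auto)+
qed

text \<open>Each such pair is charged with \<open>\<sigma> * n\<close> missing transversals out of
  at most \<open>\<sigma>\<^sup>2 / 12 * n^3\<close>.\<close>

lemma few_deficient:
  assumes "\<And>b c. (b, c) \<in> link E w \<inter> B \<times> C \<Longrightarrow> \<sigma> * n < card {a \<in> A. {a, b, c} \<notin> E}"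
  shows "card (link E w \<inter> B \<times> C) \<le> \<sigma> * n\<^sup>2"
proof -
  have "card (link E w \<inter> B \<times> C) * (\<sigma> * n) \<le> card (missing E A B C)"
    using assms by (intro card_pairs_missing fin) (auto intro: less_imp_le)
  also have "\<dots> \<le> (\<sigma> * n\<^sup>2 / 12) * (\<sigma> * n)" using card_missing_le by (simp add: power2_eq_square power3_eq_cube mult_ac)
  finally have "card (link E w \<inter> B \<times> C) \<le> \<sigma> * n\<^sup>2 / 12"
    using s0 n_ge(3) by (simp only: mult_le_cancel_right_pos mult_pos_pos)
  also have "\<dots> \<le> \<sigma> * n\<^sup>2" using s0 by simp
  finally show ?thesis .
qed

text \<open>Either some crossing link pair is completed by almost the whole third part, and then
  \<open>one_type\<close> removes the other two types while maximality of the core caps this one; or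
  all crossing pairs are deficient and few. Either way the bound stays below
  \<open>n\<^sup>2 / 9\<close>.\<close>

lemma cross_W:
  assumes w: "w \<in> W" shows "cross w \<le> n\<^sup>2 / 10 + 3 * \<sigma> * n\<^sup>2 + 4 * n"
proof -
  note sBAC = swap and sACB = swap' and sCAB = tricore.swap[OF swap'] and sBCA = tricore.swap'[OF swap]
  have W': "w \<in> tricore.W V A C B" "w \<in> tricore.W V B C A"
    using w swap_W tricore.swap_W(2)[OF swap] by simp_all
  have m: "10 * real (card (link E w \<inter> B \<times> C)) < n\<^sup>2" "10 * real (card (link E w \<inter> A \<times> C)) < n\<^sup>2"
     "10 * real (card (link E w \<inter> A \<times> B)) < n\<^sup>2" using maxi[of w] w by (auto simp: W_def)
  have sq: "\<sigma> * n\<^sup>2 \<ge> 0" using s0 by simp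
  consider (1) a b where "(a, b) \<in> link E w \<inter> A \<times> B" "card {c \<in> C. {c, a, b} \<notin> E} \<le> \<sigma> * n"
    | (2) a c where "(a, c) \<in> link E w \<inter> A \<times> C" "card {b \<in> B. {b, a, c} \<notin> E} \<le> \<sigma> * n"
    | (3) b c where "(b, c) \<in> link E w \<inter> B \<times> C" "card {a \<in> A. {a, b, c} \<notin> E} \<le> \<sigma> * n"
    | (4) "\<And>a b. (a, b) \<in> link E w \<inter> A \<times> B \<Longrightarrow> \<sigma> * n < card {c \<in> C. {c, a, b} \<notin> E}"
      "\<And>a c. (a, c) \<in> link E w \<inter> A \<times> C \<Longrightarrow> \<sigma> * n < card {b \<in> B. {b, a, c} \<notin> E}"
      "\<And>b c. (b, c) \<in> link E w \<inter> B \<times> C \<Longrightarrow> \<sigma> * n < card {a \<in> A. {a, b, c} \<notin> E}"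
    by (meson not_less)
  then show ?thesis
  proof cases
    case 1
    then show ?thesis using one_type[OF w 1] m sq n_ge unfolding cross_def of_nat_add by linarith
  next
    case 2
    have "card (link E w \<inter> A \<times> B) \<le> \<sigma> * n\<^sup>2 + 2 * n" "card (link E w \<inter> C \<times> B) \<le> \<sigma> * n\<^sup>2 + 2 * n"
      using tricore.one_type[OF sACB W'(1) 2] by auto
    then show ?thesis using m sq n_ge unfolding cross_def of_nat_add card_link_swap[of E w B C] by linarith
  next
    case 3
    have "card (link E w \<inter> B \<times> A) \<le> \<sigma> * n\<^sup>2 + 2 * n" "card (link E w \<inter> C \<times> A) \<le> \<sigma> * n\<^sup>2 + 2 * n"
      using tricore.one_type[OF sBCA W'(2) 3] by auto
    then show ?thesis using m sq n_ge unfolding cross_def of_nat_add card_link_swap[of E w B A] card_link_swap[of E w C A] by linarith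
  next
    case 4
    have "card (link E w \<inter> B \<times> C) \<le> \<sigma> * n\<^sup>2" "card (link E w \<inter> A \<times> C) \<le> \<sigma> * n\<^sup>2" "card (link E w \<inter> A \<times> B) \<le> \<sigma> * n\<^sup>2"
      using few_deficient[OF 4(3)] tricore.few_deficient[OF sBAC 4(2)] tricore.few_deficient[OF sCAB 4(1)] by auto
    moreover have "3 * \<sigma> * n\<^sup>2 = 3 * (\<sigma> * n\<^sup>2)" "0 \<le> n\<^sup>2" by simp_all
    ultimately show ?thesis using n_ge(3) unfolding cross_def of_nat_add by linarith
  qed
qed

lemma card_pairs_through: "card {p \<in> same_pairs A B C. x \<in> p} \<le> card V"
proof -
  have "{p \<in> same_pairs A B C. x \<in> p} \<subseteq> (\<lambda>y. {x, y}) ` V"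
  proof
    fix p assume p: "p \<in> {p \<in> same_pairs A B C. x \<in> p}"
    then obtain u v where uv: "p = {u, v}" by (auto simp: same_pairs_def card_2_iff)
    then have "u \<in> V" "v \<in> V" using p sub by (auto simp: same_pairs_def)
    then show "p \<in> (\<lambda>y. {x, y}) ` V" using p uv by (auto simp: insert_commute)
  qed
  then show ?thesis using surj_card_le fin(1) by blast
qed

lemma same_link_disjoint:
  assumes "2 * card V < card (same_link w)"
  obtains u u' where "{u, u'} \<in> same_pairs A B C" "{u, u', w} \<in> E" "{u, u'} \<inter> {x, x'} = {}"
proof -
  have "\<exists>p\<in>same_link w. x \<notin> p \<and> x' \<notin> p"
  proof (rule ccontr)
    assume "\<not> ?thesis"
    then have "same_link w \<subseteq> {p \<in> same_pairs A B C. x \<in> p} \<union> {p \<in> same_pairs A B C. x' \<in> p}"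
      by (auto simp: same_link_def)
    then have "card (same_link w) \<le> card ({p \<in> same_pairs A B C. x \<in> p} \<union> {p \<in> same_pairs A B C. x' \<in> p})"
      using fin_same by (intro card_mono) auto
    also have "\<dots> \<le> card V + card V"
      by (rule order_trans[OF card_Un_le]) (intro add_mono card_pairs_through)
    finally show False using assms by simp
  qed
  then obtain p where p: "p \<in> same_link w" "x \<notin> p" "x' \<notin> p" by auto
  then obtain u u' where "p = {u, u'}" by (auto simp: same_link_def same_pairs_def card_2_iff)
  then show thesis using that[of u u'] p by (auto simp: same_link_def insert_commute)
qed

text \<open>With \<open>t + 1\<close> vertices of \<open>Q\<close> over the pair
  \<open>x x'\<close>, one of them, \<open>q\<close>, plays \<open>f5\<close>, the pair plays
  \<open>f6 f7\<close>, and the others play the \<open>g_i\<close>. A same-part link pair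
  \<open>u u'\<close> of \<open>q\<close> off \<open>x x'\<close> serves as \<open>f3 f4\<close>,
  and a common link pair of \<open>u\<close>, \<open>u'\<close> as \<open>f1 f2\<close>.\<close>

lemma same_pair_codegree:
  assumes p: "p \<in> same_pairs A B C" shows "card {w \<in> Q. insert w p \<in> E} \<le> t"
proof (rule ccontr)
  assume "\<not> ?thesis"
  then have big: "t < card {w \<in> Q. insert w p \<in> E}" by simp
  then have "{w \<in> Q. insert w p \<in> E} \<noteq> {}" by (metis card.empty not_less0)
  then obtain q where q: "q \<in> Q" "insert q p \<in> E" by auto
  define G where "G = {w \<in> Q. insert w p \<in> E} - {q}"
  have fG: "finite G" using fin_W by (simp add: G_def)
  have G: "t \<le> card G" using big q fin_W by (simp add: G_def)
  obtain x x' where xx: "p = {x, x'}" using p by (auto simp: same_pairs_def card_2_iff)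
  obtain u u' where u: "{u, u'} \<in> same_pairs A B C" "{u, u', q} \<in> E" "{u, u'} \<inter> {x, x'} = {}"
    using same_link_disjoint[of q x x'] q by (auto simp: Q_def)
  have "card {x, x', q} \<le> 4" by (simp add: card_insert_if)
  then obtain y z where yz: "{u, y, z} \<in> E" "{u', y, z} \<in> E" "y \<notin> {x, x', q}" "z \<notin> {x, x', q}"
      "y \<in> A \<union> B \<union> C" "z \<in> A \<union> B \<union> C"
    using common[OF u(1), of "{x, x', q}"] by blast
  have GW: "G \<inter> (A \<union> B \<union> C) = {}" using fin_W by (auto simp: G_def)
  have "q \<notin> A \<union> B \<union> C" using q fin_W by auto
  have "contains_copy (V, E) (F_sim t)"
  proof (rule contains_F_simI[OF tg _ _ u(2) _ _ fG G])
    show "{y, z, u} \<in> E" "{y, z, u'} \<in> E" using yz by (auto simp: insert_commute)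
    show qe: "{q, x, x'} \<in> E" using q xx by simp
    show "G \<subseteq> codegree E x x'" using xx by (auto simp: G_def codegree_def insert_commute)
    show "G \<inter> {y, z, u, u', q} = {}"
    proof -
      have "{y, z, u, u'} \<subseteq> A \<union> B \<union> C" using yz(5,6) same_pairs_facts(2,3)[OF u(1)] by simp
      moreover have "q \<notin> G" by (simp add: G_def)
      ultimately show ?thesis using GW by blast
    qed
    show "distinct [y, z, u, u', q, x, x']"
    proof -
      have "u \<noteq> y" "u \<noteq> z" "y \<noteq> z" "u' \<noteq> y" "u' \<noteq> z"
        using three_graph_edge[OF tg yz(1)] three_graph_edge[OF tg yz(2)] by simp_all
      moreover have "q \<noteq> u" "q \<noteq> u'" "q \<noteq> x" "q \<noteq> x'" "u \<noteq> u'" "x \<noteq> x'"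
        using same_pairs_facts[OF u(1)] same_pairs_facts[OF p[unfolded xx]] \<open>q \<notin> A \<union> B \<union> C\<close> by blast+
      moreover have "u \<noteq> x" "u \<noteq> x'" "u' \<noteq> x" "u' \<noteq> x'" using u(3) by blast+
      ultimately show ?thesis using yz(3,4) by simp
    qed
  qed
  then show False using fr by simp
qed

section \<open>Counting the edges\<close>

lemma card_filter_sum: "finite S \<Longrightarrow> card {x \<in> S. P x} = (\<Sum>x\<in>S. if P x then 1 else 0)"
  by (simp add: sum.inter_filter[symmetric])

text \<open>Double counting with \<open>same_pair_codegree\<close>; the minimum is what makes the
  gain from \<open>Q\<close> saturate at \<open>t\<close> vertices.\<close>

lemma sum_same_link_Q: "(\<Sum>w\<in>Q. card (same_link w)) \<le> min (card Q) t * card (same_pairs A B C)"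
proof -
  have "(\<Sum>w\<in>Q. card (same_link w)) = (\<Sum>w\<in>Q. \<Sum>p\<in>same_pairs A B C. if insert w p \<in> E then 1 else 0)"
    unfolding same_link_def card_filter_sum[OF fin_same(1)] ..
  also have "\<dots> = (\<Sum>p\<in>same_pairs A B C. \<Sum>w\<in>Q. if insert w p \<in> E then 1 else 0)" by (rule sum.swap)
  also have "\<dots> = (\<Sum>p\<in>same_pairs A B C. card {w \<in> Q. insert w p \<in> E})"
    unfolding card_filter_sum[OF fin_W(2)] ..
  also have "\<dots> \<le> (\<Sum>p\<in>same_pairs A B C. min (card Q) t)"
    using same_pair_codegree fin_W by (intro sum_mono) (auto intro: card_mono)
  finally show ?thesis by (simp add: mult.commute)
qed

text \<open>Classification by the number of vertices in \<open>W\<close>; for none,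
  \<open>no_bad\<close> leaves only transversal edges.\<close>

lemma edge_cases:
  assumes e: "e \<in> E"
  obtains (transversal) "e \<in> complete_3partite_edges A B C"
  | (same) w p where "w \<in> W" "p \<in> same_link w" "e = insert w p"
  | (cross) w y z where "w \<in> W" "e = {w, y, z}" "(y, z) \<in> B \<times> C \<or> (y, z) \<in> A \<times> C \<or> (y, z) \<in> A \<times> B"
  | (two) w w' v where "w \<in> W" "w' \<in> W" "w \<noteq> w'" "v \<in> A \<union> B \<union> C" "e = {w, w', v}"
  | (three) "e \<subseteq> W"
proof -
  have "card e = 3" using e tg by (auto simp: three_graph_def)
  then obtain x y z where xyz: "e = {x, y, z}" by (auto simp: card_3_iff)
  then have d: "x \<noteq> y" "x \<noteq> z" "y \<noteq> z" "x \<in> V" "y \<in> V" "z \<in> V" using three_graph_edge[OF tg] e by auto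
  have inW: "v \<in> W \<or> v \<in> A \<union> B \<union> C" if "v \<in> V" for v using that by (auto simp: W_def)
  have pr: "{p, q} \<in> same_pairs A B C \<or> (p, q) \<in> B \<times> C \<union> A \<times> C \<union> A \<times> B \<or> (q, p) \<in> B \<times> C \<union> A \<times> C \<union> A \<times> B"
    if "p \<in> A \<union> B \<union> C" "q \<in> A \<union> B \<union> C" "p \<noteq> q" for p q using that by (auto simp: same_pairs_def)
  have one: thesis if "w \<in> W" "p \<in> A \<union> B \<union> C" "q \<in> A \<union> B \<union> C" "p \<noteq> q" "e = {w, p, q}" for w p q
    using pr[OF that(2-4)]
  proof (elim disjE)
    assume "{p, q} \<in> same_pairs A B C"
    then show thesis using same[of w "{p, q}"] that e by (auto simp: same_link_def)
  next
    assume "(p, q) \<in> B \<times> C \<union> A \<times> C \<union> A \<times> B"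
    then show thesis using cross[of w p q] that by blast
  next
    assume "(q, p) \<in> B \<times> C \<union> A \<times> C \<union> A \<times> B"
    then show thesis using cross[of w q p] that by (auto simp: insert_commute)
  qed
  have "e \<in> complete_3partite_edges A B C" if p: "x \<in> A \<union> B \<union> C" "y \<in> A \<union> B \<union> C" "z \<in> A \<union> B \<union> C"
  proof -
    have "{x, y} \<notin> same_pairs A B C" using no_bad[of x y z] e xyz p by auto
    moreover have "{x, z} \<notin> same_pairs A B C" using no_bad[of x z y] e xyz p by (auto simp: insert_commute)
    moreover have "{y, z} \<notin> same_pairs A B C" using no_bad[of y z x] e xyz p by (auto simp: insert_commute)
    ultimately have ns: "\<not> (x \<in> P \<and> y \<in> P)" "\<not> (x \<in> P \<and> z \<in> P)" "\<not> (y \<in> P \<and> z \<in> P)" if "P \<in> {A, B, C}" for P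
      using that d by (auto simp: same_pairs_def)
    have "\<exists>a\<in>A. \<exists>b\<in>B. \<exists>c\<in>C. {x, y, z} = {a, b, c}"
      using p ns[of A] ns[of B] ns[of C] by (auto simp: insert_commute)
    then show ?thesis unfolding xyz complete_3partite_edges_def by blast
  qed
  moreover have thesis if "x \<in> W" "y \<in> W" "z \<in> A \<union> B \<union> C" using two[of x y z] that d xyz by auto
  moreover have thesis if "x \<in> W" "z \<in> W" "y \<in> A \<union> B \<union> C" using two[of x z y] that d xyz by (auto simp: insert_commute)
  moreover have thesis if "y \<in> W" "z \<in> W" "x \<in> A \<union> B \<union> C" using two[of y z x] that d xyz by (auto simp: insert_commute)
  moreover have thesis if "x \<in> W" "y \<in> W" "z \<in> W" using three that xyz by auto
  moreover have thesis if "x \<in> W" "y \<in> A \<union> B \<union> C" "z \<in> A \<union> B \<union> C" using one[of x y z] that d xyz by auto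
  moreover have thesis if "y \<in> W" "x \<in> A \<union> B \<union> C" "z \<in> A \<union> B \<union> C" using one[of y x z] that d xyz by (auto simp: insert_commute)
  moreover have thesis if "z \<in> W" "x \<in> A \<union> B \<union> C" "y \<in> A \<union> B \<union> C" using one[of z x y] that d xyz by (auto simp: insert_commute)
  ultimately show thesis using inW[OF d(4)] inW[OF d(5)] inW[OF d(6)] transversal by blast
qed

text \<open>The crude last term suffices for edges with at least two vertices in \<open>W\<close>:
  since \<open>card W\<close> is of order \<open>\<sigma>\<^sup>2 * n\<close>, it is small against
  \<open>card W * n\<^sup>2\<close>.\<close>

lemma card_E_upper:
  "card E \<le> card A * card B * card C + (\<Sum>w\<in>W. cross w + card (same_link w)) + (card W)\<^sup>2 * card V"
proof -
  define X where "X w = (\<lambda>(y, z). {w, y, z}) ` (link E w \<inter> B \<times> C) \<union> (\<lambda>(y, z). {w, y, z}) ` (link E w \<inter> A \<times> C)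
      \<union> (\<lambda>(y, z). {w, y, z}) ` (link E w \<inter> A \<times> B) \<union> insert w ` same_link w" for w
  define D where "D = (\<lambda>(w, w', v). {w, w', v}) ` (W \<times> W \<times> V)"
  define K where "K = (\<lambda>(x, y, z). {x, y, z}) ` (A \<times> B \<times> C)"
  have fX: "finite (X w)" for w using finite_link[OF tg] fin_same by (auto simp: X_def)
  have cX: "card (X w) \<le> cross w + card (same_link w)" for w
    unfolding X_def cross_def using finite_link[OF tg] fin_same
    by (intro order_trans[OF card_Un_le] add_mono card_image_le) auto
  have "E \<subseteq> K \<union> (\<Union>w\<in>W. X w) \<union> D"
  proof
    fix e assume e: "e \<in> E"
    show "e \<in> K \<union> (\<Union>w\<in>W. X w) \<union> D"
      using e
    proof (cases rule: edge_cases)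
      case transversal
      then show ?thesis by (force simp: K_def complete_3partite_edges_def)
    next
      case (same w p)
      then show ?thesis by (auto simp: X_def)
    next
      case (cross w y z)
      then have "e \<in> X w" using e by (auto simp: X_def link_def)
      then show ?thesis using cross by auto
    next
      case (two w w' v)
      then have "(w, w', v) \<in> W \<times> W \<times> V" using sub by auto
      then have "e \<in> D" unfolding D_def two(5) by (metis (mono_tags, lifting) case_prod_conv image_eqI)
      then show ?thesis by auto
    next
      case three
      have "card e = 3" using e tg by (auto simp: three_graph_def)
      then obtain x y z where "e = {x, y, z}" by (auto simp: card_3_iff)
      moreover from this three have "(x, y, z) \<in> W \<times> W \<times> V" using fin_W by auto
      ultimately have "e \<in> D" unfolding D_def by (metis (mono_tags, lifting) case_prod_conv image_eqI)
      then show ?thesis by auto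
    qed
  qed
  then have "card E \<le> card (K \<union> (\<Union>w\<in>W. X w) \<union> D)"
    using fin fin_W fX by (intro card_mono) (auto simp: K_def D_def)
  also have "\<dots> \<le> card K + card (\<Union>w\<in>W. X w) + card D"
    by (intro order_trans[OF card_Un_le] add_mono order_refl)
  also have "card K \<le> card (A \<times> B \<times> C)" unfolding K_def using fin by (intro card_image_le) auto
  also have "card (A \<times> B \<times> C) = card A * card B * card C" by (simp add: card_cartesian_product)
  also have "card (\<Union>w\<in>W. X w) \<le> (\<Sum>w\<in>W. card (X w))" using fin_W by (intro card_UN_le) auto
  also have "\<dots> \<le> (\<Sum>w\<in>W. cross w + card (same_link w))" using cX by (intro sum_mono) auto
  also have "card D \<le> card (W \<times> W \<times> V)" unfolding D_def using fin fin_W by (intro card_image_le) auto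
  also have "card (W \<times> W \<times> V) = (card W)\<^sup>2 * card V" by (simp add: card_cartesian_product power2_eq_square)
  finally show ?thesis by simp
qed

end

text \<open>In units of \<open>n\<^sup>2\<close>, each of the \<open>k + r\<close> outside vertices
  loses 1/9 of transversals, at most \<open>t\<close> of the \<open>k\<close> gain 1/6, and each of
  the \<open>r\<close> gains 1/10. Against the target \<open>t / 18\<close>, a vertex short of
  \<open>t\<close> costs 1/18, one beyond \<open>t\<close> costs 1/9 and each of the
  \<open>r\<close> costs 1/90; all errors are smaller than these gaps.\<close>

lemma extremal_count_forces:
  fixes n \<sigma> w m :: real and k r t :: nat
  assumes s: "0 < \<sigma>" "\<sigma> \<le> 1 / 2000" "\<sigma> * (1000 * (t + 1)) \<le> 1" and t: "t \<ge> 1"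
    and n: "1000000 * (real t + 1)\<^sup>2 \<le> n" "100 \<le> \<sigma> * n"
    and w: "w = real k + real r" "w \<le> 9 / 4 * \<sigma>\<^sup>2 * n" and m: "m = min (real k) (real t)"
    and L: "n^3 / 27 + t * n\<^sup>2 / 18 - (1 + real t + (real t)\<^sup>2) * n
       \<le> (n - w)^3 / 27 + m * ((1 / 6 + 2 * \<sigma>) * n\<^sup>2) + k * (\<sigma>\<^sup>2 * n\<^sup>2 + 12 * n)
         + r * (n\<^sup>2 / 10 + 3 * \<sigma> * n\<^sup>2 + 6 * n) + w\<^sup>2 * n"
  shows "k = t \<and> r = 0"
proof -
  have "0 < 1000000 * (real t + 1)\<^sup>2" by simp
  then have np: "n > 0" using n(1) by linarith
  have ss: "\<sigma>\<^sup>2 \<le> \<sigma> / 2000" using mult_left_mono[OF s(2), of \<sigma>] s by (simp add: power2_eq_square)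
  have w0: "w \<ge> 0" using w by simp
  have sn: "n \<le> \<sigma> * n\<^sup>2 / 100" using mult_right_mono[OF n(2), of n] np by (simp add: power2_eq_square)
  have "(n - w)^3 = n^3 - 3 * n\<^sup>2 * w + 3 * n * w\<^sup>2 - w^3" by (simp add: power2_eq_square power3_eq_cube algebra_simps)
  then have 1: "(n - w)^3 / 27 \<le> n^3 / 27 - n\<^sup>2 * w / 9 + w\<^sup>2 * n / 9" using w0 by simp
  have "w\<^sup>2 * n = (w * n) * w" by (simp add: power2_eq_square)
  also have "\<dots> \<le> (w * n) * (9 / 4 * \<sigma>\<^sup>2 * n)" using w w0 np by (intro mult_left_mono) auto
  also have "\<dots> = (9 / 4 * (w * n\<^sup>2)) * \<sigma>\<^sup>2" by (simp add: power2_eq_square)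
  also have "\<dots> \<le> (9 / 4 * (w * n\<^sup>2)) * (\<sigma> / 2000)" using ss w0 by (intro mult_left_mono) auto
  finally have 2: "w\<^sup>2 * n \<le> (9 / 8000 * (w * \<sigma>)) * n\<^sup>2" by (simp add: mult_ac)
  have S0: "0 \<le> \<sigma> * n\<^sup>2" using s by simp
  have "\<sigma>\<^sup>2 * n\<^sup>2 \<le> \<sigma> / 2000 * n\<^sup>2" using ss by (intro mult_right_mono) auto
  also have "\<dots> = (\<sigma> * n\<^sup>2) / 2000" by simp
  finally have "\<sigma>\<^sup>2 * n\<^sup>2 + 12 * n \<le> 13 / 100 * (\<sigma> * n\<^sup>2)" using sn S0 by linarith
  then have "\<sigma>\<^sup>2 * n\<^sup>2 + 12 * n \<le> 13 / 100 * \<sigma> * n\<^sup>2" by (simp only: mult.assoc)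
  then have "k * (\<sigma>\<^sup>2 * n\<^sup>2 + 12 * n) \<le> k * (13 / 100 * \<sigma> * n\<^sup>2)" by (rule mult_left_mono) auto
  then have 3: "k * (\<sigma>\<^sup>2 * n\<^sup>2 + 12 * n) \<le> (13 / 100 * (k * \<sigma>)) * n\<^sup>2" by (simp add: mult_ac)
  have "n\<^sup>2 / 10 + 3 * \<sigma> * n\<^sup>2 + 6 * n \<le> (1 / 10 + 307 / 100 * \<sigma>) * n\<^sup>2"
  proof -
    have "(1 / 10 + 307 / 100 * \<sigma>) * n\<^sup>2 = n\<^sup>2 / 10 + 307 / 100 * (\<sigma> * n\<^sup>2)" by (simp add: algebra_simps)
    moreover have "3 * \<sigma> * n\<^sup>2 = 3 * (\<sigma> * n\<^sup>2)" by simp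
    ultimately show ?thesis using sn S0 by linarith
  qed
  then have "r * (n\<^sup>2 / 10 + 3 * \<sigma> * n\<^sup>2 + 6 * n) \<le> r * ((1 / 10 + 307 / 100 * \<sigma>) * n\<^sup>2)" by (rule mult_left_mono) auto
  then have 4: "r * (n\<^sup>2 / 10 + 3 * \<sigma> * n\<^sup>2 + 6 * n) \<le> (r / 10 + 307 / 100 * (r * \<sigma>)) * n\<^sup>2" by (simp add: algebra_simps)
  have "1 + real t + (real t)\<^sup>2 \<le> (real t + 1)\<^sup>2" by (simp add: power2_eq_square algebra_simps)
  then have "1000000 * (1 + real t + (real t)\<^sup>2) \<le> 1000000 * (real t + 1)\<^sup>2" by simp
  also note n(1)
  finally have "1000000 * (1 + real t + (real t)\<^sup>2) \<le> n" .
  then have "1000000 * (1 + real t + (real t)\<^sup>2) * n \<le> n * n" using np by (intro mult_right_mono) auto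
  then have 5: "(1 + real t + (real t)\<^sup>2) * n \<le> (1 / 1000000) * n\<^sup>2" by (simp add: power2_eq_square algebra_simps)
  have "(real t / 18 - 1 / 1000000) * n\<^sup>2 \<le>
     (- (w / 9) + 9 / 7200 * (w * \<sigma>) + (m / 6 + 2 * (m * \<sigma>)) + 13 / 100 * (k * \<sigma>) + (r / 10 + 307 / 100 * (r * \<sigma>))) * n\<^sup>2"
    using L 1 2 3 4 5 by (simp add: algebra_simps)
  then have "real t / 18 - 1 / 1000000 \<le>
     - (w / 9) + 9 / 7200 * (w * \<sigma>) + (m / 6 + 2 * (m * \<sigma>)) + 13 / 100 * (k * \<sigma>) + (r / 10 + 307 / 100 * (r * \<sigma>))"
    using np by (simp only: mult_le_cancel_right_pos zero_less_power)
  moreover have "w * \<sigma> = k * \<sigma> + r * \<sigma>" "0 \<le> k * \<sigma>" "0 \<le> r * \<sigma>" using s w by (simp_all add: algebra_simps)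
  ultimately have main: "real t / 18 - 1 / 1000000 \<le>
     - (real k / 9) - real r / 90 + (m / 6 + 2 * (m * \<sigma>)) + 14 / 100 * (k * \<sigma>) + 308 / 100 * (r * \<sigma>)"
    using w by linarith
  have rs: "real r * \<sigma> \<le> real r / 2000" using mult_left_mono[OF s(2), of "real r"] by simp
  have ts: "real t * \<sigma> + \<sigma> \<le> 1 / 1000" using s(3) by (simp add: algebra_simps)
  show ?thesis
  proof (cases "k \<le> t")
    case True
    then have mk: "m = real k" using m by simp
    have ks: "real k * \<sigma> \<le> real t * \<sigma>" using True s by (intro mult_right_mono) auto
    \<comment> \<open>The slack of just over 3/1000 is below both 1/18 and 1/200, so the same
      inequality yields first \<open>k = t\<close> and then \<open>r = 0\<close>.\<close>
    have *: "real t / 18 - 1 / 1000000 \<le> real k / 18 + 3 / 1000 - real r / 200"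
      using main[unfolded mk] ks ts rs s(1) by linarith
    then have "real t < real k + 1" by simp
    then have "k = t" using True by linarith
    then show ?thesis using * by simp
  next
    case False
    then have mt: "m = real t" and kt: "real k \<ge> real t + 1" using m by simp_all
    have c: "0 \<le> 1 / 9 - 14 / 100 * \<sigma>" using s by simp
    have kt': "(real t + 1) * (1 / 9 - 14 / 100 * \<sigma>) \<le> real k * (1 / 9 - 14 / 100 * \<sigma>)"
      using kt c by (intro mult_right_mono) auto
    have "real t / 18 - 1 / 1000000 \<le>
      - (real t / 9) - 1 / 9 + (14 / 100 * (t * \<sigma>) + 14 / 100 * \<sigma>) - real r / 90 + (real t / 6 + 2 * (t * \<sigma>)) + 308 / 100 * (r * \<sigma>)"
    proof -
      have "(real t + 1) * (1 / 9 - 14 / 100 * \<sigma>) = real t / 9 + 1 / 9 - (14 / 100 * (t * \<sigma>) + 14 / 100 * \<sigma>)"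
        "real k * (1 / 9 - 14 / 100 * \<sigma>) = real k / 9 - 14 / 100 * (k * \<sigma>)" by (simp_all add: field_simps)
      then show ?thesis using main[unfolded mt] kt' by linarith
    qed
    then have False using ts rs s(1) of_nat_0_le_iff[of r, where 'a = real] by linarith
    then show ?thesis ..
  qed
qed

section \<open>Size of the extremal graph\<close>

lemma real_choose_two: "real (a choose 2) = real a * (real a - 1) / 2"
proof -
  have "even (a * (a - 1))" by (cases a) auto
  then have "2 * (a choose 2) = a * (a - 1)" unfolding choose_two by (rule dvd_mult_div_cancel)
  then have "2 * real (a choose 2) = real (a * (a - 1))" by (metis of_nat_mult of_nat_numeral)
  then show ?thesis by (cases a) (auto simp: field_simps)
qed

text \<open>The hyperedges from \<open>is_extremal_graph\<close>, but for arbitrary parts: the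
  structure is established first, and the balance of the parts only afterwards.\<close>

definition extremal_edges :: "'a set \<Rightarrow> 'a set \<Rightarrow> 'a set \<Rightarrow> 'a set \<Rightarrow> 'a set set" where
  "extremal_edges X Y Z Q = complete_3partite_edges X Y Z
          \<union> {e. e \<subseteq> Q \<and> card e = 3}
          \<union> {{q, x, y} | q x y. q \<in> Q \<and> x \<noteq> y \<and> (\<exists>P\<in>{X, Y, Z}. x \<in> P \<and> y \<in> P)}"

lemma extremal_edges_alt:
  "extremal_edges X Y Z Q = (\<lambda>(x, y, z). {x, y, z}) ` (X \<times> Y \<times> Z)
     \<union> {e. e \<subseteq> Q \<and> card e = 3} \<union> (\<lambda>(q, p). insert q p) ` (Q \<times> same_pairs X Y Z)"
proof -
  have 1: "complete_3partite_edges X Y Z = (\<lambda>(x, y, z). {x, y, z}) ` (X \<times> Y \<times> Z)"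
    by (force simp: complete_3partite_edges_def)
  have "{{q, x, y} | q x y. q \<in> Q \<and> x \<noteq> y \<and> (\<exists>P\<in>{X, Y, Z}. x \<in> P \<and> y \<in> P)}
     = (\<lambda>(q, p). insert q p) ` (Q \<times> same_pairs X Y Z)" (is "?L = ?R")
  proof (intro set_eqI iffI)
    fix e assume "e \<in> ?L"
    then obtain q x y where e: "e = {q, x, y}" "q \<in> Q" "x \<noteq> y" "\<exists>P\<in>{X, Y, Z}. x \<in> P \<and> y \<in> P" by blast
    then have "{x, y} \<in> same_pairs X Y Z" by (auto simp: same_pairs_def)
    then show "e \<in> ?R" using e by (auto intro!: image_eqI[of _ _ "(q, {x, y})"])
  next
    fix e assume "e \<in> ?R"
    then obtain q p where e: "e = insert q p" "q \<in> Q" "p \<in> same_pairs X Y Z" by auto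
    then obtain x y where p: "p = {x, y}" "x \<noteq> y" by (auto simp: same_pairs_def card_2_iff)
    then have "\<exists>P\<in>{X, Y, Z}. x \<in> P \<and> y \<in> P" using e by (auto simp: same_pairs_def)
    then show "e \<in> ?L" using e p by blast
  qed
  then show ?thesis unfolding extremal_edges_def 1 by simp
qed

lemma card_extremal_edges:
  assumes f: "finite X" "finite Y" "finite Z" "finite Q"
    and d: "X \<inter> Y = {}" "X \<inter> Z = {}" "Y \<inter> Z = {}" "Q \<inter> (X \<union> Y \<union> Z) = {}"
  shows "card (extremal_edges X Y Z Q) = part_count (card Q) (card X) (card Y) (card Z) + (card Q choose 3)"
    and "finite (extremal_edges X Y Z Q)"
proof -
  define A1 where "A1 = (\<lambda>(x, y, z). {x, y, z}) ` (X \<times> Y \<times> Z)"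
  define A2 where "A2 = {e. e \<subseteq> Q \<and> card e = 3}"
  define A3 where "A3 = (\<lambda>(q, p). insert q p) ` (Q \<times> same_pairs X Y Z)"
  note sp = card_same_pairs[OF f(1-3) d(1-3)]
  have fin: "finite A1" "finite A2" "finite A3" using f sp by (auto simp: A1_def A2_def A3_def)
  have "card A1 = card (X \<times> Y \<times> Z)" unfolding A1_def
  proof (rule card_image, rule inj_onI)
    fix u v assume uv: "u \<in> X \<times> Y \<times> Z" "v \<in> X \<times> Y \<times> Z" "(case u of (x, y, z) \<Rightarrow> {x, y, z}) = (case v of (x, y, z) \<Rightarrow> {x, y, z})"
    obtain x y z x' y' z' where e: "u = (x, y, z)" "v = (x', y', z')" by (cases u, cases v) auto
    have m: "x \<in> X" "y \<in> Y" "z \<in> Z" "x' \<in> X" "y' \<in> Y" "z' \<in> Z" and eq: "{x, y, z} = {x', y', z'}"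
      using uv e by auto
    have "{x, y, z} \<inter> X = {x}" "{x', y', z'} \<inter> X = {x'}" "{x, y, z} \<inter> Y = {y}" "{x', y', z'} \<inter> Y = {y'}"
      "{x, y, z} \<inter> Z = {z}" "{x', y', z'} \<inter> Z = {z'}" using m d by auto
    then show "u = v" using eq unfolding e by (metis singleton_inject)
  qed
  then have 1: "card A1 = card X * card Y * card Z" by (simp add: card_cartesian_product)
  have 2: "card A2 = (card Q choose 3)" unfolding A2_def using f by (simp add: n_subsets)
  have sub: "p \<subseteq> X \<union> Y \<union> Z" if "p \<in> same_pairs X Y Z" for p using that by (auto simp: same_pairs_def)
  have "card A3 = card (Q \<times> same_pairs X Y Z)" unfolding A3_def
  proof (rule card_image, rule inj_onI)
    fix u v assume uv: "u \<in> Q \<times> same_pairs X Y Z" "v \<in> Q \<times> same_pairs X Y Z"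
      "(case u of (q, p) \<Rightarrow> insert q p) = (case v of (q, p) \<Rightarrow> insert q p)"
    obtain q p q' p' where e: "u = (q, p)" "v = (q', p')" by (cases u, cases v) auto
    have m: "q \<in> Q" "p \<in> same_pairs X Y Z" "q' \<in> Q" "p' \<in> same_pairs X Y Z"
      and eq: "insert q p = insert q' p'" using uv e by auto
    have "insert q p \<inter> Q = {q}" "insert q' p' \<inter> Q = {q'}" "insert q p \<inter> (X \<union> Y \<union> Z) = p"
      "insert q' p' \<inter> (X \<union> Y \<union> Z) = p'"
      using m d(4) sub[OF m(2)] sub[OF m(4)] by auto
    then show "u = v" using eq unfolding e by (metis singleton_inject)
  qed
  then have 3: "card A3 = card Q * ((card X choose 2) + (card Y choose 2) + (card Z choose 2))"
    using sp by (simp add: card_cartesian_product)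
  have a1: "e \<inter> Q = {} \<and> e \<noteq> {}" if "e \<in> A1" for e using that d(4) by (auto simp: A1_def)
  have a2: "e \<subseteq> Q \<and> e \<noteq> {}" if "e \<in> A2" for e using that by (auto simp: A2_def)
  have a3: "e \<inter> Q \<noteq> {} \<and> \<not> e \<subseteq> Q" if e: "e \<in> A3" for e
  proof -
    obtain q p where qp: "e = insert q p" "q \<in> Q" "p \<in> same_pairs X Y Z" using e by (auto simp: A3_def)
    then obtain x where "x \<in> p" by (auto simp: same_pairs_def card_2_iff)
    then have "x \<in> X \<union> Y \<union> Z" "x \<in> e" using sub[OF qp(3)] qp(1) by auto
    then have "x \<notin> Q" using d(4) by auto
    then show ?thesis using qp \<open>x \<in> e\<close> by auto
  qed
  have "A1 \<inter> A2 = {}" using a1 a2 by blast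
  moreover have "(A1 \<union> A2) \<inter> A3 = {}" using a1 a2 a3 by blast
  ultimately have "card (A1 \<union> A2 \<union> A3) = card A1 + card A2 + card A3"
    using fin by (simp add: card_Un_disjoint)
  then show "card (extremal_edges X Y Z Q) = part_count (card Q) (card X) (card Y) (card Z) + (card Q choose 3)"
    unfolding extremal_edges_alt A1_def[symmetric] A2_def[symmetric] A3_def[symmetric]
    using 1 2 3 by (simp add: part_count_def)
  show "finite (extremal_edges X Y Z Q)"
    unfolding extremal_edges_alt A1_def[symmetric] A2_def[symmetric] A3_def[symmetric] using fin by simp
qed

section \<open>Exactly \<open>t\<close> vertices lie outside the core\<close>

context tricore
begin

lemma card_same_pairs_upper: "card (same_pairs A B C) \<le> (1 / 6 + 2 * \<sigma>) * n\<^sup>2"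
proof -
  have ch: "real (a choose 2) \<le> ((1 / 3 + \<sigma>) * n)\<^sup>2 / 2" if "real a \<le> (1 / 3 + \<sigma>) * n" for a
  proof -
    have "real a * (real a - 1) \<le> (real a)\<^sup>2" by (simp add: power2_eq_square algebra_simps)
    also have "\<dots> \<le> ((1 / 3 + \<sigma>) * n)\<^sup>2" using that by (intro power_mono) auto
    finally show ?thesis unfolding real_choose_two by simp
  qed
  have "real (card (same_pairs A B C)) \<le> 3 * (((1 / 3 + \<sigma>) * n)\<^sup>2 / 2)"
    using ch[OF card_A_bounds(2)] ch[OF tricore.card_A_bounds(2)[OF swap]]
      ch[OF tricore.card_A_bounds(2)[OF tricore.swap[OF swap']]]
    unfolding card_same_pairs(1)[OF fin(2-4) dis] by simp
  also have "\<dots> = (1 / 6 + \<sigma> + 3 / 2 * \<sigma>\<^sup>2) * n\<^sup>2" by (simp add: power2_eq_square field_simps)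
  also have "\<dots> \<le> (1 / 6 + 2 * \<sigma>) * n\<^sup>2" using s_le s0 by (intro mult_right_mono) auto
  finally show ?thesis .
qed

text \<open>The product of the part sizes is at most \<open>(n - card W) * n\<^sup>2 / 27\<close>,
  so each outside vertex uses up \<open>n\<^sup>2 / 27\<close> of the deficit
  \<open>\<sigma>\<^sup>2 / 12 * n^3\<close>; hence the factor 27/12 = 9/4.\<close>

lemma card_W: "real (card A) + card B + card C = n - card W" "card W \<le> 9 / 4 * \<sigma>\<^sup>2 * n"
proof -
  have "card W = card V - card (A \<union> B \<union> C)" "card (A \<union> B \<union> C) \<le> card V"
    unfolding W_def using sub fin by (auto intro!: card_Diff_subset card_mono)
  then have "card V = card W + (card A + card B + card C)" unfolding card_parts(1) by simp
  then show s: "real (card A) + card B + card C = n - card W" by simp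
  have w: "card W \<le> n" using fin fin_W by (simp add: card_mono)
  have "27 * ((1 / 27 - \<sigma>\<^sup>2 / 12) * n^3) \<le> 27 * (real (card A) * card B * card C)" using prod_parts by simp
  also have "\<dots> \<le> (n - card W)^3" using amgm3[of "card A" "card B" "card C"] s by simp
  also have "\<dots> \<le> (n - card W) * n\<^sup>2"
    unfolding power3_eq_cube power2_eq_square using w by (simp add: mult.assoc) (intro mult_left_mono mult_mono, auto)
  finally have "n\<^sup>2 * card W \<le> n\<^sup>2 * (9 / 4 * \<sigma>\<^sup>2 * n)" by (simp add: power2_eq_square power3_eq_cube algebra_simps)
  then show "card W \<le> 9 / 4 * \<sigma>\<^sup>2 * n" using n_ge(3) by (simp only: mult_le_cancel_left_pos zero_less_power)
qed

text \<open>Vertices of \<open>Q\<close> have negligible crossing links and share a bounded total of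
  same-part pairs; those of \<open>W - Q\<close> have few same-part pairs and crossing links bounded
  by \<open>cross_W\<close>. The rest is \<open>extremal_count_forces\<close>.\<close>

lemma W_eq_Q:
  assumes low: "n^3 / 27 + t * n\<^sup>2 / 18 - (1 + real t + (real t)\<^sup>2) * n \<le> card E"
  shows "W = Q" "card W = t"
proof -
  define k r where "k = card Q" and "r = card (W - Q)"
  have wkr: "card W = k + r" unfolding k_def r_def
    using fin_W card_Un_disjoint[of Q "W - Q"] by (simp add: Un_absorb1 finite_subset)
  have ne: "same_link w \<noteq> {}" if "w \<in> Q" for w using that by (auto simp: Q_def)
  have "real (card E) \<le> real (card A * card B * card C + (\<Sum>w\<in>W. cross w + card (same_link w)) + (card W)\<^sup>2 * card V)"
    using card_E_upper by (simp only: of_nat_le_iff)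
  also have "\<dots> = real (card A) * card B * card C + (\<Sum>w\<in>W. real (cross w + card (same_link w))) + (real (card W))\<^sup>2 * n"
    by simp
  also have "(\<Sum>w\<in>W. real (cross w + card (same_link w))) =
     (\<Sum>w\<in>Q. real (cross w + card (same_link w))) + (\<Sum>w\<in>W - Q. real (cross w + card (same_link w)))"
    using fin_W by (simp add: sum.subset_diff add.commute)
  also have "(\<Sum>w\<in>Q. real (cross w + card (same_link w))) = (\<Sum>w\<in>Q. real (cross w)) + real (\<Sum>w\<in>Q. card (same_link w))"
    by (simp add: sum.distrib)
  also have "(\<Sum>w\<in>Q. real (cross w)) \<le> (\<Sum>w\<in>Q. \<sigma>\<^sup>2 * n\<^sup>2 + 12 * n)"
    using cross_same[OF ne] by (intro sum_mono)
  also have "(\<Sum>w\<in>Q. \<sigma>\<^sup>2 * n\<^sup>2 + 12 * n) = k * (\<sigma>\<^sup>2 * n\<^sup>2 + 12 * n)" by (simp add: k_def)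
  also have "real (\<Sum>w\<in>Q. card (same_link w)) \<le> min (real k) (real t) * ((1 / 6 + 2 * \<sigma>) * n\<^sup>2)"
  proof -
    have "real (\<Sum>w\<in>Q. card (same_link w)) \<le> real (min (card Q) t * card (same_pairs A B C))"
      using sum_same_link_Q by (simp only: of_nat_le_iff)
    also have "\<dots> = min (real k) (real t) * card (same_pairs A B C)" by (simp add: k_def of_nat_min)
    also have "\<dots> \<le> min (real k) (real t) * ((1 / 6 + 2 * \<sigma>) * n\<^sup>2)"
      using card_same_pairs_upper by (intro mult_left_mono) auto
    finally show ?thesis .
  qed
  also have "(\<Sum>w\<in>W - Q. real (cross w + card (same_link w))) \<le> (\<Sum>w\<in>W - Q. n\<^sup>2 / 10 + 3 * \<sigma> * n\<^sup>2 + 6 * n)"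
  proof (intro sum_mono)
    fix w assume w: "w \<in> W - Q"
    then have "card (same_link w) \<le> 2 * card V" by (auto simp: Q_def not_less)
    then have "real (card (same_link w)) \<le> 2 * n" by linarith
    then show "real (cross w + card (same_link w)) \<le> n\<^sup>2 / 10 + 3 * \<sigma> * n\<^sup>2 + 6 * n" using cross_W[of w] w by simp
  qed
  also have "(\<Sum>w\<in>W - Q. n\<^sup>2 / 10 + 3 * \<sigma> * n\<^sup>2 + 6 * n) = r * (n\<^sup>2 / 10 + 3 * \<sigma> * n\<^sup>2 + 6 * n)" by (simp add: r_def)
  also have "real (card A) * card B * card C \<le> (n - card W)^3 / 27"
    using amgm3[of "card A" "card B" "card C"] card_W(1) by simp
  finally have up: "real (card E) \<le> (n - card W)^3 / 27 + (k * (\<sigma>\<^sup>2 * n\<^sup>2 + 12 * n) + min (real k) (real t) * ((1 / 6 + 2 * \<sigma>) * n\<^sup>2)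
      + r * (n\<^sup>2 / 10 + 3 * \<sigma> * n\<^sup>2 + 6 * n)) + (real (card W))\<^sup>2 * n" by simp
  have "k = t \<and> r = 0"
  proof (rule extremal_count_forces[OF s0 s_le(1) s1 t1 n6 sn _ card_W(2) refl])
    show "real (card W) = real k + real r" using wkr by simp
    show "n ^ 3 / 27 + real t * n\<^sup>2 / 18 - (1 + real t + (real t)\<^sup>2) * n
      \<le> (n - real (card W)) ^ 3 / 27 + min (real k) (real t) * ((1 / 6 + 2 * \<sigma>) * n\<^sup>2) +
         real k * (\<sigma>\<^sup>2 * n\<^sup>2 + 12 * n) + real r * (n\<^sup>2 / 10 + 3 * \<sigma> * n\<^sup>2 + 6 * n) + (real (card W))\<^sup>2 * n"
      using low up by linarith
  qed
  then show "W = Q" "card W = t" using wkr fin_W by (auto simp: r_def)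
qed

end

lemma card_missing_swap:
  assumes "finite A" "finite B" "finite C"
  shows "card (missing E B A C) = card (missing E A B C)" "card (missing E A C B) = card (missing E A B C)"
  using card_missing[OF assms, of E] card_missing[of B A C E] card_missing[of A C B E] assms
  by (simp_all add: transversals_swap[of E B A C] transversals_swap'[of E A C B] mult_ac)

section \<open>From the edge count to the exact structure\<close>

context tricore
begin

lemma card_same_pairs_lower: "n\<^sup>2 / 7 \<le> card (same_pairs A B C)"
proof -
  have ch: "105 / 2000 * n\<^sup>2 \<le> real (a choose 2)" if "33 / 100 * n \<le> real a" for a
  proof -
    have "(33 / 100 * n) * (32 / 100 * n) \<le> real a * (real a - 1)"
      using that n_ge by (intro mult_mono) auto
    moreover have "(33 / 100 * n) * (32 / 100 * n) = 1056 / 10000 * n\<^sup>2" by (simp add: power2_eq_square)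
    moreover have "0 \<le> n\<^sup>2" by simp
    ultimately show ?thesis unfolding real_choose_two by linarith
  qed
  have "3 * (105 / 2000 * n\<^sup>2) \<le> real (card (same_pairs A B C))"
    using ch[OF card_A_bounds(1)] ch[OF tricore.card_A_bounds(1)[OF swap]]
      ch[OF tricore.card_A_bounds(1)[OF tricore.swap[OF swap']]]
    unfolding card_same_pairs(1)[OF fin(2-4) dis] by simp
  moreover have "0 \<le> n\<^sup>2" by simp
  ultimately show ?thesis by linarith
qed

text \<open>The target count requires nearly \<open>t\<close> times all same-part pairs. None of the
  \<open>t\<close> vertices can supply more than all of them, so each must supply nearly all;
  crossing edges and edges with two vertices in \<open>W\<close> make up at most
  \<open>n\<^sup>2 / 1000\<close>.\<close>

lemma card_same_link_lower:
  assumes WQ: "W = Q" and cW: "card W = t"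
    and low: "part_count t (card A) (card B) (card C) + (t choose 3) \<le> card E" and q: "q \<in> W"
  shows "card (same_pairs A B C) \<le> card (same_link q) + n\<^sup>2 / 1000"
proof -
  define s where "s = card (same_pairs A B C)"
  have le: "card (same_link w) \<le> s" for w
    unfolding s_def using fin_same by (intro card_mono) (auto simp: same_link_def)
  have "card A * card B * card C + t * s \<le> card E"
    using low unfolding s_def card_same_pairs(1)[OF fin(2-4) dis] part_count_def by simp
  also have "card E \<le> card A * card B * card C + (\<Sum>w\<in>W. cross w + card (same_link w)) + t\<^sup>2 * card V"
    using card_E_upper cW by simp
  finally have "t * s \<le> (\<Sum>w\<in>W. cross w) + (\<Sum>w\<in>W. card (same_link w)) + t\<^sup>2 * card V" by (simp add: sum.distrib)
  also have "(\<Sum>w\<in>W. card (same_link w)) = card (same_link q) + (\<Sum>w\<in>W - {q}. card (same_link w))"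
    using fin_W q by (simp add: sum.remove)
  also have "(\<Sum>w\<in>W - {q}. card (same_link w)) \<le> (\<Sum>w\<in>W - {q}. s)" using le by (intro sum_mono)
  also have "(\<Sum>w\<in>W - {q}. s) = (t - 1) * s" using fin_W q cW by simp
  finally have "t * s \<le> (\<Sum>w\<in>W. cross w) + (card (same_link q) + (t - 1) * s) + t\<^sup>2 * card V" by simp
  moreover have "t * s = (t - 1) * s + s" using t1 by (cases t) auto
  ultimately have "s \<le> (\<Sum>w\<in>W. cross w) + card (same_link q) + t\<^sup>2 * card V" by linarith
  then have "real s \<le> real ((\<Sum>w\<in>W. cross w) + card (same_link q) + t\<^sup>2 * card V)" by (simp only: of_nat_le_iff)
  then have 1: "real s \<le> (\<Sum>w\<in>W. real (cross w)) + card (same_link q) + (real t)\<^sup>2 * n" by simp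
  have ne: "same_link w \<noteq> {}" if "w \<in> W" for w using that unfolding WQ by (auto simp: Q_def)
  have "(\<Sum>w\<in>W. real (cross w)) \<le> (\<Sum>w\<in>W. \<sigma>\<^sup>2 * n\<^sup>2 + 12 * n)" using cross_same[OF ne] by (intro sum_mono)
  also have "\<dots> = t * (\<sigma>\<^sup>2 * n\<^sup>2 + 12 * n)" using cW by simp
  also have "\<dots> = (\<sigma> * t) * (\<sigma> * n\<^sup>2) + 12 * (t * n)" by (simp add: power2_eq_square algebra_simps)
  finally have 2: "(\<Sum>w\<in>W. real (cross w)) \<le> (\<sigma> * t) * (\<sigma> * n\<^sup>2) + 12 * (t * n)" .
  have "(\<sigma> * t) * (\<sigma> * n\<^sup>2) \<le> 1 / 1000 * (1 / 2000 * n\<^sup>2)" using s_le s0 by (intro mult_mono) auto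
  moreover have tn: "1000000 * real t \<le> n" using n_ge(2) by simp
  then have "1000000 * real t * n \<le> n * n" by (intro mult_right_mono) auto
  then have "t * n \<le> n\<^sup>2 / 1000000" by (simp add: power2_eq_square)
  moreover have "(real t)\<^sup>2 * n \<le> n\<^sup>2 / 1000000"
  proof -
    have "(real t)\<^sup>2 \<le> (real t + 1)\<^sup>2" by (intro power_mono) auto
    then have "1000000 * (real t)\<^sup>2 \<le> 1000000 * (real t + 1)\<^sup>2" by simp
    then have "1000000 * (real t)\<^sup>2 \<le> n" using n6 by (rule order_trans)
    then have "1000000 * (real t)\<^sup>2 * n \<le> n * n" by (intro mult_right_mono) auto
    then show ?thesis by (simp add: power2_eq_square)
  qed
  moreover have "0 \<le> n\<^sup>2" by simp
  ultimately show ?thesis using 1 2 unfolding s_def[symmetric] by linarith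
qed

text \<open>\<open>q\<close> and \<open>q'\<close> share more than \<open>n\<close> same-part pairs,
  hence some \<open>u u'\<close> off \<open>x\<close>; then \<open>{u, u', q}\<close>,
  \<open>{u, u', q'}\<close>, \<open>{q, q', x}\<close> form an \<open>F_5\<close> with tip
  \<open>x\<close> in the core.\<close>

lemma no_two_in_W:
  assumes WQ: "W = Q" and cW: "card W = t"
    and low: "part_count t (card A) (card B) (card C) + (t choose 3) \<le> card E"
    and q: "q \<in> W" "q' \<in> W" "q \<noteq> q'" and x: "x \<in> A \<union> B \<union> C"
  shows "{q, q', x} \<notin> E"
proof
  assume e: "{q, q', x} \<in> E"
  have "card (same_link q \<union> same_link q') \<le> card (same_pairs A B C)"
    using fin_same by (intro card_mono) (auto simp: same_link_def)
  moreover have "card (same_link q) + card (same_link q') = card (same_link q \<union> same_link q') + card (same_link q \<inter> same_link q')"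
    by (rule card_Un_Int[OF fin_same(2) fin_same(2)])
  ultimately have "real (card (same_link q)) + card (same_link q') \<le> real (card (same_pairs A B C)) + card (same_link q \<inter> same_link q')"
    by linarith
  then have big: "n < card (same_link q \<inter> same_link q')"
    using card_same_link_lower[OF WQ cW low q(1)] card_same_link_lower[OF WQ cW low q(2)]
      card_same_pairs_lower n_mult(1) n_ge(3) by linarith
  have "\<not> same_link q \<inter> same_link q' \<subseteq> {p \<in> same_pairs A B C. x \<in> p}"
  proof
    assume "same_link q \<inter> same_link q' \<subseteq> {p \<in> same_pairs A B C. x \<in> p}"
    then have "card (same_link q \<inter> same_link q') \<le> card {p \<in> same_pairs A B C. x \<in> p}"
      using fin_same by (intro card_mono) auto
    then show False using card_pairs_through[of x] big by linarith
  qed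
  then obtain p where p: "p \<in> same_link q" "p \<in> same_link q'" "x \<notin> p" by (auto simp: same_link_def)
  obtain u u' where u: "p = {u, u'}" using p by (auto simp: same_link_def same_pairs_def card_2_iff)
  have "{u, u', q} \<in> E" "{u, u', q'} \<in> E" using p u by (auto simp: same_link_def insert_commute)
  then show False using no_tip[OF x _ _ q(3) e] p u by auto
qed

lemma cross_pair_light:
  assumes "2 * card V < card (same_link q)" and e: "{q, y, z} \<in> E"
  shows "card (codegree E y z) < t + 5"
proof -
  obtain u u' where u: "{u, u'} \<in> same_pairs A B C" "{u, u', q} \<in> E" "{u, u'} \<inter> {y, z} = {}"
    using same_link_disjoint[OF assms(1)] .
  then show ?thesis using same_pair_light[OF u(1,2) e] by auto
qed

text \<open>A crossing pair in a link of \<open>W\<close> is light: it gains at most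
  \<open>t\<close> edges but misses \<open>n / 4\<close> transversals. The three types of crossing
  pairs may share these transversals, so \<open>n / 4\<close> is compared with \<open>3 * t\<close>,
  and no such pair exists. Then \<open>E\<close> lies inside the extremal edge set and is no
  smaller.\<close>

lemma extremal_structure:
  assumes WQ: "W = Q" and cW: "card W = t"
    and low: "part_count t (card A) (card B) (card C) + (t choose 3) \<le> card E"
  shows "E = extremal_edges A B C W"
proof -
  define xp where "xp Y Z = {(y, z) \<in> Y \<times> Z. \<exists>q\<in>W. {q, y, z} \<in> E}" for Y Z
  have big: "2 * card V < card (same_link q)" if "q \<in> W" for q using that unfolding WQ by (auto simp: Q_def)
  have fxp: "finite (xp Y Z)" if "finite Y" "finite Z" for Y Z
    using that finite_subset[of "xp Y Z" "Y \<times> Z"] by (auto simp: xp_def)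
  have light: "card (codegree E y z) < t + 5" if "(y, z) \<in> xp Y Z" for y z Y Z
    using that cross_pair_light big by (auto simp: xp_def)
  have "xp B C \<subseteq> light B C" using light[of _ _ B C] by (auto simp: xp_def light_def)
  then have m1: "card (xp B C) * (n / 4) \<le> card (missing E A B C)" by (rule card_light_missing)
  have "xp A C \<subseteq> tricore.light t E A C" using light[of _ _ A C] by (auto simp: xp_def tricore.light_def[OF swap])
  then have m2: "card (xp A C) * (n / 4) \<le> card (missing E A B C)"
    using tricore.card_light_missing[OF swap] card_missing_swap(1)[OF fin(2-4)] by metis
  note sCAB = tricore.swap[OF swap']
  have "xp A B \<subseteq> tricore.light t E A B" using light[of _ _ A B] by (auto simp: xp_def tricore.light_def[OF sCAB])
  then have "card (xp A B) * (n / 4) \<le> card (missing E C A B)" by (rule tricore.card_light_missing[OF sCAB])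
  then have m3: "card (xp A B) * (n / 4) \<le> card (missing E A B C)"
    using card_missing_swap(2)[OF fin(2-4), of E] card_missing_swap(1)[OF fin(2,4,3), of E] by simp
  define T where "T = (\<lambda>(x, y, z). {x, y, z}) ` transversals E A B C"
  define A2 where "A2 = {e. e \<subseteq> W \<and> card e = 3}"
  define A3 where "A3 = (\<lambda>(q, p). insert q p) ` (W \<times> same_pairs A B C)"
  define X where "X = (\<lambda>(q, y, z). {q, y, z}) ` (W \<times> (xp B C \<union> xp A C \<union> xp A B))"
  have cov: "e \<in> T \<union> A2 \<union> A3 \<union> X" if e: "e \<in> E" for e
    using e
  proof (cases rule: edge_cases)
    case transversal
    then obtain x y z where "e = {x, y, z}" "x \<in> A" "y \<in> B" "z \<in> C" by (auto simp: complete_3partite_edges_def)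
    then have "(x, y, z) \<in> transversals E A B C" "e = (\<lambda>(x, y, z). {x, y, z}) (x, y, z)"
      using e by (auto simp: transversals_def link_def)
    then show ?thesis unfolding T_def by blast
  next
    case (same w p)
    then show ?thesis by (auto simp: A3_def same_link_def)
  next
    case (cross w y z)
    then have "(y, z) \<in> xp B C \<union> xp A C \<union> xp A B" using e by (auto simp: xp_def)
    then have "(w, y, z) \<in> W \<times> (xp B C \<union> xp A C \<union> xp A B)" "e = (\<lambda>(q, y, z). {q, y, z}) (w, y, z)" using cross by auto
    then show ?thesis unfolding X_def by blast
  next
    case (two w w' v)
    then show ?thesis using no_two_in_W[OF WQ cW low two(1-4)] e by simp
  next
    case three
    then show ?thesis using e tg by (auto simp: A2_def three_graph_def)
  qed
  have fT: "finite T" "card T \<le> card (transversals E A B C)"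
    using finite_transversals[OF tg sub(1)] by (auto simp: T_def card_image_le)
  have f2: "finite A2" "card A2 = (t choose 3)" using fin_W cW by (simp_all add: A2_def n_subsets)
  have f3: "finite A3" "card A3 \<le> t * card (same_pairs A B C)"
    using fin_W fin_same card_image_le[of "W \<times> same_pairs A B C" "\<lambda>(q, p). insert q p"] cW
    by (auto simp: A3_def card_cartesian_product)
  have fxs: "finite (xp B C)" "finite (xp A C)" "finite (xp A B)" using fxp fin by auto
  have "card X \<le> card (W \<times> (xp B C \<union> xp A C \<union> xp A B))"
    unfolding X_def using fin_W fxs by (intro card_image_le) auto
  also have "\<dots> = t * card (xp B C \<union> xp A C \<union> xp A B)" using cW by (simp add: card_cartesian_product)
  also have "\<dots> \<le> t * (card (xp B C) + card (xp A C) + card (xp A B))"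
    by (intro mult_le_mono2 order_trans[OF card_Un_le] add_mono card_Un_le order_refl)
  finally have fX: "card X \<le> t * (card (xp B C) + card (xp A C) + card (xp A B))" .
  have "finite X" using fin_W fxs by (auto simp: X_def)
  then have "card E \<le> card (T \<union> A2 \<union> A3 \<union> X)" using cov fT f2 f3 by (intro card_mono) auto
  also have "\<dots> \<le> card T + card A2 + card A3 + card X"
    by (intro order_trans[OF card_Un_le] add_mono order_refl)
  finally have "card A * card B * card C \<le> card (transversals E A B C) + t * (card (xp B C) + card (xp A C) + card (xp A B))"
    using low fT(2) f2(2) f3(2) fX unfolding part_count_def card_same_pairs(1)[OF fin(2-4) dis] by linarith
  then have "card (missing E A B C) \<le> t * (card (xp B C) + card (xp A C) + card (xp A B))"
    using card_missing[OF fin(2-4), of E] by linarith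
  then have "real (card (missing E A B C)) \<le> real (t * (card (xp B C) + card (xp A C) + card (xp A B)))"
    by (simp only: of_nat_le_iff)
  moreover define P where "P = real (card (xp B C)) + card (xp A C) + card (xp A B)"
  ultimately have "real (card (missing E A B C)) \<le> t * P" by simp
  moreover have "P * (n / 4) \<le> 3 * real (card (missing E A B C))" using m1 m2 m3 by (simp add: P_def algebra_simps)
  ultimately have "P * (n / 4) \<le> P * (3 * t)" by (simp add: mult_ac)
  moreover have "3 * real t < n / 4" using n_ge(2) by simp
  then have lt: "real (3 * t) < n / 4" by simp
  ultimately have "P \<le> 0" using mult_strict_left_mono[OF lt, of P] by linarith
  then have "card (xp B C) = 0" "card (xp A C) = 0" "card (xp A B) = 0" unfolding P_def by linarith+
  then have "X = {}" using fxs by (simp add: X_def)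
  moreover have "T \<subseteq> (\<lambda>(x, y, z). {x, y, z}) ` (A \<times> B \<times> C)" unfolding T_def transversals_def by (intro image_mono) auto
  ultimately have sub: "E \<subseteq> extremal_edges A B C W" unfolding extremal_edges_alt using cov A2_def A3_def by blast
  have dW: "W \<inter> (A \<union> B \<union> C) = {}" using fin_W by auto
  show ?thesis
    using card_extremal_edges[OF fin(2-4) fin_W(1) dis dW] low cW
    by (intro card_seteq sub) auto
qed

end

section \<open>Optimal part sizes\<close>

lemma real_part_count:
  "real (part_count t a b c) = real a * b * c + t * ((real a)\<^sup>2 + (real b)\<^sup>2 + (real c)\<^sup>2 - (a + b + c)) / 2"
  by (simp add: part_count_def real_choose_two power2_eq_square field_simps)

lemma part_count_perm: "part_count t b a c = part_count t a b c" "part_count t a c b = part_count t a b c"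
  by (simp_all add: part_count_def mult_ac add_ac)

text \<open>Shifting one vertex to the smaller part gains \<open>(d + 1) * c\<close> transversals
  and loses \<open>t * (d + 1)\<close> same-part edges, so it pays when the third part exceeds
  \<open>t\<close>.\<close>

lemma part_count_move:
  assumes "c > t"
  shows "part_count t (b + d + 2) b c < part_count t (b + d + 1) (b + 1) c"
proof -
  have "real (part_count t (b + d + 1) (b + 1) c) - part_count t (b + d + 2) b c = (d + 1) * (real c - t)"
    unfolding real_part_count by (simp add: power2_eq_square field_simps)
  also have "\<dots> > 0" using assms by simp
  finally show ?thesis by simp
qed

definition balanced :: "nat \<Rightarrow> nat \<Rightarrow> nat \<Rightarrow> bool" where
  "balanced a b c \<longleftrightarrow> \<bar>int a - int b\<bar> \<le> 1 \<and> \<bar>int a - int c\<bar> \<le> 1 \<and> \<bar>int b - int c\<bar> \<le> 1"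

lemma balanced_cases:
  assumes "balanced a b c"
  obtains m where "a = m \<or> a = m + 1" "b = m \<or> b = m + 1" "c = m \<or> c = m + 1" "m = (a + b + c) div 3"
proof -
  define m where "m = min a (min b c)"
  have m: "a = m \<or> a = m + 1" "b = m \<or> b = m + 1" "c = m \<or> c = m + 1"
    using assms unfolding balanced_def m_def by linarith+
  have "m \<le> a" "m \<le> b" "m \<le> c" "a \<le> m + 1" "b \<le> m + 1" "c \<le> m + 1" "a = m \<or> b = m \<or> c = m"
    using m by (auto simp: m_def)
  then have "3 * m \<le> a + b + c" "a + b + c \<le> 3 * m + 2" by auto
  then have "(a + b + c) div 3 = m" by linarith
  then show thesis using that m by simp
qed

text \<open>Up to order a balanced triple is determined by its sum; \<open>F m k\<close> is the
  normal form with \<open>k\<close> parts of size \<open>m + 1\<close>.\<close>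

lemma balanced_part_count_eq:
  assumes "balanced a b c" "balanced a' b' c'" "a + b + c = a' + b' + c'"
  shows "part_count t a b c = part_count t a' b' c'"
proof -
  define F where "F m k = part_count t (if 1 \<le> k then m + 1 else m) (if 2 \<le> k then m + 1 else m)
    (if 3 \<le> k then m + 1 else m)" for m k :: nat
  have "part_count t a b c = F ((a + b + c) div 3) (a + b + c - 3 * ((a + b + c) div 3))"
    if bal: "balanced a b c" for a b c
  proof -
    obtain m where m: "a = m \<or> a = m + 1" "b = m \<or> b = m + 1" "c = m \<or> c = m + 1" "m = (a + b + c) div 3"
      using balanced_cases[OF bal] by metis
    have "part_count t a b c = F m (a + b + c - 3 * m)"
      using m(1-3) by (elim disjE) (simp_all add: F_def part_count_perm)
    then show ?thesis using m(4) by simp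
  qed
  then show ?thesis using assms by simp
qed

text \<open>The identity behind \<open>amgm3\<close>, now used from the other side: all squared
  differences of part sizes are at most 1.\<close>

lemma balanced_part_count_lower:
  assumes "balanced a b c" "a + b + c = N"
  shows "(real N)^3 / 27 - N + t * ((real N)\<^sup>2 / 6 - N / 2) \<le> part_count t a b c"
proof -
  have N: "real N = real a + b + c" using assms(2) by simp
  have "\<bar>real a - b\<bar> \<le> 1" "\<bar>real a - c\<bar> \<le> 1" "\<bar>real b - c\<bar> \<le> 1"
    using assms(1) unfolding balanced_def by linarith+
  then have d: "(real a - b)\<^sup>2 \<le> 1" "(real a - c)\<^sup>2 \<le> 1" "(real b - c)\<^sup>2 \<le> 1"
    by (simp_all add: abs_square_le_1)
  have "(real N)^3 - 27 * (real a * b * c)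
    = N * ((real a - b)\<^sup>2 + (real b - c)\<^sup>2 + (real a - c)\<^sup>2) / 2
      + 3 * (a * (real b - c)\<^sup>2 + b * (real a - c)\<^sup>2 + c * (real a - b)\<^sup>2)"
    unfolding N by (simp add: power2_eq_square power3_eq_cube field_simps)
  also have "\<dots> \<le> 27 * real N"
  proof -
    have "N * ((real a - b)\<^sup>2 + (real b - c)\<^sup>2 + (real a - c)\<^sup>2) \<le> real N * 3"
      using d by (intro mult_left_mono) linarith+
    moreover have "a * (real b - c)\<^sup>2 \<le> real a * 1" "b * (real a - c)\<^sup>2 \<le> real b * 1" "c * (real a - b)\<^sup>2 \<le> real c * 1"
      using d by (auto intro!: mult_left_mono simp del: mult_1_right)
    moreover have "0 \<le> real N" by simp
    moreover have "x / 2 + 3 * (p + q + r) \<le> 27 * m"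
      if "x \<le> m * 3" "p \<le> a * 1" "q \<le> b * 1" "r \<le> c * 1" "0 \<le> m" "m = a + b + c" for x p q r m a b c :: real
      using that by simp
    ultimately show ?thesis using N by blast
  qed
  finally have 1: "(real N)^3 / 27 - N \<le> real a * b * c" by simp
  have "0 \<le> (real a - b)\<^sup>2 + (real b - c)\<^sup>2 + (real a - c)\<^sup>2" by simp
  also have "\<dots> = 3 * ((real a)\<^sup>2 + (real b)\<^sup>2 + (real c)\<^sup>2) - (real N)\<^sup>2"
    unfolding N by (simp add: power2_eq_square algebra_simps)
  finally have "(real N)\<^sup>2 / 6 - N / 2 \<le> ((real a)\<^sup>2 + (real b)\<^sup>2 + (real c)\<^sup>2 - (a + b + c)) / 2"
    unfolding assms(2) by (simp add: field_simps)
  then have "t * ((real N)\<^sup>2 / 6 - N / 2) \<le> t * (((real a)\<^sup>2 + (real b)\<^sup>2 + (real c)\<^sup>2 - (a + b + c)) / 2)"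
    by (rule mult_left_mono) simp
  then show ?thesis using 1 unfolding real_part_count by simp
qed

text \<open>A part of size at most \<open>t\<close> leaves only a quadratic count, far below the
  cubic one of balanced parts. This excludes the regime in which \<open>part_count_move\<close> does
  not apply.\<close>

lemma part_count_small_part:
  assumes "c \<le> t" "a + b + c = N" shows "part_count t a b c \<le> 2 * t * N\<^sup>2"
proof -
  have sq: "a * b \<le> N\<^sup>2" using mult_le_mono[of a N b N] assms(2) by (simp add: power2_eq_square)
  have "a * b * c \<le> N\<^sup>2 * t" using mult_le_mono[OF sq assms(1)] .
  moreover have "(a choose 2) + (b choose 2) + (c choose 2) \<le> N\<^sup>2"
  proof -
    have ch: "k choose 2 \<le> k\<^sup>2" for k
      unfolding choose_two by (rule order_trans[OF div_le_dividend]) (simp add: power2_eq_square)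
    have "a\<^sup>2 + b\<^sup>2 + c\<^sup>2 \<le> N\<^sup>2" unfolding assms(2)[symmetric] by (simp add: power2_eq_square algebra_simps)
    then show ?thesis using ch[of a] ch[of b] ch[of c] by linarith
  qed
  then have "t * ((a choose 2) + (b choose 2) + (c choose 2)) \<le> t * N\<^sup>2" by (rule mult_le_mono2)
  moreover have "2 * t * N\<^sup>2 = N\<^sup>2 * t + t * N\<^sup>2" by simp
  ultimately show ?thesis unfolding part_count_def by linarith
qed

lemma balanced_exists:
  assumes "N \<ge> 3" obtains a b c where "balanced a b c" "a + b + c = N" "a > 0" "b > 0" "c > 0"
proof -
  define m where "m = N div 3"
  have m: "m > 0" using assms by (simp add: m_def div_greater_zero_iff)
  have "N = 3 * m \<or> N = 3 * m + 1 \<or> N = 3 * m + 2" unfolding m_def by linarith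
  then show thesis
    using that[of m m m] that[of "m + 1" m m] that[of "m + 1" "m + 1" m] m by (auto simp: balanced_def)
qed

lemma part_count_le_max:
  assumes "a > 0" "b > 0" "c > 0" "a + b + c = N"
  shows "part_count t a b c \<le> max_part_count t N"
    and "\<exists>a b c. a > 0 \<and> b > 0 \<and> c > 0 \<and> a + b + c = N \<and> part_count t a b c = max_part_count t N"
proof -
  define S where "S = {part_count t a b c | a b c. a > 0 \<and> b > 0 \<and> c > 0 \<and> a + b + c = N}"
  have "S \<subseteq> (\<lambda>(a, b, c). part_count t a b c) ` ({..N} \<times> {..N} \<times> {..N})"
  proof
    fix k assume "k \<in> S"
    then obtain x y z where k: "k = part_count t x y z" "x + y + z = N" by (auto simp: S_def)
    then show "k \<in> (\<lambda>(a, b, c). part_count t a b c) ` ({..N} \<times> {..N} \<times> {..N})"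
      by (intro image_eqI[of _ _ "(x, y, z)"]) auto
  qed
  then have fS: "finite S" by (rule finite_subset) auto
  have mem: "part_count t a b c \<in> S" using assms by (auto simp: S_def)
  have eq: "max_part_count t N = Max S" by (simp add: max_part_count_def S_def)
  show "part_count t a b c \<le> max_part_count t N" unfolding eq using fS mem by (rule Max_ge)
  have "Max S \<in> S" using fS mem by (intro Max_in) auto
  then obtain k where "k = Max S" "k \<in> S" by blast
  then show "\<exists>a b c. a > 0 \<and> b > 0 \<and> c > 0 \<and> a + b + c = N \<and> part_count t a b c = max_part_count t N"
    unfolding eq by (simp add: S_def) metis
qed

text \<open>\<open>N \<ge> 100 * (t + 1)\<close> lets \<open>N^3 / 27\<close> outweigh
  \<open>2 * t * N\<^sup>2\<close>, so all parts of a maximiser exceed \<open>t\<close>, and two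
  parts differing by 2 or more could be improved by a shift.\<close>

lemma max_attained_balanced:
  assumes N: "N \<ge> 100 * (t + 1)" and abc: "a > 0" "b > 0" "c > 0" "a + b + c = N"
    and mx: "part_count t a b c = max_part_count t N"
  shows "balanced a b c"
proof -
  have N3: "N \<ge> 3" using N by simp
  obtain a' b' c' where bal: "balanced a' b' c'" "a' + b' + c' = N" "a' > 0" "b' > 0" "c' > 0"
    using balanced_exists[OF N3] by blast
  have "2 * t * N\<^sup>2 < part_count t a' b' c'"
  proof -
    have "100 * (real t + 1) * (real N)\<^sup>2 \<le> real N * (real N)\<^sup>2" using N by (intro mult_right_mono) auto
    then have "100 * (t * (real N)\<^sup>2) + 100 * (real N)\<^sup>2 \<le> (real N)^3" by (simp add: power2_eq_square power3_eq_cube algebra_simps)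
    moreover have "100 * real N \<le> (real N)\<^sup>2" using N by (simp add: power2_eq_square)
    moreover have "real t * (real N)\<^sup>2 \<ge> t * (100 * real N)" using \<open>100 * real N \<le> (real N)\<^sup>2\<close> by (intro mult_left_mono) auto
    moreover have "real t * N \<ge> 0" by simp
    moreover have "real N > 0" using N by simp
    moreover have "t * ((real N)\<^sup>2 / 6 - N / 2) = t * (real N)\<^sup>2 / 6 - real t * real N / 2" by (simp add: field_simps)
    moreover have "t * (100 * real N) = 100 * (t * real N)" "real (2 * t * N\<^sup>2) = 2 * (t * (real N)\<^sup>2)" by simp_all
    ultimately have "real (2 * t * N\<^sup>2) < (real N)^3 / 27 - N + t * ((real N)\<^sup>2 / 6 - N / 2)" by linarith
    then have "real (2 * t * N\<^sup>2) < part_count t a' b' c'"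
      using balanced_part_count_lower[OF bal(1,2), of t] by linarith
    then show ?thesis by (simp only: of_nat_less_iff)
  qed
  also have "\<dots> \<le> part_count t a b c" unfolding mx using bal by (intro part_count_le_max(1)) auto
  finally have big: "2 * t * N\<^sup>2 < part_count t a b c" .
  have gt: "a > t" "b > t" "c > t"
    using part_count_small_part[of c t a b N] part_count_small_part[of b t a c N] part_count_small_part[of a t b c N]
      big abc(4) part_count_perm[of t] by (force simp: add_ac)+
  have no: False if xyz: "part_count t x y z = max_part_count t N" "z > t" "x + y + z = N" "y > 0" "z > 0" "x \<ge> y + 2" for x y z
  proof -
    define d where "d = x - y - 2"
    have x: "x = y + d + 2" using xyz(6) by (simp add: d_def)
    have "part_count t x y z < part_count t (y + d + 1) (y + 1) z" unfolding x by (rule part_count_move[OF xyz(2)])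
    also have "\<dots> \<le> max_part_count t N" using xyz x by (intro part_count_le_max(1)) auto
    finally show False using xyz(1) by simp
  qed
  have "\<not> a \<ge> b + 2" using no[of a b c] mx gt abc by auto
  moreover have "\<not> b \<ge> a + 2" using no[of b a c] mx gt abc by (auto simp: part_count_perm)
  moreover have "\<not> a \<ge> c + 2" using no[of a c b] mx gt abc by (auto simp: part_count_perm)
  moreover have "\<not> c \<ge> a + 2" using no[of c a b] mx gt abc part_count_perm[of t] by auto
  moreover have "\<not> b \<ge> c + 2" using no[of b c a] mx gt abc part_count_perm[of t] by auto
  moreover have "\<not> c \<ge> b + 2" using no[of c b a] mx gt abc part_count_perm[of t] by auto
  ultimately show ?thesis unfolding balanced_def by linarith
qed

lemma balanced_part_count_max:
  assumes N: "N \<ge> 100 * (t + 1)" and bal: "balanced a b c" "a + b + c = N"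
  shows "part_count t a b c = max_part_count t N"
proof -
  have N3: "N \<ge> 3" using N by simp
  obtain a' b' c' where "balanced a' b' c'" "a' + b' + c' = N" "a' > 0" "b' > 0" "c' > 0"
    using balanced_exists[OF N3] by blast
  then obtain x y z where xyz: "x > 0" "y > 0" "z > 0" "x + y + z = N" "part_count t x y z = max_part_count t N"
    using part_count_le_max(2)[of a' b' c' N t] by auto
  then have "balanced x y z" using max_attained_balanced[OF N] by blast
  then show ?thesis using balanced_part_count_eq[OF bal(1), of x y z t] xyz bal(2) by simp
qed

lemma balanced_floor_ceiling:
  assumes "balanced a b c" "a + b + c = N"
  shows "int a = \<lfloor>real N / 3\<rfloor> \<or> int a = \<lceil>real N / 3\<rceil>"
proof (cases "3 * a \<le> N")
  case True
  have "N \<le> 3 * a + 2" using assms unfolding balanced_def by linarith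
  then have "\<lfloor>real N / 3\<rfloor> = int a" using True by (intro floor_unique) auto
  then show ?thesis by simp
next
  case False
  have "3 * a \<le> N + 2" using assms unfolding balanced_def by linarith
  then have "\<lceil>real N / 3\<rceil> = int a" using False by (intro ceiling_unique) auto
  then show ?thesis by simp
qed

lemma T3_parts_iff:
  assumes d: "X \<inter> Y = {}" "X \<inter> Z = {}" "Y \<inter> Z = {}" and f: "finite X" "finite Y" "finite Z"
  shows "T3_parts N X Y Z \<longleftrightarrow> balanced (card X) (card Y) (card Z) \<and> card X + card Y + card Z = N"
proof -
  have c: "card (X \<union> Y \<union> Z) = card X + card Y + card Z"
    using d f by (simp add: card_Un_disjoint Int_Un_distrib2)
  show ?thesis
  proof
    assume T: "T3_parts N X Y Z"
    have "\<lceil>real N / 3\<rceil> \<le> \<lfloor>real N / 3\<rfloor> + 1" by linarith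
    moreover have "\<lfloor>real N / 3\<rfloor> \<le> \<lceil>real N / 3\<rceil>" by (rule floor_le_ceiling)
    ultimately show "balanced (card X) (card Y) (card Z) \<and> card X + card Y + card Z = N"
      using T c unfolding T3_parts_def balanced_def by auto
  next
    assume B: "balanced (card X) (card Y) (card Z) \<and> card X + card Y + card Z = N"
    then have "balanced (card Y) (card X) (card Z)" "balanced (card Z) (card X) (card Y)"
      unfolding balanced_def by auto
    then show "T3_parts N X Y Z"
      unfolding T3_parts_def using B balanced_floor_ceiling[of "card X" "card Y" "card Z" N]
        balanced_floor_ceiling[of "card Y" "card X" "card Z" N] balanced_floor_ceiling[of "card Z" "card X" "card Y" N] c d f
      by (simp add: add_ac)
  qed
qed

section \<open>The extremal graph and the main theorem\<close>

text \<open>Label \<open>X\<close>, \<open>Y\<close>, \<open>Z\<close>, \<open>Q\<close> by the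
  vectors (1,0), (0,1), (1,1), (0,0) over the field with two elements. \<open>X \<union> Z\<close>
  and \<open>Y \<union> Z\<close> are the supports of the two coordinates, and every edge has label
  sum zero.\<close>

lemma extremal_edge_parity:
  assumes d: "X \<inter> Y = {}" "X \<inter> Z = {}" "Y \<inter> Z = {}" "Q \<inter> (X \<union> Y \<union> Z) = {}"
    and e: "e \<in> extremal_edges X Y Z Q" and S: "S = X \<union> Z \<or> S = Y \<union> Z"
  shows "even (card (e \<inter> S))" and "e \<subseteq> X \<union> Y \<union> Z \<union> Q"
proof -
  have "(\<exists>x y z. e = {x, y, z} \<and> x \<in> X \<and> y \<in> Y \<and> z \<in> Z) \<or> e \<subseteq> Q \<or>
      (\<exists>q x y P. e = {q, x, y} \<and> q \<in> Q \<and> x \<noteq> y \<and> (P = X \<or> P = Y \<or> P = Z) \<and> x \<in> P \<and> y \<in> P)"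
    using e unfolding extremal_edges_def complete_3partite_edges_def by blast
  then consider (1) x y z where "e = {x, y, z}" "x \<in> X" "y \<in> Y" "z \<in> Z"
    | (2) "e \<subseteq> Q"
    | (3) q x y P where "e = {q, x, y}" "q \<in> Q" "x \<noteq> y" "P = X \<or> P = Y \<or> P = Z" "x \<in> P" "y \<in> P"
    by blast
  then have "even (card (e \<inter> S)) \<and> e \<subseteq> X \<union> Y \<union> Z \<union> Q"
  proof cases
    case 1
    have "e \<inter> S = {x, z} \<and> x \<noteq> z \<or> e \<inter> S = {y, z} \<and> y \<noteq> z" using S 1 d by blast
    then show ?thesis using 1 by auto
  next
    case 2
    have "e \<inter> S = {}" using S 2 d(4) by blast
    then show ?thesis using 2 by auto
  next
    case 3
    have "e \<inter> S = {x, y} \<or> e \<inter> S = {}" using S 3 d by blast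
    then show ?thesis using 3 by auto
  qed
  then show "even (card (e \<inter> S))" "e \<subseteq> X \<union> Y \<union> Z \<union> Q" by auto
qed

lemma even_card_Int_triple:
  assumes "even (card ({u, v, w} \<inter> S))" "u \<noteq> v" "u \<noteq> w" "v \<noteq> w"
  shows "w \<in> S \<longleftrightarrow> (u \<in> S \<longleftrightarrow> v \<notin> S)"
  using assms by (cases "u \<in> S"; cases "v \<in> S"; cases "w \<in> S") (simp_all add: Int_insert_left)

text \<open>Every edge of the extremal graph meets \<open>X \<union> Z\<close> and \<open>Y \<union> Z\<close> in an even number of vertices. In a
  copy of \<open>F_sim\<close> this parity forces \<open>f\<^sub>5\<close> and all \<open>g\<^sub>i\<close> into \<open>Q\<close>.\<close>

lemma extremal_edges_free:
  assumes d: "X \<inter> Y = {}" "X \<inter> Z = {}" "Y \<inter> Z = {}" "Q \<inter> (X \<union> Y \<union> Z) = {}"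
    and Q: "finite Q" "card Q \<le> t"
  shows "\<not> contains_copy (V, extremal_edges X Y Z Q) (F_sim t)"
proof
  assume "contains_copy (V, extremal_edges X Y Z Q) (F_sim t)"
  then obtain \<phi> where inj: "inj_on \<phi> (verts (F_sim t))"
    and ed: "\<And>e. e \<in> hedges (F_sim t) \<Longrightarrow> \<phi> ` e \<in> extremal_edges X Y Z Q"
    unfolding contains_copy_def by auto
  define f where "f i = \<phi> (Vf i)" for i
  define g where "g i = \<phi> (Vg i)" for i
  have V: "Vf i \<in> verts (F_sim t)" if "i \<in> {1..7}" for i using that by (simp add: F_sim_def)
  have Vg: "Vg i \<in> verts (F_sim t)" if "i \<in> {1..t}" for i using that by (simp add: F_sim_def)
  have ff: "f i \<noteq> f j" if "i \<in> {1..7}" "j \<in> {1..7}" "i \<noteq> j" for i j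
    using inj_onD[OF inj _ V[OF that(1)] V[OF that(2)]] that(3) by (auto simp: f_def)
  have fg: "f i \<noteq> g j" if "i \<in> {1..7}" "j \<in> {1..t}" for i j
    using inj_onD[OF inj _ V[OF that(1)] Vg[OF that(2)]] by (auto simp: f_def g_def)
  have gg: "inj_on g {1..t}"
    using inj_onD[OF inj _ Vg Vg] by (auto simp: inj_on_def g_def)
  have e: "{f 1, f 2, f 3} \<in> extremal_edges X Y Z Q" "{f 1, f 2, f 4} \<in> extremal_edges X Y Z Q"
    "{f 3, f 4, f 5} \<in> extremal_edges X Y Z Q" "{f 5, f 6, f 7} \<in> extremal_edges X Y Z Q"
    using ed[of "{Vf 1, Vf 2, Vf 3}"] ed[of "{Vf 1, Vf 2, Vf 4}"] ed[of "{Vf 3, Vf 4, Vf 5}"] ed[of "{Vf 5, Vf 6, Vf 7}"]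
    by (simp_all add: F_sim_def f_def)
  have eg: "{f 6, f 7, g i} \<in> extremal_edges X Y Z Q" if "i \<in> {1..t}" for i
    using ed[of "{Vf 6, Vf 7, Vg i}"] that by (auto simp: F_sim_def f_def g_def insert_commute)
  have par: "w \<in> S \<longleftrightarrow> (u \<in> S \<longleftrightarrow> v \<notin> S)"
    if "{u, v, w} \<in> extremal_edges X Y Z Q" "S = X \<union> Z \<or> S = Y \<union> Z" "u \<noteq> v" "u \<noteq> w" "v \<noteq> w" for u v w S
    using even_card_Int_triple[OF extremal_edge_parity(1)[OF d that(1,2)] that(3-5)] .
  \<comment> \<open>\<open>f 3\<close> and \<open>f 4\<close> both have the label sum of
    \<open>f 1\<close> and \<open>f 2\<close>, so they agree; hence \<open>f 5\<close> has label
    zero, and \<open>f 6\<close>, \<open>f 7\<close> agree, which forces each \<open>g i\<close> to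
    zero as well.\<close>
  have f5: "f 5 \<notin> S \<and> (f 6 \<in> S \<longleftrightarrow> f 7 \<in> S)" if S: "S = X \<union> Z \<or> S = Y \<union> Z" for S
  proof -
    have "f 3 \<in> S \<longleftrightarrow> f 4 \<in> S" using par[OF e(1) S] par[OF e(2) S] ff by simp
    moreover have "f 5 \<in> S \<longleftrightarrow> (f 3 \<in> S \<longleftrightarrow> f 4 \<notin> S)" using par[OF e(3) S] ff by simp
    moreover have "f 7 \<in> S \<longleftrightarrow> (f 5 \<in> S \<longleftrightarrow> f 6 \<notin> S)" using par[OF e(4) S] ff by simp
    ultimately show ?thesis by blast
  qed
  have "f 5 \<in> X \<union> Y \<union> Z \<union> Q" using extremal_edge_parity(2)[OF d e(4)] by auto
  then have "f 5 \<in> Q" using f5[of "X \<union> Z"] f5[of "Y \<union> Z"] by auto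
  moreover have "g i \<in> Q" if i: "i \<in> {1..t}" for i
  proof -
    have "g i \<notin> S" if S: "S = X \<union> Z \<or> S = Y \<union> Z" for S
      using par[OF eg[OF i] S] f5[OF S] ff[of 6 7] fg[of 6 i] fg[of 7 i] i by auto
    moreover have "g i \<in> X \<union> Y \<union> Z \<union> Q" using extremal_edge_parity(2)[OF d eg[OF i]] by auto
    ultimately show ?thesis by blast
  qed
  ultimately have sub: "insert (f 5) (g ` {1..t}) \<subseteq> Q" by auto
  have "f 5 \<notin> g ` {1..t}" using fg[of 5] by force
  then have "card (insert (f 5) (g ` {1..t})) = Suc t" using gg by (simp add: card_image)
  then show False using card_mono[OF Q(1) sub] Q(2) by simp
qed

text \<open>Passing from \<open>n\<close> to \<open>n - t\<close> costs
  \<open>t * n\<^sup>2 / 9\<close> in the cubic term, the same-part edges bring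
  \<open>t * n\<^sup>2 / 6\<close>; the balance is \<open>t * n\<^sup>2 / 18\<close>, and the linear
  term takes up the lower orders.\<close>

lemma extremal_number_lower:
  assumes "N = n - t" "t \<le> n" "N \<ge> 100 * (t + 1)"
  shows "(real n)^3 / 27 + t * (real n)\<^sup>2 / 18 - (1 + real t + (real t)\<^sup>2) * real n \<le> max_part_count t N"
proof -
  have "N \<ge> 3" using assms(3) by simp
  then obtain a b c where bal: "balanced a b c" "a + b + c = N" "a > 0" "b > 0" "c > 0"
    using balanced_exists by blast
  define x y where "x = real n" and "y = real t"
  have xy: "0 \<le> y" "y \<le> x" "real N = x - y" using assms by (simp_all add: x_def y_def of_nat_diff)
  have "(x - y)^3 / 27 - (x - y) + y * ((x - y)\<^sup>2 / 6 - (x - y) / 2) \<le> max_part_count t N"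
    using balanced_part_count_lower[OF bal(1,2), of t] part_count_le_max(1)[OF bal(3-5,2), of t]
    unfolding xy(3) y_def by linarith
  moreover have "(x - y)^3 / 27 - (x - y) + y * ((x - y)\<^sup>2 / 6 - (x - y) / 2)
      - (x^3 / 27 + y * x\<^sup>2 / 18 - (1 + y + y\<^sup>2) * x) = x * y / 2 + 7 / 9 * (x * y\<^sup>2) + (7 / 54 * y^3 + y\<^sup>2 / 2 + y)"
    by (simp add: power2_eq_square power3_eq_cube field_simps)
  moreover have "\<dots> \<ge> 0" using xy by simp
  ultimately show ?thesis unfolding x_def y_def by linarith
qed

lemma is_extremal_graph_iff:
  "is_extremal_graph t n (V, E) \<longleftrightarrow> (\<exists>X Y Z Q. T3_parts (n - t) X Y Z \<and> finite Q \<and> card Q = t \<and>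
     Q \<inter> (X \<union> Y \<union> Z) = {} \<and> V = X \<union> Y \<union> Z \<union> Q \<and> E = extremal_edges X Y Z Q)"
  by (simp add: is_extremal_graph_def extremal_edges_def)

lemma extremal_graph_card:
  assumes ex: "is_extremal_graph t n (V, E)" and N: "n - t \<ge> 100 * (t + 1)"
  shows "card E = max_part_count t (n - t) + (t choose 3)"
proof -
  obtain X Y Z Q where P: "T3_parts (n - t) X Y Z" "finite Q" "card Q = t" "Q \<inter> (X \<union> Y \<union> Z) = {}"
    "E = extremal_edges X Y Z Q" using ex unfolding is_extremal_graph_iff by blast
  then have d: "X \<inter> Y = {}" "X \<inter> Z = {}" "Y \<inter> Z = {}" and f: "finite X" "finite Y" "finite Z"
    by (auto simp: T3_parts_def)
  have "balanced (card X) (card Y) (card Z)" "card X + card Y + card Z = n - t"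
    using P(1) T3_parts_iff[OF d f] by auto
  then have "part_count t (card X) (card Y) (card Z) = max_part_count t (n - t)"
    by (rule balanced_part_count_max[OF N])
  then show ?thesis using card_extremal_edges(1)[OF f P(2) d P(4)] P(3,5) by simp
qed

text \<open>Once \<open>E\<close> is known to be an extremal edge set with parts of unknown sizes,
  its exact size lies between the maximum and itself, so the part sizes attain the maximum and must
  be balanced.\<close>

lemma dense_free_extremal:
  assumes t: "t \<ge> 1"
  shows "\<exists>n0. \<forall>V E :: 'a set set. three_graph (V, E) \<and> card V \<ge> n0 \<and> \<not> contains_copy (V, E) (F_sim t) \<and>
    max_part_count t (card V - t) + (t choose 3) \<le> card E \<longrightarrow> is_extremal_graph t (card V) (V, E)"
proof -
  \<comment> \<open>The largest value allowed by \<open>s1\<close>; \<open>\<eta>\<close> is then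
    fixed by \<open>3 * \<eta> = \<sigma>\<^sup>2 / 12\<close>, which matches the loss in
    \<open>maximal_core_exists\<close> with the assumption \<open>T\<close>.\<close>
  define \<sigma> where "\<sigma> = 1 / (1000 * (real t + 1))"
  define \<eta> where "\<eta> = \<sigma>\<^sup>2 / 36"
  obtain n1 :: nat where n1: "(27 * (t + 5) + 2) / \<eta>\<^sup>2 \<le> n1" using real_arch_simple by blast
  have s: "0 < \<sigma>" "\<sigma> * (1000 * (t + 1)) \<le> 1" by (simp_all add: \<sigma>_def field_simps)
  have "\<sigma> \<le> 1" using t by (simp add: \<sigma>_def field_simps)
  then have s2: "\<sigma>\<^sup>2 \<le> \<sigma>" using s(1) mult_left_mono[of \<sigma> 1 \<sigma>] by (simp add: power2_eq_square)
  have "\<sigma> \<le> 1 / 2000" using t by (simp add: \<sigma>_def field_simps)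
  then have eta: "0 < \<eta>" "\<eta> \<le> 1 / 1000" using s s2 by (simp_all add: \<eta>_def)
  show ?thesis
  proof (intro exI[of _ "n1 + 1000000 * (t + 1)\<^sup>2"] allI impI, elim conjE)
    fix V :: "'a set" and E :: "'a set set"
    assume tg: "three_graph (V, E)" and big: "n1 + 1000000 * (t + 1)\<^sup>2 \<le> card V"
      and fr: "\<not> contains_copy (V, E) (F_sim t)"
      and e: "max_part_count t (card V - t) + (t choose 3) \<le> card E"
    define n where "n = real (card V)"
    have "(t + 1) * 1 \<le> (t + 1)\<^sup>2" unfolding power2_eq_square by (intro mult_left_mono) auto
    then have lin: "1000000 * (t + 1) \<le> card V" using big by linarith
    then have tn: "t \<le> card V" and N: "100 * (t + 1) \<le> card V - t" by simp_all
    have "real (1000000 * (t + 1)\<^sup>2) \<le> n" unfolding n_def using big by (simp only: of_nat_le_iff)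
    then have n6: "1000000 * (real t + 1)\<^sup>2 \<le> n" by (simp add: add.commute)
    have "real (1000000 * (t + 1)) \<le> n" unfolding n_def using lin by (simp only: of_nat_le_iff)
    then have nl: "1000000 * (real t + 1) \<le> n" by simp
    have "\<sigma> * (1000000 * (real t + 1)) \<le> \<sigma> * n" using s nl by (intro mult_left_mono) auto
    moreover have "\<sigma> * (1000000 * (real t + 1)) = 1000" by (simp add: \<sigma>_def field_simps)
    ultimately have sn: "100 \<le> \<sigma> * n" by simp
    have low: "n^3 / 27 + t * n\<^sup>2 / 18 - (1 + real t + (real t)\<^sup>2) * n \<le> card E"
      using extremal_number_lower[OF refl tn N] e unfolding n_def by linarith
    \<comment> \<open>The second-order gain outweighs the linear error, so \<open>E\<close> has at
      least \<open>n^3 / 27\<close> edges, as the core construction requires.\<close>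
    have "(1 + real t + (real t)\<^sup>2) * n \<le> t * n\<^sup>2 / 18"
    proof -
      have "1 + real t + (real t)\<^sup>2 \<le> (real t + 1)\<^sup>2" by (simp add: power2_eq_square algebra_simps)
      also have "\<dots> \<le> n / 18" using n6 zero_le_power2[of "real t + 1"] by linarith
      finally have "(1 + real t + (real t)\<^sup>2) * n \<le> n / 18 * n" by (intro mult_right_mono) (auto simp: n_def)
      also have "\<dots> = 1 * (n\<^sup>2 / 18)" by (simp add: power2_eq_square)
      also have "\<dots> \<le> t * (n\<^sup>2 / 18)" using t by (intro mult_right_mono) auto
      finally show ?thesis by simp
    qed
    then have e3: "n^3 \<le> 27 * real (card E)" using low by linarith
    have n2: "(27 * (real t + 5) + 2) / \<eta>\<^sup>2 \<le> card V" using n1 big by simp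
    obtain A B C where core: "core V E A B C"
      and T: "(1 / 27 - 3 * \<eta>) * (real (card V))^3 \<le> card (transversals E A B C)"
      and maxi: "\<And>w. w \<in> V - (A \<union> B \<union> C) \<Longrightarrow> 10 * real (card (link E w \<inter> B \<times> C)) < (real (card V))\<^sup>2 \<and>
       10 * real (card (link E w \<inter> A \<times> C)) < (real (card V))\<^sup>2 \<and> 10 * real (card (link E w \<inter> A \<times> B)) < (real (card V))\<^sup>2"
      by (rule maximal_core_exists[OF tg fr eta e3[unfolded n_def] n2]) (rule that; assumption)
    interpret tricore t V E A B C \<sigma>
    proof
      show "(1 / 27 - \<sigma>\<^sup>2 / 12) * (real (card V))^3 \<le> card (transversals E A B C)"
        using T by (simp add: \<eta>_def)
    qed (use tg fr core t s maxi n6 sn in \<open>auto simp: n_def\<close>)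
    note W = W_eq_Q[OF low[unfolded n_def]]
    have "real (card A + card B + card C) = real (card V - t)"
      using card_W(1) W(2) tn by (simp add: of_nat_diff)
    then have sum: "card A + card B + card C = card V - t" by (simp only: of_nat_eq_iff)
    have pos: "card A > 0" "card B > 0" "card C > 0"
      using card_A_bounds(1) tricore.card_A_bounds(1)[OF swap] tricore.card_A_bounds(1)[OF tricore.swap[OF swap']] n_ge
      by (auto intro: gr0I)
    have le: "part_count t (card A) (card B) (card C) \<le> max_part_count t (card V - t)"
      using pos sum by (rule part_count_le_max(1))
    have E: "E = extremal_edges A B C W"
      using le e by (intro extremal_structure W) simp
    have dW: "W \<inter> (A \<union> B \<union> C) = {}" using fin_W by auto
    have "card E = part_count t (card A) (card B) (card C) + (t choose 3)"
      using card_extremal_edges(1)[OF fin(2-4) fin_W(1) dis dW] W(2) E by simp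
    then have "part_count t (card A) (card B) (card C) = max_part_count t (card V - t)" using e le by simp
    then have "balanced (card A) (card B) (card C)" by (rule max_attained_balanced[OF N pos sum])
    then have "T3_parts (card V - t) A B C" using T3_parts_iff[OF dis fin(2-4)] sum by blast
    moreover have "V = A \<union> B \<union> C \<union> W" using sub by (auto simp: W_def)
    ultimately show "is_extremal_graph t (card V) (V, E)"
      unfolding is_extremal_graph_iff using E W(2) fin_W(1) dW by blast
  qed
qed

lemma extremal_graph_exists:
  assumes "t \<le> n" "n - t \<ge> 3"
  shows "\<exists>E. three_graph ({..<n}, E) \<and> \<not> contains_copy ({..<n}, E) (F_sim t) \<and> is_extremal_graph t n ({..<n}, E)"
proof -
  obtain a b c where bal: "balanced a b c" "a + b + c = n - t"
    using balanced_exists[OF assms(2)] by blast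
  define X Y Z Q where "X = {..<a}" and "Y = {a..<a + b}" and "Z = {a + b..<a + b + c}" and "Q = {a + b + c..<n}"
  have d: "X \<inter> Y = {}" "X \<inter> Z = {}" "Y \<inter> Z = {}" "Q \<inter> (X \<union> Y \<union> Z) = {}"
    by (auto simp: X_def Y_def Z_def Q_def)
  have f: "finite X" "finite Y" "finite Z" "finite Q" by (auto simp: X_def Y_def Z_def Q_def)
  have c: "card X = a" "card Y = b" "card Z = c" "card Q = t"
    using assms(1) bal(2) by (auto simp: X_def Y_def Z_def Q_def)
  have V: "{..<n} = X \<union> Y \<union> Z \<union> Q"
    using assms(1) bal(2) by (auto simp: X_def Y_def Z_def Q_def)
  have "T3_parts (n - t) X Y Z" using T3_parts_iff[OF d(1-3) f(1-3)] bal c by simp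
  then have "is_extremal_graph t n ({..<n}, extremal_edges X Y Z Q)"
    unfolding is_extremal_graph_iff using f d c V by blast
  moreover have "three_graph ({..<n}, extremal_edges X Y Z Q)"
    unfolding three_graph_def
  proof (intro conjI ballI)
    fix e assume "e \<in> hedges ({..<n}, extremal_edges X Y Z Q)"
    then have e: "e \<in> extremal_edges X Y Z Q" by simp
    show "e \<subseteq> verts ({..<n}, extremal_edges X Y Z Q)" using extremal_edge_parity(2)[OF d e] V by auto
    show "card e = 3"
      using e d unfolding extremal_edges_def complete_3partite_edges_def by (auto simp: card_3_distinct)
  qed simp
  moreover have "\<not> contains_copy ({..<n}, extremal_edges X Y Z Q) (F_sim t)"
    using extremal_edges_free[OF d f(4)] c(4) by simp
  ultimately show ?thesis by blast
qed

theorem theorem1p3: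
  fixes t :: nat
  assumes "t \<ge> 1"
  shows "\<exists>n0. \<forall>n\<ge>n0.
    ex3 n (F_sim t) = max_part_count t (n - t) + (t choose 3) \<and>
    (\<forall>a b c. a > 0 \<and> b > 0 \<and> c > 0 \<and> a + b + c = n - t \<and>
        \<bar>int a - int b\<bar> \<le> 1 \<and> \<bar>int a - int c\<bar> \<le> 1 \<and> \<bar>int b - int c\<bar> \<le> 1 \<longrightarrow>
        part_count t a b c = max_part_count t (n - t)) \<and>
    (\<forall>H :: 'a hypergraph.
        three_graph H \<and> card (verts H) = n \<and> \<not> contains_copy H (F_sim t) \<longrightarrow>
        (card (hedges H) = max_part_count t (n - t) + (t choose 3) \<longleftrightarrow>
         is_extremal_graph t n H))"
proof -
  \<comment> \<open>\<open>ex3\<close> speaks of graphs on natural numbers, the uniqueness claim of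
    graphs over \<open>'a\<close>; the structure result is taken at both types and the thresholds
    are added.\<close>
  obtain n1 where n1: "\<And>V (E :: nat set set). three_graph (V, E) \<Longrightarrow> card V \<ge> n1 \<Longrightarrow> \<not> contains_copy (V, E) (F_sim t) \<Longrightarrow>
    max_part_count t (card V - t) + (t choose 3) \<le> card E \<Longrightarrow> is_extremal_graph t (card V) (V, E)"
    using dense_free_extremal[OF assms, where 'a = nat] by blast
  obtain n2 where n2: "\<And>V (E :: 'a set set). three_graph (V, E) \<Longrightarrow> card V \<ge> n2 \<Longrightarrow> \<not> contains_copy (V, E) (F_sim t) \<Longrightarrow>
    max_part_count t (card V - t) + (t choose 3) \<le> card E \<Longrightarrow> is_extremal_graph t (card V) (V, E)"
    using dense_free_extremal[OF assms, where 'a = 'a] by blast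
  show ?thesis
  proof (intro exI[of _ "n1 + n2 + t + 100 * (t + 1)"] allI impI conjI)
    fix n assume n: "n1 + n2 + t + 100 * (t + 1) \<le> n"
    then have N: "100 * (t + 1) \<le> n - t" and tn: "t \<le> n" by simp_all
    define M where "M = max_part_count t (n - t) + (t choose 3)"
    define S where "S = {card (hedges H) | H :: nat hypergraph.
      three_graph H \<and> verts H = {..<n} \<and> \<not> contains_copy H (F_sim t)}"
    have "S \<subseteq> card ` Pow (Pow {..<n})"
      by (force simp: S_def three_graph_def)
    then have fS: "finite S" by (rule finite_subset) auto
    obtain E where E: "three_graph ({..<n}, E)" "\<not> contains_copy ({..<n}, E) (F_sim t)" "is_extremal_graph t n ({..<n}, E)"
      using extremal_graph_exists[OF tn] N by auto
    then have "card E = M" unfolding M_def using extremal_graph_card[OF _ N] by blast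
    then have "M \<in> S" unfolding S_def using E by force
    \<comment> \<open>A free graph with more than \<open>M\<close> edges would satisfy the
      hypotheses of \<open>n1\<close>, hence be extremal and have exactly \<open>M\<close>
      edges.\<close>
    moreover have "k \<le> M" if kS: "k \<in> S" for k
    proof (rule ccontr)
      assume k: "\<not> k \<le> M"
      obtain V F where F: "k = card F" "three_graph (V, F)" "V = {..<n}" "\<not> contains_copy (V, F) (F_sim t)"
        using kS unfolding S_def by auto
      then have "is_extremal_graph t n (V, F)" using n1[of V F] k n by (simp add: M_def)
      then have "k = M" unfolding M_def F(1) by (rule extremal_graph_card[OF _ N])
      then show False using k by simp
    qed
    ultimately have "Max S = M" using fS by (intro Max_eqI) auto
    then show "ex3 n (F_sim t) = max_part_count t (n - t) + (t choose 3)"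
      unfolding ex3_def S_def M_def .
  next
    fix n a b c assume "n1 + n2 + t + 100 * (t + 1) \<le> n"
      "a > 0 \<and> b > 0 \<and> c > 0 \<and> a + b + c = n - t \<and>
        \<bar>int a - int b\<bar> \<le> 1 \<and> \<bar>int a - int c\<bar> \<le> 1 \<and> \<bar>int b - int c\<bar> \<le> 1"
    then show "part_count t a b c = max_part_count t (n - t)"
      by (intro balanced_part_count_max) (auto simp: balanced_def)
  next
    fix n and H :: "'a hypergraph"
    assume n: "n1 + n2 + t + 100 * (t + 1) \<le> n"
      and H: "three_graph H \<and> card (verts H) = n \<and> \<not> contains_copy H (F_sim t)"
    have N: "100 * (t + 1) \<le> n - t" using n by simp
    obtain V E where VE: "H = (V, E)" by (cases H) auto
    show "card (hedges H) = max_part_count t (n - t) + (t choose 3) \<longleftrightarrow> is_extremal_graph t n H"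
      using n2[of V E] H n extremal_graph_card[OF _ N, of V E] unfolding VE by auto
  qed
qed

end
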